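(* Suppose $1<p<\infty$, $r>0$, $\alpha>-1$ and $\mu$ is a positive Borel measure on $T_B$. Then the following conditions are equivalent: (1) $\mu$ is a vanishing Carleson measure for $A_\alpha^p(T_B)$. (2) $\displaystyle\lim_{a\to\partial\widehat{T_B}}\int_{T_B}\frac{\rho(a)^{n+\alpha+1}}{|\rho(z,a)|^{2(n+\alpha+1)}}\,d\mu(z)=0$. (3) $\displaystyle\lim_{a\to\partial\widehat{T_B}}\frac{\mu(D(a,r))}{\rho(a)^{n+\alpha+1}}=0$. (4) For $\{a_k\}$ an $r$-lattice in the Bergman metric, $\displaystyle\lim_{k\to\infty}\frac{\mu(D(a_k,r))}{\rho(a_k)^{n+\alpha+1}}=0$.
   Context: For $z=(z',z_n)\in\mathbb{C}^n$ with $z'=(z_1,\dots,z_{n-1})$, write $z'^2=z_1^2+\cdots+z_{n-1}^2$. Let $B=\{(y',y_n)\in\mathbb{R}^n: y_1^2+\cdots+y_{n-1}^2<y_n\}$ and $T_B=\{x+iy\in\mathbb{C}^n: x\in\mathbb{R}^n,\ y\in B\}$. Put $\rho(z,w)=\frac14\left((z'-\overline{w'})^2-2i(z_n-\overline{w_n})\right)$ and $\rho(z)=\rho(z,z)=y_n-y'^2$ for $z=x+iy$. For $\alpha>-1$ let $dV_\alpha(z)=\rho(z)^\alpha dV(z)$ with $dV$ Lebesgue measure on $\mathbb{C}^n$; $\|f\|_{p,\alpha}=\left(\int_{T_B}|f|^p\,dV_\alpha\right)^{1/p}$, and $A_\alpha^p(T_B)$ is the space of holomorphic $f$ on $T_B$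 with $\|f\|_{p,\alpha}<\infty$. The Bergman metric on $T_B$ is $\beta(z,w)=\tanh^{-1}\sqrt{1-\frac{\rho(z)\rho(w)}{|\rho(z,w)|^2}}$, and $D(z,r)=\{w\in T_B:\beta(z,w)<r\}$. An $r$-lattice in the Bergman metric is a sequence $\{a_k\}_{k\ge1}$ in $T_B$ such that $T_B=\bigcup_k D(a_k,r)$, the sets $D(a_k,r/4)$ are mutually disjoint, and there is an integer $N$ such that each point of $T_B$ belongs to at most $N$ of the sets $D(a_k,2r)$. $\partial\widehat{T_B}=\partial T_B\cup\{\infty\}$, where $\partial T_B=\{z\in\mathbb{C}^n:\rho(z)=0\}$; $a\to\partial\widehat{T_B}$ means $\rho(a)\to0$ or $|a|\to\infty$. A positive Borel measure $\mu$ on $T_B$ is a vanishing Carleson measure for $A_\alpha^p(T_B)$ if $\lim_{k\to\infty}\int_{T_B}|f_k|^p\,d\mu=0$ for every bounded sequence $\{f_k\}$ in $A_\alpha^p(T_B)$ that converges to $0$ uniformly on every compact subset of $T_B$.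
   Formalization: The positive Borel measure μ is additionally assumed finite on compact subsets of T_B; without this the claim fails, e.g. for μ = ∞ times a point mass at z_0, where (3) and (4) hold but (1) and (2) do not. *)

theory Defs
  imports "HOL-Analysis.Analysis"
begin

text \<open>
  \<open>\<complex>\<^sup>n\<close> is \<open>complex ^ 'n\<close> with \<open>n = CARD('n)\<close>; the index type is linearly ordered only so that
  there is a last coordinate \<open>z\<^sub>n\<close>.
\<close>

definition last_ix :: "'n::{finite,linorder}" where
  "last_ix = Max UNIV"

definition base_B :: "(real ^ 'n::{finite,linorder}) set" where
  "base_B = {y. (\<Sum>j\<in>UNIV - {last_ix}. (y $ j)\<^sup>2) < y $ last_ix}"

definition tube_B :: "(complex ^ 'n::{finite,linorder}) set" where
  "tube_B = {z. (\<chi> j. Im (z $ j)) \<in> base_B}"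

definition rho2 :: "complex ^ 'n::{finite,linorder} \<Rightarrow> complex ^ 'n::{finite,linorder} \<Rightarrow> complex" where
  "rho2 z w = ((\<Sum>j\<in>UNIV - {last_ix}. (z $ j - cnj (w $ j))\<^sup>2)
                 - 2 * \<i> * (z $ last_ix - cnj (w $ last_ix))) / 4"

definition rho :: "complex ^ 'n::{finite,linorder} \<Rightarrow> real" where
  "rho z = Im (z $ last_ix) - (\<Sum>j\<in>UNIV - {last_ix}. (Im (z $ j))\<^sup>2)"

lemma rho2_diag: "rho2 z z = complex_of_real (rho z)"
proof -
  have d: "u - cnj u = 2 * \<i> * complex_of_real (Im u)" for u
    by (simp add: complex_eq_iff)
  have "(\<Sum>j\<in>UNIV - {last_ix}. (z $ j - cnj (z $ j))\<^sup>2)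
      = - 4 * complex_of_real (\<Sum>j\<in>UNIV - {last_ix}. (Im (z $ j))\<^sup>2)"
    by (simp add: d power_mult_distrib sum_distrib_left sum_negf)
  then show ?thesis
    by (simp add: rho2_def rho_def d field_simps flip: of_real_power)
qed

lemma mem_tube_B_iff: "z \<in> tube_B \<longleftrightarrow> rho z > 0"
  by (auto simp: tube_B_def base_B_def rho_def)

text \<open>Holomorphy in several variables: Frechet differentiable with complex-linear derivative.\<close>

definition holomorphic_vec_on :: "(complex ^ 'n \<Rightarrow> complex) \<Rightarrow> (complex ^ 'n) set \<Rightarrow> bool" where
  "holomorphic_vec_on f S \<longleftrightarrow>
     (\<forall>z\<in>S. \<exists>f'. (f has_derivative f') (at z within S) \<and> (\<forall>c v. f' (c *s v) = c * f' v))"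

definition dV :: "real \<Rightarrow> (complex ^ 'n::{finite,linorder}) measure" where
  "dV \<alpha> = density (restrict_space lborel tube_B) (\<lambda>z. ennreal (rho z powr \<alpha>))"

definition bergman_norm ::
    "real \<Rightarrow> real \<Rightarrow> (complex ^ 'n::{finite,linorder} \<Rightarrow> complex) \<Rightarrow> real" where
  "bergman_norm p \<alpha> f = (\<integral>z. norm (f z) powr p \<partial>dV \<alpha>) powr (1 / p)"

text \<open>Elements are functions on all of \<open>\<complex>\<^sup>n\<close>; their values outside \<open>tube_B\<close> play no role.\<close>

definition bergman_space ::
    "real \<Rightarrow> real \<Rightarrow> (complex ^ 'n::{finite,linorder} \<Rightarrow> complex) set" where
  "bergman_space p \<alpha> =
     {f. holomorphic_vec_on f tube_B \<and> integrable (dV \<alpha>) (\<lambda>z. norm (f z) powr p)}"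

definition bergman_dist :: "complex ^ 'n::{finite,linorder} \<Rightarrow> complex ^ 'n::{finite,linorder} \<Rightarrow> real" where
  "bergman_dist z w = artanh (sqrt (1 - rho z * rho w / (norm (rho2 z w))\<^sup>2))"

definition bergman_ball ::
    "complex ^ 'n::{finite,linorder} \<Rightarrow> real \<Rightarrow> (complex ^ 'n::{finite,linorder}) set" where
  "bergman_ball z r = {w \<in> tube_B. bergman_dist z w < r}"

definition bergman_lattice ::
    "real \<Rightarrow> (nat \<Rightarrow> complex ^ 'n::{finite,linorder}) \<Rightarrow> bool" where
  "bergman_lattice r a \<longleftrightarrow>
     range a \<subseteq> tube_B \<and>
     tube_B = (\<Union>k. bergman_ball (a k) r) \<and>
     disjoint_family (\<lambda>k. bergman_ball (a k) (r / 4)) \<and>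
     (\<exists>N. \<forall>z\<in>tube_B. finite {k. z \<in> bergman_ball (a k) (2 * r)} \<and>
                      card {k. z \<in> bergman_ball (a k) (2 * r)} \<le> N)"

text \<open>
  The filter of \<open>a \<rightarrow> \<partial>\<close> in the one-point compactified sense, for \<open>a\<close> in \<open>tube_B\<close>. Being a
  supremum, it makes a limit along it a limit both as \<open>\<rho>(a) \<rightarrow> 0\<close> and as \<open>|a| \<rightarrow> \<infinity>\<close>.
\<close>

definition to_boundary :: "(complex ^ 'n::{finite,linorder}) filter" where
  "to_boundary =
     inf (sup (filtercomap rho (nhds 0)) at_infinity) (principal tube_B)"

definition vanishing_carleson ::
    "real \<Rightarrow> real \<Rightarrow> (complex ^ 'n::{finite,linorder}) measure \<Rightarrow> bool" where
  "vanishing_carleson p \<alpha> \<mu> \<longleftrightarrow>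
     (\<forall>f :: nat \<Rightarrow> complex ^ 'n::{finite,linorder} \<Rightarrow> complex.
        (\<forall>k. f k \<in> bergman_space p \<alpha>) \<and>
        (\<exists>M. \<forall>k. bergman_norm p \<alpha> (f k) \<le> M) \<and>
        (\<forall>K. compact K \<and> K \<subseteq> tube_B \<longrightarrow> uniform_limit K f (\<lambda>_. 0) sequentially)
        \<longrightarrow> (\<lambda>k. \<integral>\<^sup>+ z. ennreal (norm (f k z) powr p) \<partial>\<mu>) \<longlonglongrightarrow> 0)"

end

theory Submission
  imports Defs "HOL-Complex_Analysis.Cauchy_Integral_Formula"
begin

text \<open>
  The group generated by real translations, the shears
  \<open>(z', z\<^sub>n) \<mapsto> (z' + i b, z\<^sub>n + 2 b z' + i b\<^sup>2)\<close> and the dilations \<open>(t z', t\<^sup>2 z\<^sub>n)\<close> acts simply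
  transitively on \<open>T\<^sub>B\<close> by complex affine maps, and \<open>\<rho>(z, w)\<close> is multiplied by \<open>\<rho>(a)\<close> under the element
  taking \<open>(0, i)\<close> to \<open>a\<close>. Hence the metric is invariant, \<open>dV\<^sub>\<alpha>\<close> scales by \<open>\<rho>(a)\<^sup>s\<close> with
  \<open>s = n + \<alpha> + 1\<close>, and all estimates reduce to the base point.

  \<open>(1) \<Longrightarrow> (2)\<close>: the functions \<open>\<rho>(a)\<^bsup>s/p\<^esup> \<rho>(z, a)\<^bsup>-2s/p\<^esup>\<close> all have the same finite norm and tend to \<open>0\<close>
  locally uniformly as \<open>a\<close> tends to the boundary. \<open>(2) \<Longrightarrow> (3)\<close>: on \<open>D(a, r)\<close> one has
  \<open>|\<rho>(z, a)| \<le> 2 cosh\<^sup>2 r \<rho>(a)\<close>. \<open>(3) \<Longrightarrow> (4)\<close>: a lattice leaves every compact set.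
  \<open>(4) \<Longrightarrow> (1)\<close>: by subharmonicity of \<open>|f|\<^sup>p\<close> its value on \<open>D(a\<^sub>k, r)\<close> is at most
  \<open>C \<rho>(a\<^sub>k)\<^bsup>-s\<^esup>\<close> times its integral over \<open>D(a\<^sub>k, 2r)\<close>; sum over the lattice, using finite overlap for
  large \<open>k\<close> and uniform convergence on a compact set for the remaining \<open>k\<close>.
\<close>

section \<open>The Bergman metric and its affine automorphisms\<close>

text \<open>What makes the metric tractable is the identity cosh(beta(z,w)) = |rho(z,w)| /
  sqrt(rho(z) rho(w)): metric balls become sublevel sets of real polynomials. The estimates rest on
  one inequality, \<open>rho z + rho w <= 2 * norm (rho2 z w)\<close>. The exponents fit for the
  following reason. The automorphism taking the base point to a has real Jacobian rho(a)^(n+1), and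
  the weight adds rho(a)^\<alpha>, which gives the power s. The same scaling bounds the
  \<open>dV\<close>-mass of the set where |rho(z,(0,i))| <= R by a constant times R^s, so a kernel
  of size R^(-2s) leaves R^(-s), and dyadic shells can be summed. The boundary is reached in two
  ways, by height tending to 0 or by escape to infinity. One fact links them: for z in a bounded
  set, a bound on |rho(z,a)| confines a to a bounded set. Hence, if |rho(z,a)| stays bounded, only
  the height can degenerate. Return from (4) to (1) needs some lattice to exist, so one is
  constructed.\<close>

lemma rho2_commute: "rho2 w z = cnj (rho2 z w)"
proof -
  have "(w $ j - cnj (z $ j))\<^sup>2 = (cnj (z $ j) - w $ j)\<^sup>2" for j
    by (simp add: power2_commute)
  then show ?thesis
    by (simp add: rho2_def algebra_simps)
qed

lemma norm_rho2_commute: "norm (rho2 w z) = norm (rho2 z w)"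
  by (simp add: rho2_commute[of w z])

text \<open>The parallelogram law for Im u + Im v and Im u - Im v trades conjugates for differences.
  All lower bounds on |rho(z,w)| come from this identity, as does the positivity of its real part,
  which later permits the principal branch of the logarithm.\<close>

lemma Re_rho2:
  "4 * Re (rho2 z w) =
     2 * rho z + 2 * rho w + (\<Sum>j\<in>UNIV - {last_ix}. (norm (z $ j - w $ j))\<^sup>2)"
proof -
  have "Re ((u - cnj v)\<^sup>2) = (norm (u - v))\<^sup>2 - 2 * (Im u)\<^sup>2 - 2 * (Im v)\<^sup>2" for u v
    by (subst cmod_power2) (simp add: power2_eq_square algebra_simps)
  then have "(\<Sum>j\<in>UNIV - {last_ix}. (norm (z $ j - w $ j))\<^sup>2) =
      (\<Sum>j\<in>UNIV - {last_ix}. Re ((z $ j - cnj (w $ j))\<^sup>2) + 2 * (Im (z $ j))\<^sup>2 + 2 * (Im (w $ j))\<^sup>2)"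
    by (intro sum.cong) auto
  then show ?thesis
    by (simp add: rho2_def rho_def sum.distrib sum_distrib_left[symmetric] algebra_simps)
qed

lemma rho_add_le_norm_rho2: "rho z + rho w \<le> 2 * norm (rho2 z w)"
proof -
  have "0 \<le> (\<Sum>j\<in>UNIV - {last_ix}. (norm (z $ j - w $ j))\<^sup>2)"
    by (intro sum_nonneg) auto
  then show ?thesis
    using Re_rho2[of z w] complex_Re_le_cmod[of "rho2 z w"] by linarith
qed

lemma Re_rho2_pos: "z \<in> tube_B \<Longrightarrow> w \<in> tube_B \<Longrightarrow> Re (rho2 z w) > 0"
proof -
  assume "z \<in> tube_B" "w \<in> tube_B"
  moreover have "0 \<le> (\<Sum>j\<in>UNIV - {last_ix}. (norm (z $ j - w $ j))\<^sup>2)"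
    by (intro sum_nonneg) auto
  ultimately show ?thesis
    using Re_rho2[of z w] by (simp add: mem_tube_B_iff)
qed

lemma norm_rho2_pos: "z \<in> tube_B \<Longrightarrow> w \<in> tube_B \<Longrightarrow> norm (rho2 z w) > 0"
  using Re_rho2_pos[of z w] by force

text \<open>The inequality of arithmetic and geometric means. It puts the radicand in
  \<open>bergman_dist\<close> into [0,1), so that the metric is a genuine real number.\<close>

lemma rho_mult_le_norm_rho2:
  assumes "z \<in> tube_B" "w \<in> tube_B"
  shows "rho z * rho w \<le> (norm (rho2 z w))\<^sup>2"
proof -
  have "4 * (rho z * rho w) \<le> (rho z + rho w)\<^sup>2"
    using sum_squares_bound[of "rho z" "rho w"] by (simp add: power2_sum mult.commute mult.left_commute)
  also have "\<dots> \<le> (2 * norm (rho2 z w))\<^sup>2"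
    using rho_add_le_norm_rho2[of z w] assms by (intro power_mono) (auto simp: mem_tube_B_iff)
  finally show ?thesis by (simp add: power_mult_distrib)
qed

text \<open>If cosh t = c with t >= 0, then sqrt(1 - 1/c^2) = tanh t. This form is preferred because
  cosh obeys an addition theorem and squares to a rational expression.\<close>

lemma bergman_dist_eq_arcosh:
  assumes "z \<in> tube_B" "w \<in> tube_B"
  shows "bergman_dist z w = arcosh (norm (rho2 z w) / sqrt (rho z * rho w))"
proof -
  define c where "c = norm (rho2 z w) / sqrt (rho z * rho w)"
  have pos: "rho z * rho w > 0" using assms by (simp add: mem_tube_B_iff)
  then have c1: "c \<ge> 1"
    using rho_mult_le_norm_rho2[OF assms] by (simp add: c_def real_le_lsqrt)
  have c2: "rho z * rho w / (norm (rho2 z w))\<^sup>2 = 1 / c\<^sup>2"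
    using pos by (simp add: c_def power_divide)
  define t where "t = arcosh c"
  have t: "t \<ge> 0" "cosh t = c"
    using c1 by (auto simp: t_def arcosh_nonneg_real)
  have "sqrt (1 - 1 / c\<^sup>2) = tanh t"
  proof (rule real_sqrt_unique)
    show "0 \<le> tanh t" using t by simp
    have "(cosh t)\<^sup>2 - (sinh t)\<^sup>2 = 1" by (simp add: cosh_square_eq)
    then have "(sinh t)\<^sup>2 = c\<^sup>2 - 1" using t by simp
    then show "(tanh t)\<^sup>2 = 1 - 1 / c\<^sup>2"
      using c1 t by (simp add: tanh_def power_divide diff_divide_distrib)
  qed
  then show ?thesis
    by (simp add: bergman_dist_def c2 artanh_tanh_real flip: c_def t_def)
qed

lemma cosh_bergman_dist:
  assumes "z \<in> tube_B" "w \<in> tube_B"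
  shows "cosh (bergman_dist z w) = norm (rho2 z w) / sqrt (rho z * rho w)"
    and bergman_dist_nonneg: "bergman_dist z w \<ge> 0"
proof -
  have pos: "rho z * rho w > 0" using assms by (simp add: mem_tube_B_iff)
  then have "norm (rho2 z w) / sqrt (rho z * rho w) \<ge> 1"
    using rho_mult_le_norm_rho2[OF assms] by (simp add: real_le_lsqrt)
  then show "cosh (bergman_dist z w) = norm (rho2 z w) / sqrt (rho z * rho w)"
    "bergman_dist z w \<ge> 0"
    by (simp_all add: bergman_dist_eq_arcosh assms arcosh_nonneg_real)
qed

lemma bergman_dist_commute: "bergman_dist z w = bergman_dist w z"
  by (simp add: bergman_dist_def norm_rho2_commute[of z w] mult.commute)

lemma bergman_dist_less_iff:
  assumes "z \<in> tube_B" "w \<in> tube_B" "r > 0"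
  shows "bergman_dist z w < r \<longleftrightarrow> (norm (rho2 z w))\<^sup>2 < (cosh r)\<^sup>2 * (rho z * rho w)"
proof -
  have pos: "rho z * rho w > 0" using assms by (simp add: mem_tube_B_iff)
  have "bergman_dist z w < r \<longleftrightarrow> cosh (bergman_dist z w) < cosh r"
    using assms bergman_dist_nonneg[of z w] by (simp add: cosh_real_nonneg_less_iff)
  also have "\<dots> \<longleftrightarrow> norm (rho2 z w) < cosh r * sqrt (rho z * rho w)"
    using pos assms by (simp add: cosh_bergman_dist field_simps)
  also have "\<dots> \<longleftrightarrow> (norm (rho2 z w))\<^sup>2 < (cosh r * sqrt (rho z * rho w))\<^sup>2"
    using pos cosh_real_pos[of r]
    by (intro iffI power_strict_mono) (auto intro: power2_less_imp_less)
  finally show ?thesis using pos by (simp add: power_mult_distrib)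
qed

lemma mem_bergman_ball_iff:
  assumes "a \<in> tube_B" "r > 0"
  shows "w \<in> bergman_ball a r \<longleftrightarrow>
    w \<in> tube_B \<and> (norm (rho2 a w))\<^sup>2 < (cosh r)\<^sup>2 * (rho a * rho w)"
  using bergman_dist_less_iff[of a w r] assms by (auto simp: bergman_ball_def)

text \<open>Insert rho(w) <= 2 |rho(a,w)| into the inequality that defines the ball and cancel one
  factor |rho(a,w)|; this is the origin of the 2.\<close>

lemma norm_rho2_le_of_bergman_ball:
  assumes "a \<in> tube_B" "r > 0" "w \<in> bergman_ball a r"
  shows "norm (rho2 w a) \<le> 2 * (cosh r)\<^sup>2 * rho a"
proof -
  have w: "w \<in> tube_B" "(norm (rho2 a w))\<^sup>2 < (cosh r)\<^sup>2 * (rho a * rho w)"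
    using assms by (auto simp: mem_bergman_ball_iff)
  have pos: "rho a > 0" "rho w > 0" "norm (rho2 a w) > 0"
    using w assms norm_rho2_pos[of a w] by (auto simp: mem_tube_B_iff)
  have "(norm (rho2 a w))\<^sup>2 \<le> (cosh r)\<^sup>2 * rho a * (2 * norm (rho2 a w))"
    using w pos rho_add_le_norm_rho2[of a w]
    by (smt (verit) mult.assoc mult_left_mono mult_nonneg_nonneg zero_le_power2)
  then have "norm (rho2 a w) * norm (rho2 a w) \<le> (2 * (cosh r)\<^sup>2 * rho a) * norm (rho2 a w)"
    by (simp add: power2_eq_square algebra_simps)
  then show ?thesis
    using pos by (simp add: norm_rho2_commute[of w a])
qed

section \<open>The affine automorphisms\<close>

definition base_pt :: "complex ^ 'n::{finite,linorder}" where
  "base_pt = (\<chi> j. if j = last_ix then \<i> else 0)"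

text \<open>Linear part of an automorphism: a dilation by t followed by a shear. Only Im a occurs,
  because the real part of a acts by translation. Keeping t independent of a makes pure shears (t =
  1) and pure dilations (a = 0) special cases.\<close>

definition tube_lin ::
    "real \<Rightarrow> complex ^ 'n::{finite,linorder} \<Rightarrow> complex ^ 'n::{finite,linorder} \<Rightarrow> complex ^ 'n::{finite,linorder}" where
  "tube_lin t a v = (\<chi> j. if j = last_ix
     then of_real (t\<^sup>2) * v $ last_ix + of_real (2 * t) * (\<Sum>i\<in>UNIV - {last_ix}. of_real (Im (a $ i)) * v $ i)
     else of_real t * v $ j)"

text \<open>The affine automorphism of \<open>T\<^sub>B\<close> that takes the base point to \<open>a\<close>.\<close>

definition tube_aut :: "complex ^ 'n::{finite,linorder} \<Rightarrow> complex ^ 'n::{finite,linorder} \<Rightarrow> complex ^ 'n::{finite,linorder}" where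
  "tube_aut a w = a + tube_lin (sqrt (rho a)) a (w - base_pt)"

lemma tube_lin_add: "tube_lin t a (v + w) = tube_lin t a v + tube_lin t a w"
  by (vector tube_lin_def) (auto simp: algebra_simps sum.distrib)

lemma tube_lin_cmult: "tube_lin t a (c *s v) = c *s tube_lin t a v"
  by (vector tube_lin_def) (auto simp: algebra_simps sum_distrib_left)

lemma linear_tube_lin:
  fixes a :: "complex ^ 'n::{finite,linorder}"
  shows "linear (tube_lin t a)"
proof
  show "tube_lin t a (v + w) = tube_lin t a v + tube_lin t a w" for v w
    by (rule tube_lin_add)
  have "c *\<^sub>R v = complex_of_real c *s v" for c and v :: "(complex, 'n) vec"
    by (simp add: vec_eq_iff scaleR_conv_of_real[where 'a=complex])
  then show "tube_lin t a (c *\<^sub>R v) = c *\<^sub>R tube_lin t a v" for c v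
    by (simp add: tube_lin_cmult)
qed

lemma bij_tube_lin:
  assumes "t \<noteq> 0"
  shows "bij (tube_lin t a)"
proof (rule bijI)
  show "inj (tube_lin t a)"
  proof (rule linear_injective_0[OF linear_tube_lin, THEN iffD2], safe)
    fix v assume v: "tube_lin t a v = 0"
    have j: "v $ j = 0" if "j \<noteq> last_ix" for j
      using arg_cong[OF v, of "\<lambda>u. u $ j"] that assms by (simp add: tube_lin_def)
    then have "v $ last_ix = 0"
      using arg_cong[OF v, of "\<lambda>u. u $ last_ix"] assms by (simp add: tube_lin_def)
    with j show "v = 0" by (metis vec_eq_iff zero_index)
  qed
  then show "surj (tube_lin t a)"
    by (simp add: linear_injective_imp_surjective linear_tube_lin)
qed

lemma bij_tube_aut:
  assumes "a \<in> tube_B"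
  shows "bij (tube_aut a)"
proof -
  have "bij (\<lambda>v. a + v)" by (intro o_bij[of "\<lambda>v. v - a"]) auto
  moreover have "bij (\<lambda>v. v - base_pt)" by (intro o_bij[of "\<lambda>v. v + base_pt"]) auto
  moreover have "bij (tube_lin (sqrt (rho a)) a)"
    using assms by (intro bij_tube_lin) (simp add: mem_tube_B_iff)
  moreover have "tube_aut a = (\<lambda>v. a + v) \<circ> (tube_lin (sqrt (rho a)) a \<circ> (\<lambda>v. v - base_pt))"
    by (simp add: tube_aut_def fun_eq_iff)
  ultimately show ?thesis by (metis bij_comp)
qed

lemma tube_aut_nth: "j \<noteq> last_ix \<Longrightarrow> tube_aut a w $ j = a $ j + of_real (sqrt (rho a)) * w $ j"
  by (simp add: tube_aut_def tube_lin_def base_pt_def)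

lemma tube_aut_last: "rho a \<ge> 0 \<Longrightarrow> tube_aut a w $ last_ix = a $ last_ix + of_real (rho a) * (w $ last_ix - \<i>)
   + of_real (2 * sqrt (rho a)) * (\<Sum>i\<in>UNIV - {last_ix}. of_real (Im (a $ i)) * w $ i)"
  by (simp add: tube_aut_def tube_lin_def base_pt_def)

lemma tube_aut_base_pt [simp]: "tube_aut a base_pt = a"
  using linear_0[OF linear_tube_lin] by (simp add: tube_aut_def)

lemma rho_base_pt [simp]: "rho base_pt = 1"
  by (simp add: rho_def base_pt_def)

lemma base_pt_in_tube [simp]: "base_pt \<in> tube_B"
  by (simp add: mem_tube_B_iff)

lemma four_rho2:
  "4 * rho2 z w = (\<Sum>j\<in>UNIV - {last_ix}. (z $ j - cnj (w $ j))\<^sup>2)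
                 - 2 * \<i> * (z $ last_ix - cnj (w $ last_ix))"
proof -
  have "u = v / 4 \<Longrightarrow> 4 * u = v" for u v :: complex by (simp add: mult.commute)
  then show ?thesis using rho2_def by blast
qed

text \<open>Completing the square. With y = Im a and t^2 = rho(a), each difference of first
  coordinates becomes t d_j + 2 i y_j. Its cross terms cancel against the shear in the last
  coordinate, and the remaining constant 4 y_n - 4 y'^2 - 4 t^2 vanishes.\<close>

lemma rho2_tube_aut:
  fixes a z w :: "complex ^ 'n::{finite,linorder}"
  assumes "rho a \<ge> 0"
  shows "rho2 (tube_aut a z) (tube_aut a w) = of_real (rho a) * rho2 z w"
proof -
  define I where "I = UNIV - {last_ix :: 'n}"
  define t where "t = sqrt (rho a)"
  have t: "of_real (rho a) = (of_real t)\<^sup>2"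
    using assms by (simp add: t_def flip: of_real_power)
  define y where "y j = complex_of_real (Im (a $ j))" for j
  have cy: "cnj (y j) = y j" for j by (simp add: y_def)
  define d where "d j = z $ j - cnj (w $ j)" for j
  have aa: "a $ j = cnj (a $ j) + 2 * \<i> * y j" for j
    by (simp add: y_def complex_eq_iff)
  have 1: "(\<Sum>j\<in>I. (tube_aut a z $ j - cnj (tube_aut a w $ j))\<^sup>2) =
     (of_real t)\<^sup>2 * (\<Sum>j\<in>I. (d j)\<^sup>2) + 4 * \<i> * of_real t * (\<Sum>j\<in>I. y j * d j) - 4 * (\<Sum>j\<in>I. (y j)\<^sup>2)"
  proof -
    have "(tube_aut a z $ j - cnj (tube_aut a w $ j))\<^sup>2 =
       (of_real t)\<^sup>2 * (d j)\<^sup>2 + 4 * \<i> * of_real t * (y j * d j) - 4 * (y j)\<^sup>2" if "j \<in> I" for j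
    proof -
      have "tube_aut a z $ j - cnj (tube_aut a w $ j) = of_real t * d j + 2 * \<i> * y j"
        using that aa[of j] by (simp add: I_def tube_aut_nth t_def d_def algebra_simps)
      then show ?thesis
        by (simp add: power2_sum power_mult_distrib)
    qed
    then show ?thesis
      by (simp add: sum.distrib sum_subtractf sum_distrib_left)
  qed
  have r: "(\<Sum>j\<in>I. (y j)\<^sup>2) = y last_ix - (of_real t)\<^sup>2"
    unfolding t[symmetric] by (simp add: rho_def y_def I_def)
  have 2: "tube_aut a z $ last_ix - cnj (tube_aut a w $ last_ix) =
     2 * \<i> * y last_ix + (of_real t)\<^sup>2 * (d last_ix - 2 * \<i>) + 2 * of_real t * (\<Sum>j\<in>I. y j * d j)"
    using aa[of last_ix] assms
    by (simp add: tube_aut_last t cy y_def[symmetric] I_def[symmetric] t_def[symmetric] d_def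
        sum_subtractf algebra_simps)
  have 3: "rho2 z w = ((\<Sum>j\<in>I. (d j)\<^sup>2) - 2 * \<i> * d last_ix) / 4"
    by (simp add: rho2_def I_def d_def)
  show ?thesis
    unfolding rho2_def[of "tube_aut a z"] I_def[symmetric] 1 2 3 t r
    by (simp add: algebra_simps)
qed

lemma rho_tube_aut: "rho a \<ge> 0 \<Longrightarrow> rho (tube_aut a w) = rho a * rho w"
  using rho2_tube_aut[of a w w] by (simp add: rho2_diag flip: of_real_mult)

lemma tube_aut_in_tube_iff: "a \<in> tube_B \<Longrightarrow> tube_aut a w \<in> tube_B \<longleftrightarrow> w \<in> tube_B"
  by (simp add: mem_tube_B_iff rho_tube_aut zero_less_mult_iff)

lemma bergman_dist_tube_aut:
  "a \<in> tube_B \<Longrightarrow> bergman_dist (tube_aut a z) (tube_aut a w) = bergman_dist z w"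
  by (simp add: bergman_dist_def mem_tube_B_iff rho_tube_aut rho2_tube_aut norm_mult power2_eq_square)

lemma tube_aut_in_bergman_ball_iff:
  "a \<in> tube_B \<Longrightarrow> tube_aut a w \<in> bergman_ball (tube_aut a z) r \<longleftrightarrow> w \<in> bergman_ball z r"
  by (simp add: bergman_ball_def tube_aut_in_tube_iff bergman_dist_tube_aut)

lemma ex_tube_aut:
  assumes "a \<in> tube_B" "z \<in> tube_B"
  obtains w where "w \<in> tube_B" "z = tube_aut a w"
  using bij_tube_aut[OF assms(1)] assms tube_aut_in_tube_iff
  by (metis bij_pointE)

section \<open>Continuity, openness and compact metric balls\<close>

lemma continuous_on_tube_aut [continuous_intros]: "continuous_on S (tube_aut a)"
  unfolding tube_aut_def
  by (intro continuous_intros linear_continuous_on_compose[OF _ linear_tube_lin])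

lemma continuous_on_rho [continuous_intros]:
  "continuous_on S f \<Longrightarrow> continuous_on S (\<lambda>x. rho (f x))"
  unfolding rho_def by (intro continuous_intros)

lemma continuous_on_rho2 [continuous_intros]:
  "continuous_on S f \<Longrightarrow> continuous_on S g \<Longrightarrow> continuous_on S (\<lambda>x. rho2 (f x) (g x))"
  unfolding rho2_def by (intro continuous_intros) auto

lemma open_tube_B: "open (tube_B :: (complex ^ 'n::{finite,linorder}) set)"
proof -
  have "tube_B = {z :: (complex, 'n) vec. 0 < rho z}" by (auto simp: mem_tube_B_iff)
  also have "open \<dots>" by (intro open_Collect_less continuous_intros)
  finally show ?thesis .
qed

text \<open>By \<open>Re_rho2\<close>, |z_j - a_j|^2 <= 4 R for the first n-1 coordinates, which
  yields the bound \<open>m\<close>; solving \<open>four_rho2\<close> for the last coordinate of a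
  yields \<open>M1\<close>. The lemma serves three times: for compactness of balls, for decay of the
  kernel at infinity, and for pulling sublevel sets back into a fixed ball.\<close>

lemma norm_bound_of_rho2_bound:
  fixes B R :: real
  obtains M where "\<And>z a :: complex ^ 'n::{finite,linorder}.
    norm z \<le> B \<Longrightarrow> 0 \<le> rho z \<Longrightarrow> 0 \<le> rho a \<Longrightarrow> norm (rho2 z a) \<le> R \<Longrightarrow> norm a \<le> M"
proof -
  define m where "m = B + 2 * sqrt R"
  define M1 where "M1 = B + 2 * R + real CARD('n) * (B + m)\<^sup>2"
  have "norm a \<le> real CARD('n) * (\<bar>m\<bar> + \<bar>M1\<bar>)"
    if z: "norm z \<le> B" "0 \<le> rho z" "0 \<le> rho a" "norm (rho2 z a) \<le> R" for z a :: "(complex, 'n) vec"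
  proof -
    have nz: "norm (z $ j) \<le> B" for j
      using z Finite_Cartesian_Product.norm_nth_le[of z j] by linarith
    have aj: "norm (a $ j) \<le> m" if "j \<noteq> last_ix" for j
    proof -
      have "(norm (z $ j - a $ j))\<^sup>2 \<le> (\<Sum>j\<in>UNIV - {last_ix}. (norm (z $ j - a $ j))\<^sup>2)"
        using that by (intro member_le_sum) auto
      also have "\<dots> \<le> 4 * R"
        using Re_rho2[of z a] z complex_Re_le_cmod[of "rho2 z a"] by linarith
      finally have "norm (z $ j - a $ j) \<le> sqrt (4 * R)"
        by (rule real_le_rsqrt)
      then have "norm (a $ j) \<le> norm (z $ j) + 2 * sqrt R"
        using norm_triangle_ineq3[of "a $ j" "z $ j"] by (simp add: real_sqrt_mult norm_minus_commute)
      then show ?thesis using nz[of j] by (simp add: m_def)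
    qed
    have R0: "R \<ge> 0" using z(4) norm_ge_zero order_trans by blast
    have B0: "B \<ge> 0" using z(1) norm_ge_zero order_trans by blast
    have "norm (\<Sum>j\<in>UNIV - {last_ix}. (z $ j - cnj (a $ j))\<^sup>2) \<le> (\<Sum>j\<in>UNIV - {last_ix::'n}. (B + m)\<^sup>2)"
    proof (intro sum_norm_le)
      fix j :: 'n assume "j \<in> UNIV - {last_ix}"
      then have "norm (z $ j - cnj (a $ j)) \<le> B + m"
        using norm_triangle_ineq4[of "z $ j" "cnj (a $ j)"] aj[of j] nz[of j] by auto
      then show "norm ((z $ j - cnj (a $ j))\<^sup>2) \<le> (B + m)\<^sup>2"
        by (simp add: norm_power power_mono)
    qed
    also have "\<dots> = real (card (UNIV - {last_ix :: 'n})) * (B + m)\<^sup>2"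
      by simp
    also have "\<dots> \<le> real CARD('n) * (B + m)\<^sup>2"
      by (intro mult_right_mono) (auto intro: card_mono)
    finally have S: "norm (\<Sum>j\<in>UNIV - {last_ix}. (z $ j - cnj (a $ j))\<^sup>2) \<le> real CARD('n) * (B + m)\<^sup>2" .
    have "2 * \<i> * cnj (a $ last_ix) = 4 * rho2 z a + 2 * \<i> * z $ last_ix
         - (\<Sum>j\<in>UNIV - {last_ix}. (z $ j - cnj (a $ j))\<^sup>2)"
      unfolding four_rho2 by (simp add: algebra_simps)
    then have "2 * norm (a $ last_ix) = norm (4 * rho2 z a + 2 * \<i> * z $ last_ix
         - (\<Sum>j\<in>UNIV - {last_ix}. (z $ j - cnj (a $ j))\<^sup>2))"
      by (metis complex_mod_cnj norm_ii norm_mult norm_numeral mult.right_neutral)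
    also have "\<dots> \<le> norm (4 * rho2 z a) + norm (2 * \<i> * z $ last_ix)
         + norm (\<Sum>j\<in>UNIV - {last_ix}. (z $ j - cnj (a $ j))\<^sup>2)"
      by (meson norm_triangle_ineq norm_triangle_ineq4 add_right_mono order_trans)
    also have "\<dots> \<le> 4 * R + 2 * B + real CARD('n) * (B + m)\<^sup>2"
      using z S nz[of last_ix] by (intro add_mono) (auto simp: norm_mult)
    finally have "2 * norm (a $ last_ix) \<le> 2 * M1"
      using B0 R0 by (simp add: M1_def) (smt (verit) zero_le_power2 mult_nonneg_nonneg of_nat_0_le_iff)
    then have "norm (a $ j) \<le> \<bar>m\<bar> + \<bar>M1\<bar>" for j
      using aj[of j] by (cases "j = last_ix") auto
    then have "(\<Sum>j\<in>UNIV. norm (a $ j)) \<le> (\<Sum>j\<in>(UNIV::'n set). \<bar>m\<bar> + \<bar>M1\<bar>)"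
      by (intro sum_mono) auto
    moreover have "norm a \<le> (\<Sum>j\<in>UNIV. norm (a $ j))"
      by (simp add: norm_vec_def L2_set_le_sum)
    ultimately show ?thesis by simp
  qed
  then show thesis using that by blast
qed

lemma bergman_dist_le_iff:
  assumes "z \<in> tube_B" "w \<in> tube_B" "r \<ge> 0"
  shows "bergman_dist z w \<le> r \<longleftrightarrow> (norm (rho2 z w))\<^sup>2 \<le> (cosh r)\<^sup>2 * (rho z * rho w)"
proof -
  have pos: "rho z * rho w > 0" using assms by (simp add: mem_tube_B_iff)
  have "bergman_dist z w \<le> r \<longleftrightarrow> cosh (bergman_dist z w) \<le> cosh r"
    using assms bergman_dist_nonneg[of z w] by (simp add: cosh_real_nonneg_le_iff)
  also have "\<dots> \<longleftrightarrow> norm (rho2 z w) \<le> cosh r * sqrt (rho z * rho w)"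
    using pos assms by (simp add: cosh_bergman_dist field_simps)
  also have "\<dots> \<longleftrightarrow> (norm (rho2 z w))\<^sup>2 \<le> (cosh r * sqrt (rho z * rho w))\<^sup>2"
    using pos cosh_real_pos[of r]
    by (intro iffI power_mono) (auto intro: power2_le_imp_le)
  finally show ?thesis using pos by (simp add: power_mult_distrib)
qed

text \<open>The tube is open, so closedness in the whole space is the issue. The description by
  \<open>0 <= rho w\<close> is closed, and it adds no boundary point: rho(w) = 0 would force
  rho(a,w) = 0, whereas 2 |rho(a,w)| >= rho(a) > 0.\<close>

lemma compact_bergman_cball:
  fixes a :: "complex ^ 'n::{finite,linorder}"
  assumes a: "a \<in> tube_B" and r: "r \<ge> 0"
  shows "compact {w \<in> tube_B. bergman_dist a w \<le> r}"
proof -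
  define c where "c = (cosh r)\<^sup>2 * rho a"
  have c0: "c \<ge> 0" using a by (simp add: c_def mem_tube_B_iff)
  have eq: "{w \<in> tube_B. bergman_dist a w \<le> r} = {w. 0 \<le> rho w \<and> (norm (rho2 a w))\<^sup>2 \<le> c * rho w}"
  proof -
    have "w \<in> tube_B" if "0 \<le> rho w" "(norm (rho2 a w))\<^sup>2 \<le> c * rho w" for w
    proof (rule ccontr)
      assume "w \<notin> tube_B"
      then have "rho w = 0" using that by (simp add: mem_tube_B_iff)
      then show False using that a rho_add_le_norm_rho2[of a w] by (simp add: mem_tube_B_iff)
    qed
    then show ?thesis
      using a r by (auto simp: bergman_dist_le_iff c_def mult.assoc) (auto simp: mem_tube_B_iff)
  qed
  obtain M where M: "\<And>z w :: (complex, 'n) vec.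
    norm z \<le> norm a \<Longrightarrow> 0 \<le> rho z \<Longrightarrow> 0 \<le> rho w \<Longrightarrow> norm (rho2 z w) \<le> 2 * c \<Longrightarrow> norm w \<le> M"
    using norm_bound_of_rho2_bound[of "norm a" "2 * c"] by blast
  have "norm w \<le> M" if w: "0 \<le> rho w" "(norm (rho2 a w))\<^sup>2 \<le> c * rho w" for w
  proof (rule M[of a])
    have "rho w \<le> 2 * norm (rho2 a w)"
      using rho_add_le_norm_rho2[of a w] a by (simp add: mem_tube_B_iff)
    then have "(norm (rho2 a w))\<^sup>2 \<le> c * (2 * norm (rho2 a w))"
      using w c0 mult_left_mono by fastforce
    then have "norm (rho2 a w) * norm (rho2 a w) \<le> (2 * c) * norm (rho2 a w)"
      by (simp add: power2_eq_square algebra_simps)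
    then show "norm (rho2 a w) \<le> 2 * c"
      using c0 by (smt (verit) mult_le_cancel_right norm_ge_zero)
  qed (use a w in \<open>auto simp: mem_tube_B_iff\<close>)
  then have "bounded {w. 0 \<le> rho w \<and> (norm (rho2 a w))\<^sup>2 \<le> c * rho w}"
    by (auto simp: bounded_iff)
  moreover have "closed {w. 0 \<le> rho w \<and> (norm (rho2 a w))\<^sup>2 \<le> c * rho w}"
    by (intro closed_Collect_conj closed_Collect_le continuous_intros)
  ultimately show ?thesis
    unfolding eq by (simp add: compact_eq_bounded_closed)
qed

lemma open_bergman_ball:
  assumes "a \<in> tube_B" "r > 0"
  shows "open (bergman_ball a r)"
proof -
  have "bergman_ball a r = tube_B \<inter> {w. (norm (rho2 a w))\<^sup>2 < (cosh r)\<^sup>2 * (rho a * rho w)}"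
    using assms by (auto simp: mem_bergman_ball_iff)
  also have "open \<dots>"
    by (intro open_Int open_tube_B open_Collect_less continuous_intros)
  finally show ?thesis .
qed

section \<open>The triangle inequality\<close>

lemma bergman_dist_self [simp]: "z \<in> tube_B \<Longrightarrow> bergman_dist z z = 0"
  by (simp add: bergman_dist_def rho2_diag mem_tube_B_iff power2_eq_square)

lemma center_in_bergman_ball [simp]: "z \<in> tube_B \<Longrightarrow> r > 0 \<Longrightarrow> z \<in> bergman_ball z r"
  by (simp add: bergman_ball_def)

text \<open>
  With \<open>u(x) = x'\<^sup>2 - 2 i x\<^sub>n\<close>, the form \<open>4 \<rho>(x, z) = u(x) + cnj (u(z)) - 2 \<langle>x', z'\<rangle>\<close> has signature \<open>(1, n)\<close>;
  the vectors \<open>X x\<close> below are the projections to the complement of the base point, where the form is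
  negative definite, so that the triangle inequality is Cauchy--Schwarz together with the addition
  theorem for \<open>cosh\<close>.
\<close>

lemma bergman_triangle_base:
  fixes x z :: "complex ^ 'n::{finite,linorder}"
  assumes x: "x \<in> tube_B" and z: "z \<in> tube_B"
  shows "bergman_dist x z \<le> bergman_dist x base_pt + bergman_dist base_pt z"
proof -
  define u where "u x = (\<Sum>j\<in>UNIV - {last_ix}. (x $ j)\<^sup>2) - 2 * \<i> * x $ last_ix" for x :: "(complex, 'n) vec"
  \<comment> \<open>The shift 2 is \<open>u base_pt\<close>. The weight sqrt 8 is forced by
    expanding (u(x) + 2)(cnj u(z) + 2) - 16 rho(x,z) = (u(x) - 2)(cnj u(z) - 2) + 8 <x',z'>, which
    is \<open>key\<close>.\<close>
  define X where "X x j = (if j = last_ix then u x - 2 else of_real (sqrt 8) * x $ j)"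
    for x :: "(complex, 'n) vec" and j
  have split: "(\<Sum>j\<in>UNIV. g j) = g last_ix + (\<Sum>j\<in>UNIV - {last_ix::'n}. g j)" for g :: "'n \<Rightarrow> complex"
    by (subst sum.remove[of UNIV last_ix]) auto
  have rho2_u: "4 * rho2 x z = u x + cnj (u z) - 2 * (\<Sum>j\<in>UNIV - {last_ix}. x $ j * cnj (z $ j))" for x z
  proof -
    have "(\<Sum>j\<in>UNIV - {last_ix}. (x $ j - cnj (z $ j))\<^sup>2) = (\<Sum>j\<in>UNIV - {last_ix}. (x $ j)\<^sup>2)
        + (\<Sum>j\<in>UNIV - {last_ix}. (cnj (z $ j))\<^sup>2) - 2 * (\<Sum>j\<in>UNIV - {last_ix}. x $ j * cnj (z $ j))"
      by (simp add: power2_diff sum.distrib sum_subtractf sum_distrib_left mult.assoc)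
    then show ?thesis
      unfolding four_rho2 u_def by (simp add: algebra_simps)
  qed
  have u_base: "u base_pt = 2"
    by (simp add: u_def base_pt_def mult.assoc)
  have rho2_base: "4 * rho2 x base_pt = u x + 2" for x
    by (subst rho2_u) (simp add: u_base, simp add: base_pt_def)
  have rho2_base': "4 * rho2 base_pt x = cnj (u x) + 2" for x
    using arg_cong[OF rho2_base[of x], of cnj] unfolding rho2_commute[of base_pt] by simp
  have key: "16 * (rho2 x base_pt * rho2 base_pt z - rho2 x z) = (\<Sum>j\<in>UNIV. X x j * cnj (X z j))" for x z
  proof -
    have "complex_of_real (sqrt 8) * complex_of_real (sqrt 8) = 8"
      by (simp flip: of_real_mult)
    then have "complex_of_real (sqrt 8) * u * (complex_of_real (sqrt 8) * v) = 8 * (u * v)" for u v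
      by (metis mult.assoc mult.left_commute)
    then have "(\<Sum>j\<in>UNIV - {last_ix}. X x j * cnj (X z j)) = (\<Sum>j\<in>UNIV - {last_ix}. 8 * (x $ j * cnj (z $ j)))"
      by (intro sum.cong) (simp_all add: X_def)
    then have "(\<Sum>j\<in>UNIV. X x j * cnj (X z j)) =
       (u x - 2) * (cnj (u z) - 2) + 8 * (\<Sum>j\<in>UNIV - {last_ix}. x $ j * cnj (z $ j))"
      unfolding split by (simp add: sum_distrib_left) (simp add: X_def)
    moreover have "16 * (rho2 x base_pt * rho2 base_pt z - rho2 x z) =
      (4 * rho2 x base_pt) * (4 * rho2 base_pt z) - 4 * (4 * rho2 x z)" by (simp add: algebra_simps)
    ultimately show ?thesis
      by (simp only: rho2_base rho2_base' rho2_u[of x z]) (simp add: algebra_simps)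
  qed
  have nX: "(\<Sum>j\<in>UNIV. (norm (X x j))\<^sup>2) = 16 * ((norm (rho2 x base_pt))\<^sup>2 - rho x)" for x
  proof -
    have "complex_of_real (\<Sum>j\<in>UNIV. (norm (X x j))\<^sup>2) = (\<Sum>j\<in>UNIV. X x j * cnj (X x j))"
      by (simp only: complex_norm_square of_real_sum)
    also have "\<dots> = of_real (16 * ((norm (rho2 x base_pt))\<^sup>2 - rho x))"
      unfolding key[symmetric]
      by (simp only: rho2_diag rho2_commute[of base_pt x] of_real_mult of_real_diff complex_norm_square) simp
    finally show ?thesis unfolding of_real_eq_iff .
  qed
  define p where "p = norm (rho2 x base_pt)"
  define q where "q = norm (rho2 base_pt z)"
  have pq: "rho x \<le> p\<^sup>2" "rho z \<le> q\<^sup>2" "rho x > 0" "rho z > 0"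
    using rho_mult_le_norm_rho2[of x base_pt] rho_mult_le_norm_rho2[of base_pt z] x z
    by (auto simp: p_def q_def mem_tube_B_iff)
  have "norm (16 * (rho2 x base_pt * rho2 base_pt z - rho2 x z)) \<le>
     (\<Sum>j\<in>UNIV. norm (X x j) * norm (X z j))"
    unfolding key by (intro sum_norm_le) (simp add: norm_mult)
  also have "\<dots> \<le> L2_set (\<lambda>j. norm (X x j)) UNIV * L2_set (\<lambda>j. norm (X z j)) UNIV"
    using L2_set_mult_ineq[of "\<lambda>j. norm (X x j)" "\<lambda>j. norm (X z j)" UNIV] by simp
  also have "\<dots> = 16 * (sqrt (p\<^sup>2 - rho x) * sqrt (q\<^sup>2 - rho z))"
  proof -
    have "L2_set (\<lambda>j. norm (X x j)) UNIV = 4 * sqrt ((norm (rho2 x base_pt))\<^sup>2 - rho x)" for x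
      unfolding L2_set_def nX real_sqrt_mult by simp
    then show ?thesis by (simp add: p_def q_def norm_rho2_commute[of base_pt z])
  qed
  finally have "norm (rho2 x base_pt * rho2 base_pt z - rho2 x z) \<le> sqrt (p\<^sup>2 - rho x) * sqrt (q\<^sup>2 - rho z)"
    unfolding norm_mult[of 16] by simp
  then have main: "norm (rho2 x z) \<le> p * q + sqrt (p\<^sup>2 - rho x) * sqrt (q\<^sup>2 - rho z)"
    using norm_triangle_ineq3[of "rho2 x base_pt * rho2 base_pt z" "rho2 x z"]
    by (simp add: p_def q_def norm_mult)
  define A where "A = bergman_dist x base_pt"
  define C where "C = bergman_dist base_pt z"
  have A: "A \<ge> 0" "cosh A = p / sqrt (rho x)" and C: "C \<ge> 0" "cosh C = q / sqrt (rho z)"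
    using x z by (auto simp: A_def C_def bergman_dist_nonneg cosh_bergman_dist p_def q_def)
  \<comment> \<open>With this value of sinh, the right-hand side of \<open>main\<close> divided by
    sqrt(rho(x) rho(z)) is exactly cosh A cosh C + sinh A sinh C.\<close>
  have sinh: "sinh t = sqrt (m\<^sup>2 - s) / sqrt s" if "t \<ge> 0" "cosh t = m / sqrt s" "s > 0" for t m s :: real
  proof -
    have "(sinh t)\<^sup>2 = (m / sqrt s)\<^sup>2 - 1" using that cosh_square_eq[of t] by simp
    also have "\<dots> = (m\<^sup>2 - s) / s" using that by (simp add: power_divide diff_divide_distrib)
    finally have "sinh t = sqrt ((m\<^sup>2 - s) / s)" using that by (metis real_sqrt_unique sinh_real_nonneg_iff)
    then show ?thesis by (simp add: real_sqrt_divide)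
  qed
  have "cosh (A + C) = (p * q + sqrt (p\<^sup>2 - rho x) * sqrt (q\<^sup>2 - rho z)) / sqrt (rho x * rho z)"
    using A C sinh[of A p "rho x"] sinh[of C q "rho z"] pq
    by (simp add: cosh_add add_divide_distrib real_sqrt_mult)
  also have "\<dots> \<ge> norm (rho2 x z) / sqrt (rho x * rho z)"
    using main pq by (intro divide_right_mono) auto
  finally have "cosh (bergman_dist x z) \<le> cosh (A + C)"
    using x z by (simp add: cosh_bergman_dist)
  then show ?thesis
    using A C bergman_dist_nonneg[OF x z] by (simp add: cosh_real_nonneg_le_iff A_def C_def)
qed

text \<open>An automorphism moves the middle point y to the base point.\<close>

lemma bergman_triangle:
  assumes "x \<in> tube_B" "y \<in> tube_B" "z \<in> tube_B"
  shows "bergman_dist x z \<le> bergman_dist x y + bergman_dist y z"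
proof -
  obtain x' where x': "x' \<in> tube_B" "x = tube_aut y x'" using ex_tube_aut[OF assms(2,1)] .
  obtain z' where z': "z' \<in> tube_B" "z = tube_aut y z'" using ex_tube_aut[OF assms(2,3)] .
  have "bergman_dist x y = bergman_dist x' base_pt" "bergman_dist y z = bergman_dist base_pt z'"
    using bergman_dist_tube_aut[OF assms(2), of x' base_pt] bergman_dist_tube_aut[OF assms(2), of base_pt z']
    by (simp_all add: x' z')
  with bergman_triangle_base[OF x'(1) z'(1)] show ?thesis
    by (simp add: x'(2) z'(2) bergman_dist_tube_aut assms)
qed

section \<open>Change of variables\<close>

lemma nn_integral_lborel_translate:
  fixes f :: "'a::euclidean_space \<Rightarrow> ennreal"
  assumes [measurable]: "f \<in> borel_measurable borel"
  shows "(\<integral>\<^sup>+v. f (x + v) \<partial>lborel) = (\<integral>\<^sup>+v. f v \<partial>lborel)"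
  by (subst (2) lborel_distr_plus[of x, symmetric]) (simp add: nn_integral_distr)

text \<open>Uniqueness of Haar measure: evaluate \<open>\<integral>\<integral> 1\<^sub>A(T v + y) 1\<^sub>B(y) dv dy\<close> in both orders.\<close>

lemma emeasure_lborel_linear_vimage:
  fixes T :: "'a::euclidean_space \<Rightarrow> 'a"
  assumes "linear T" "bij T" and A: "A \<in> sets borel"
  shows "emeasure lborel (T -` A) * emeasure lborel (ball 0 1 :: 'a set) =
         emeasure lborel A * emeasure lborel (T -` ball 0 1)"
proof -
  have T [measurable]: "T \<in> borel_measurable borel"
    by (intro borel_measurable_continuous_onI linear_continuous_on assms linear_conv_bounded_linear[THEN iffD1])
  have Ti: "T (inv T x) = x" for x using assms(2) by (simp add: bij_is_surj surj_f_inv_f)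
  \<comment> \<open>Since y = T (inv T y), the shift by y is a translation of v, which leaves the
    integral unchanged.\<close>
  have shift: "(\<integral>\<^sup>+v. indicator S (T v + y) \<partial>lborel) = emeasure lborel (T -` S)"
    if [measurable]: "S \<in> sets borel" for S :: "'a set" and y
  proof -
    have "(\<integral>\<^sup>+v. indicator S (T v + y) \<partial>lborel) = (\<integral>\<^sup>+v. indicator S (T (inv T y + v)) \<partial>(lborel :: 'a measure))"
      by (simp add: linear_add[OF assms(1)] Ti add.commute)
    also have "\<dots> = (\<integral>\<^sup>+v. indicator S (T v) \<partial>(lborel :: 'a measure))"
      by (rule nn_integral_lborel_translate) measurable
    also have "\<dots> = (\<integral>\<^sup>+v. indicator (T -` S) v \<partial>(lborel :: 'a measure))"
      by (intro nn_integral_cong) (simp add: indicator_def)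
    also have "\<dots> = emeasure lborel (T -` S)"
      using measurable_sets[OF T that] by (subst nn_integral_indicator) auto
    finally show ?thesis .
  qed
  let ?B = "ball 0 1 :: 'a set"
  note A [measurable]
  have [measurable]: "?B \<in> sets borel" by (intro borel_open open_ball)
  have "emeasure lborel (T -` A) * emeasure lborel ?B =
     (\<integral>\<^sup>+y. (\<integral>\<^sup>+v. indicator A (T v + y) \<partial>lborel) * indicator ?B y \<partial>lborel)"
    by (simp add: shift nn_integral_cmult_indicator)
  also have "\<dots> = (\<integral>\<^sup>+y. (\<integral>\<^sup>+v. indicator A (T v + y) * indicator ?B y \<partial>lborel) \<partial>lborel)"
    by (intro nn_integral_cong nn_integral_multc[symmetric]) measurable
  also have "\<dots> = (\<integral>\<^sup>+v. (\<integral>\<^sup>+y. indicator A (T v + y) * indicator ?B y \<partial>lborel) \<partial>lborel)"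
    by (rule lborel_pair.Fubini') measurable
  \<comment> \<open>Writing y as (T v + y) - T v makes both factors functions of T v + y.
    Translation invariance in y then moves T from A to the unit ball.\<close>
  also have "\<dots> = (\<integral>\<^sup>+v. (\<integral>\<^sup>+y. indicator A (T v + y) * indicator ?B (T v + y - T v) \<partial>lborel) \<partial>lborel)"
    by simp
  also have "\<dots> = (\<integral>\<^sup>+v. (\<integral>\<^sup>+y. indicator A y * indicator ?B (y - T v) \<partial>lborel) \<partial>lborel)"
    by (intro nn_integral_cong nn_integral_lborel_translate[of "\<lambda>y. indicator A y * indicator ?B (y - T _)"]) measurable
  also have "\<dots> = (\<integral>\<^sup>+y. (\<integral>\<^sup>+v. indicator A y * indicator ?B (y - T v) \<partial>lborel) \<partial>lborel)"
    by (rule lborel_pair.Fubini') measurable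
  also have "\<dots> = (\<integral>\<^sup>+y. indicator A y * (\<integral>\<^sup>+v. indicator ?B (T v + (- y)) \<partial>lborel) \<partial>lborel)"
  proof (intro nn_integral_cong)
    fix y
    have "indicator ?B (y - T v) = (indicator ?B (T v + (- y)) :: ennreal)" for v
      by (simp add: indicator_def norm_minus_commute)
    then show "(\<integral>\<^sup>+v. indicator A y * indicator ?B (y - T v) \<partial>lborel) =
       indicator A y * (\<integral>\<^sup>+v. indicator ?B (T v + (- y)) \<partial>lborel)"
      by (subst nn_integral_cmult[symmetric]) (auto, measurable)
  qed
  also have "\<dots> = emeasure lborel A * emeasure lborel (T -` ?B)"
    by (subst shift) (simp_all add: nn_integral_multc)
  finally show ?thesis .
qed

text \<open>The unit ball and its preimage are bounded and contain a neighbourhood of 0, so both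
  have positive finite measure and the preceding identity can be divided by that of the ball. The
  factor stays abstract instead of being a determinant; the last clause settles it for isometries,
  whose preimage of the ball is the ball.\<close>

lemma nn_integral_lborel_linear:
  fixes T :: "'a::euclidean_space \<Rightarrow> 'a"
  assumes "linear T" "bij T"
  obtains c :: real where "c > 0"
    "\<And>f. f \<in> borel_measurable borel \<Longrightarrow> (\<integral>\<^sup>+v. f (T v) \<partial>lborel) = ennreal c * (\<integral>\<^sup>+v. f v \<partial>lborel)"
    "(\<And>v. norm (T v) = norm v) \<Longrightarrow> c = 1"
proof -
  let ?B = "ball 0 1 :: 'a set"
  have bl: "bounded_linear T" using assms by (simp add: linear_conv_bounded_linear)
  have cont: "continuous_on UNIV T" by (intro linear_continuous_on bl)
  have T [measurable]: "T \<in> borel_measurable borel"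
    by (intro borel_measurable_continuous_onI cont)
  have bd: "emeasure lborel S \<noteq> 0 \<and> emeasure lborel S < \<infinity>" if S: "open S" "bounded S" "0 \<in> S" for S :: "'a set"
  proof -
    obtain e where "e > 0" "ball 0 e \<subseteq> S" using S by (metis open_contains_ball)
    then have "emeasure lborel (ball 0 e :: 'a set) \<le> emeasure lborel S"
      using S by (intro emeasure_mono) auto
    moreover have "emeasure lborel (ball 0 e :: 'a set) > 0"
      using \<open>e > 0\<close> open_ball[of "0::'a" e] content_ball_pos[of e "0::'a"] emeasure_lborel_ball_finite[of "0::'a" e]
      by (simp add: emeasure_eq_ennreal_measure less_top)
    ultimately show ?thesis using emeasure_bounded_finite[OF S(2)] by auto
  qed
  have 1: "open (T -` ?B)" using cont by (simp add: open_vimage)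
  have 2: "bounded (T -` ?B)"
  proof -
    have "linear (inv T)" using assms by (simp add: bij_is_inj inj_linear_imp_inv_linear)
    then have "bounded (inv T ` ?B)"
      by (intro bounded_linear_image bounded_ball) (simp add: linear_conv_bounded_linear)
    moreover have "T -` ?B = inv T ` ?B" by (rule bij_vimage_eq_inv_image[OF assms(2)])
    ultimately show ?thesis by simp
  qed
  have 3: "0 \<in> T -` ?B" using linear_0[OF assms(1)] by simp
  define c where "c = measure lborel (T -` ?B) / measure lborel ?B"
  have mB: "measure lborel ?B > 0" "emeasure lborel ?B = ennreal (measure lborel ?B)"
    using bd[of ?B] by (auto simp: emeasure_eq_ennreal_measure less_top[symmetric] zero_less_measure_iff)
  have mT: "measure lborel (T -` ?B) > 0" "emeasure lborel (T -` ?B) = ennreal (measure lborel (T -` ?B))"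
    using bd[OF 1 2 3] by (auto simp: emeasure_eq_ennreal_measure less_top[symmetric] zero_less_measure_iff)
  have c0: "c > 0" using mB mT by (simp add: c_def)
  have eq: "emeasure lborel (T -` A) = ennreal c * emeasure lborel A" if "A \<in> sets borel" for A
  proof -
    have "emeasure lborel (T -` A) * ennreal (measure lborel ?B) =
       emeasure lborel A * ennreal (c * measure lborel ?B)"
      using emeasure_lborel_linear_vimage[OF assms that] mB mT by (simp add: c_def)
    also have "\<dots> = (ennreal c * emeasure lborel A) * ennreal (measure lborel ?B)"
      using c0 by (simp add: ennreal_mult mult_ac)
    finally show ?thesis
      using mB(1) by (simp add: mult.commute[of _ "ennreal (measure lborel ?B)"] ennreal_mult_cancel_left)
  qed
  have "distr lborel borel T = density lborel (\<lambda>_. ennreal c)"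
    by (rule measure_eqI) (auto simp: emeasure_distr eq emeasure_density_const)
  then have int: "(\<integral>\<^sup>+v. f (T v) \<partial>lborel) = ennreal c * (\<integral>\<^sup>+v. f v \<partial>lborel)"
    if [measurable]: "f \<in> borel_measurable borel" for f
    using nn_integral_distr[of T lborel borel f] by (simp add: nn_integral_density nn_integral_cmult)
  have "c = 1" if "\<And>v. norm (T v) = norm v"
  proof -
    have "T -` ?B = ?B" using that by auto
    then show ?thesis using mB by (simp add: c_def)
  qed
  with c0 int show thesis using that by blast
qed

section \<open>Scaling factors of shears and dilations\<close>

lemma borel_measurable_tube_lin:
  "tube_lin t a \<in> borel_measurable (borel :: (complex ^ 'n::{finite,linorder}) measure)"
  by (intro borel_measurable_continuous_onI linear_continuous_on)
     (simp add: linear_conv_bounded_linear[symmetric] linear_tube_lin)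

text \<open>
  The shear by \<open>2 a\<close> is both the square of the shear by \<open>a\<close> and conjugate to it by a dilation, so its
  scaling factor satisfies \<open>c = c\<^sup>2\<close>.
\<close>

lemma nn_integral_tube_shear:
  fixes f :: "complex ^ 'n::{finite,linorder} \<Rightarrow> ennreal"
  assumes f: "f \<in> borel_measurable borel"
  shows "(\<integral>\<^sup>+v. f (tube_lin 1 a v) \<partial>lborel) = (\<integral>\<^sup>+v. f v \<partial>lborel)"
proof -
  have comp: "tube_lin 1 a (tube_lin 1 a v) = tube_lin 1 (a + a) v" for v
    by (simp add: tube_lin_def vec_eq_iff sum_distrib_left algebra_simps)
  have conj: "tube_lin 1 (a + a) (tube_lin 2 0 v) = tube_lin 2 0 (tube_lin 1 a v)" for v
    by (simp add: tube_lin_def vec_eq_iff sum_distrib_left algebra_simps)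
  obtain c where c: "c > 0" "\<And>f. f \<in> borel_measurable borel \<Longrightarrow>
      (\<integral>\<^sup>+v. f (tube_lin 1 a v) \<partial>lborel) = ennreal c * (\<integral>\<^sup>+v. f v \<partial>lborel)"
    using nn_integral_lborel_linear[OF linear_tube_lin bij_tube_lin[of 1 a]] by (metis zero_neq_one)
  obtain d where d: "d > 0" "\<And>f. f \<in> borel_measurable borel \<Longrightarrow>
      (\<integral>\<^sup>+v. f (tube_lin 2 0 v) \<partial>lborel) = ennreal d * (\<integral>\<^sup>+v. f v \<partial>(lborel :: (complex, 'n) vec measure))"
    using nn_integral_lborel_linear[OF linear_tube_lin bij_tube_lin[of 2 0]] by (metis zero_neq_numeral)
  have m [measurable]: "tube_lin t b \<in> borel_measurable borel" for t and b :: "(complex, 'n) vec"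
    by (rule borel_measurable_tube_lin)
  \<comment> \<open>Any test function with positive finite integral would do; these two properties
    allow the cancellation that yields c = 1.\<close>
  define g :: "(complex, 'n) vec \<Rightarrow> ennreal" where "g = indicator (ball 0 1)"
  have g [measurable]: "g \<in> borel_measurable borel"
    unfolding g_def by (intro borel_measurable_indicator borel_open open_ball)
  define I where "I = (\<integral>\<^sup>+v. g v \<partial>lborel)"
  obtain i where i: "I = ennreal i" "i > 0"
  proof
    show "I = ennreal (measure lborel (ball 0 1 :: (complex, 'n) vec set))"
      using emeasure_lborel_ball_finite[of "0 :: (complex, 'n) vec" 1]
      by (simp add: I_def g_def emeasure_eq_ennreal_measure less_top)
    show "0 < measure lborel (ball 0 1 :: (complex, 'n) vec set)"
      by (simp add: content_ball_pos)
  qed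
  have "(\<integral>\<^sup>+v. g (tube_lin 1 a (tube_lin 1 a (tube_lin 2 0 v))) \<partial>lborel) = ennreal d * (ennreal c * (ennreal c * I))"
    by (subst d(2)[of "\<lambda>v. g (tube_lin 1 a (tube_lin 1 a v))"], measurable)
       (subst c(2)[of "\<lambda>v. g (tube_lin 1 a v)"], measurable, subst c(2), auto simp: I_def)
  moreover have "(\<integral>\<^sup>+v. g (tube_lin 2 0 (tube_lin 1 a v)) \<partial>lborel) = ennreal c * (ennreal d * I)"
    by (subst c(2)[of "\<lambda>v. g (tube_lin 2 0 v)"], measurable) (subst d(2), auto simp: I_def)
  ultimately have "ennreal d * (ennreal c * (ennreal c * I)) = ennreal c * (ennreal d * I)"
    by (simp only: comp conj)
  then have "ennreal (d * (c * (c * i))) = ennreal (c * (d * i))"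
    using c d i by (simp add: ennreal_mult)
  then have "c = 1"
    using c d i by (subst (asm) ennreal_inj) auto
  then show ?thesis using c(2)[OF f] by simp
qed

text \<open>Of the 2n real coordinates, the two belonging to z_n (the basis vectors in
  \<open>P\<close>) scale by t^2 and the other 2n - 2 by t, so the exponent is 4 + (2n - 2).\<close>

lemma nn_integral_tube_dilation:
  fixes f :: "complex ^ 'n::{finite,linorder} \<Rightarrow> ennreal"
  assumes [measurable]: "f \<in> borel_measurable borel" and t: "t > 0"
  shows "(\<integral>\<^sup>+v. f v \<partial>lborel) = ennreal (t ^ (2 * CARD('n) + 2)) * (\<integral>\<^sup>+v. f (tube_lin t 0 v) \<partial>lborel)"
proof -
  define P :: "(complex, 'n) vec set" where "P = {axis last_ix 1, axis last_ix \<i>}"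
  define c where "c b = (if b \<in> P then t\<^sup>2 else t)" for b
  have PB: "P \<subseteq> Basis" by (auto simp: P_def Basis_vec_def Basis_complex_def)
  have cardP: "card P = 2" by (simp add: P_def axis_eq_axis)
  have T: "0 + (\<Sum>j\<in>Basis. (c j * (x \<bullet> j)) *\<^sub>R j) = tube_lin t 0 x" for x
  proof (rule euclidean_eqI)
    fix b :: "(complex, 'n) vec" assume b: "b \<in> Basis"
    then obtain i u where iu: "b = axis i u" "u \<in> {1, \<i>}"
      by (auto simp: Basis_vec_def Basis_complex_def)
    have "b \<in> P \<longleftrightarrow> i = last_ix"
      using iu by (auto simp: P_def axis_eq_axis)
    then have "c b * (x \<bullet> b) = tube_lin t 0 x \<bullet> b"
      using iu by (auto simp: c_def inner_axis tube_lin_def inner_complex_def power2_eq_square)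
    then show "(0 + (\<Sum>j\<in>Basis. (c j * (x \<bullet> j)) *\<^sub>R j)) \<bullet> b = tube_lin t 0 x \<bullet> b"
      using b by (simp add: inner_sum_left_Basis)
  qed
  have "(\<Prod>j\<in>Basis. \<bar>c j\<bar>) = (\<Prod>j\<in>P. \<bar>c j\<bar>) * (\<Prod>j\<in>Basis - P. \<bar>c j\<bar>)"
    using PB by (metis finite_Basis prod.subset_diff mult.commute)
  also have "(\<Prod>j\<in>P. \<bar>c j\<bar>) = (\<Prod>j\<in>P. t\<^sup>2)"
    by (intro prod.cong) (auto simp: c_def)
  also have "\<dots> = t ^ 4" by (simp add: cardP power_mult[symmetric])
  also have "(\<Prod>j\<in>Basis - P. \<bar>c j\<bar>) = (\<Prod>j\<in>(Basis :: (complex, 'n) vec set) - P. t)"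
    using t by (intro prod.cong) (auto simp: c_def)
  also have "\<dots> = t ^ (2 * CARD('n) - 2)"
    using PB by (simp add: card_Diff_subset finite_subset[OF PB] cardP mult.commute)
  also have "t ^ 4 * t ^ (2 * CARD('n) - 2) = t ^ (2 * CARD('n) + 2)"
  proof -
    have "4 + (2 * CARD('n) - 2) = 2 * CARD('n) + 2"
      using zero_less_card_finite[where 'a='n] by linarith
    then show ?thesis by (simp only: power_add[symmetric])
  qed
  finally have prod: "(\<Prod>j\<in>Basis. \<bar>c j\<bar>) = t ^ (2 * CARD('n) + 2)" .
  have cnz: "\<And>j. j \<in> Basis \<Longrightarrow> c j \<noteq> 0" using t by (simp add: c_def)
  have leb: "(lborel :: (complex, 'n) vec measure) = density (distr lborel borel (tube_lin t 0)) (\<lambda>_. ennreal (t ^ (2 * CARD('n) + 2)))"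
    using lborel_affine_euclidean[of c 0] cnz unfolding T prod by auto
  have m [measurable]: "tube_lin t (0::(complex, 'n) vec) \<in> borel_measurable borel"
    by (rule borel_measurable_tube_lin)
  show ?thesis
    by (subst leb) (simp add: nn_integral_density nn_integral_distr nn_integral_cmult)
qed

text \<open>A shear after a dilation, and the shear preserves volume.\<close>

lemma nn_integral_tube_lin:
  fixes f :: "complex ^ 'n::{finite,linorder} \<Rightarrow> ennreal"
  assumes [measurable]: "f \<in> borel_measurable borel" and t: "t > 0"
  shows "(\<integral>\<^sup>+v. f v \<partial>lborel) = ennreal (t ^ (2 * CARD('n) + 2)) * (\<integral>\<^sup>+v. f (tube_lin t a v) \<partial>lborel)"
proof -
  have comp: "tube_lin 1 a (tube_lin t 0 v) = tube_lin t a v" for v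
    by (simp add: tube_lin_def vec_eq_iff sum_distrib_left algebra_simps)
  have m [measurable]: "tube_lin 1 a \<in> borel_measurable borel"
    by (rule borel_measurable_tube_lin)
  have "(\<integral>\<^sup>+v. f v \<partial>lborel) = (\<integral>\<^sup>+v. f (tube_lin 1 a v) \<partial>lborel)"
    by (rule nn_integral_tube_shear[symmetric]) fact
  also have "\<dots> = ennreal (t ^ (2 * CARD('n) + 2)) * (\<integral>\<^sup>+v. f (tube_lin 1 a (tube_lin t 0 v)) \<partial>lborel)"
    by (rule nn_integral_tube_dilation) (measurable, fact)
  finally show ?thesis by (simp add: comp)
qed

section \<open>The weighted measure and its behaviour under automorphisms\<close>

lemma borel_tube_B: "tube_B \<in> sets (borel :: (complex ^ 'n::{finite,linorder}) measure)"
  by (simp add: borel_open open_tube_B)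

lemma borel_measurable_rho: "(rho :: complex ^ 'n::{finite,linorder} \<Rightarrow> real) \<in> borel_measurable borel"
  by (intro borel_measurable_continuous_onI continuous_on_rho continuous_on_id)

lemma sets_dV: "sets (dV \<alpha>) = sets (restrict_space borel tube_B)"
  by (simp add: dV_def sets_restrict_space)

lemma space_dV: "space (dV \<alpha>) = tube_B"
  by (simp add: dV_def space_restrict_space)

lemma measurable_dV: "borel_measurable (dV \<alpha>) = borel_measurable (restrict_space borel tube_B)"
  by (intro measurable_cong_sets sets_dV refl)

lemma nn_integral_dV:
  fixes F :: "complex ^ 'n::{finite,linorder} \<Rightarrow> ennreal"
  assumes F: "F \<in> borel_measurable (restrict_space borel tube_B)"
  shows "(\<integral>\<^sup>+z. F z \<partial>dV \<alpha>) = (\<integral>\<^sup>+z. ennreal (rho z powr \<alpha>) * F z * indicator tube_B z \<partial>lborel)"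
proof -
  have tube: "tube_B \<in> sets (lborel :: (complex, 'n) vec measure)"
    by (simp add: borel_tube_B)
  note borel_measurable_rho [measurable]
  have rho: "(\<lambda>z :: (complex, 'n) vec. ennreal (rho z powr \<alpha>)) \<in> borel_measurable borel"
    by measurable
  have s: "sets (restrict_space lborel tube_B) = sets (restrict_space borel (tube_B :: (complex, 'n) vec set))"
    by (simp add: sets_restrict_space)
  have "(\<integral>\<^sup>+z. F z \<partial>dV \<alpha>) = (\<integral>\<^sup>+z. ennreal (rho z powr \<alpha>) * F z \<partial>restrict_space lborel tube_B)"
    unfolding dV_def using F rho
    by (intro nn_integral_density) (auto simp: measurable_cong_sets[OF s refl] intro: measurable_restrict_space1)
  also have "\<dots> = (\<integral>\<^sup>+z. ennreal (rho z powr \<alpha>) * F z * indicator tube_B z \<partial>lborel)"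
    using tube by (intro nn_integral_restrict_space) simp
  finally show ?thesis .
qed

text \<open>With t^2 = rho(a), the Jacobian t^(2n+2) is rho(a)^(n+1), and rho(a)^\<alpha> comes from
  rho(tube_aut a w) = rho(a) rho(w). The two translations in \<open>tube_aut\<close> cost
  nothing.\<close>

lemma nn_integral_dV_tube_aut:
  fixes F :: "complex ^ 'n::{finite,linorder} \<Rightarrow> ennreal"
  assumes a: "a \<in> tube_B" and F: "F \<in> borel_measurable (restrict_space borel tube_B)"
  shows "(\<integral>\<^sup>+z. F z \<partial>dV \<alpha>) =
    ennreal (rho a powr (real CARD('n) + \<alpha> + 1)) * (\<integral>\<^sup>+w. F (tube_aut a w) \<partial>dV \<alpha>)"
proof -
  define t where "t = sqrt (rho a)"
  have t: "t > 0" "t\<^sup>2 = rho a" using a by (auto simp: t_def mem_tube_B_iff)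
  define G where "G z = ennreal (rho z powr \<alpha>) * F z * indicator tube_B z" for z
  note borel_measurable_rho [measurable]
  note tube [measurable] = borel_tube_B
  have [measurable]: "(\<lambda>z. F z * indicator tube_B z) \<in> borel_measurable borel"
    using F tube by (simp add: borel_measurable_restrict_space_iff_ennreal)
  have G [measurable]: "G \<in> borel_measurable borel"
    unfolding G_def mult.assoc by measurable
  have lin [measurable]: "tube_lin t a \<in> borel_measurable borel"
    by (rule borel_measurable_tube_lin)
  have aut: "tube_aut a \<in> measurable (restrict_space borel tube_B) (restrict_space borel tube_B)"
    using a by (intro measurable_restrict_space2 measurable_restrict_space1 borel_measurable_continuous_onI
        continuous_on_tube_aut) (auto simp: space_restrict_space tube_aut_in_tube_iff)
  have Fa: "(\<lambda>w. F (tube_aut a w)) \<in> borel_measurable (restrict_space borel tube_B)"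
    using measurable_compose[OF aut F] .
  have G_aut: "G (tube_aut a w) = ennreal (rho a powr \<alpha>) * (ennreal (rho w powr \<alpha>) * F (tube_aut a w) * indicator tube_B w)" for w
  proof (cases "w \<in> tube_B")
    case True
    then show ?thesis using a
      by (simp add: G_def tube_aut_in_tube_iff rho_tube_aut mem_tube_B_iff powr_mult ennreal_mult mult.assoc)
  next
    case False
    then show ?thesis using a by (simp add: G_def tube_aut_in_tube_iff)
  qed
  have "(\<integral>\<^sup>+z. F z \<partial>dV \<alpha>) = (\<integral>\<^sup>+z. G z \<partial>lborel)"
    unfolding G_def by (rule nn_integral_dV[OF F])
  also have "\<dots> = (\<integral>\<^sup>+v. G (a + v) \<partial>lborel)"
    by (rule nn_integral_lborel_translate[symmetric]) fact
  also have "\<dots> = ennreal (t ^ (2 * CARD('n) + 2)) * (\<integral>\<^sup>+v. G (a + tube_lin t a v) \<partial>lborel)"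
    by (rule nn_integral_tube_lin) (measurable, fact)
  also have "(\<integral>\<^sup>+v. G (a + tube_lin t a v) \<partial>lborel) = (\<integral>\<^sup>+v. G (a + tube_lin t a (- base_pt + v)) \<partial>lborel)"
    by (rule nn_integral_lborel_translate[symmetric]) measurable
  also have "\<dots> = (\<integral>\<^sup>+w. G (tube_aut a w) \<partial>lborel)"
    by (simp add: tube_aut_def t_def)
  also have "\<dots> = ennreal (rho a powr \<alpha>) * (\<integral>\<^sup>+w. F (tube_aut a w) \<partial>dV \<alpha>)"
    unfolding G_aut nn_integral_dV[OF Fa]
  proof (rule nn_integral_cmult)
    have [measurable]: "(\<lambda>z. F (tube_aut a z) * indicator tube_B z) \<in> borel_measurable borel"
      using Fa tube by (simp add: borel_measurable_restrict_space_iff_ennreal)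
    show "(\<lambda>w. ennreal (rho w powr \<alpha>) * F (tube_aut a w) * indicator tube_B w) \<in> borel_measurable lborel"
      unfolding mult.assoc by measurable
  qed
  also have "ennreal (t ^ (2 * CARD('n) + 2)) * (ennreal (rho a powr \<alpha>) * (\<integral>\<^sup>+w. F (tube_aut a w) \<partial>dV \<alpha>)) =
     ennreal (t ^ (2 * CARD('n) + 2) * rho a powr \<alpha>) * (\<integral>\<^sup>+w. F (tube_aut a w) \<partial>dV \<alpha>)"
    using t by (simp add: ennreal_mult mult.assoc)
  also have "t ^ (2 * CARD('n) + 2) = rho a powr (real CARD('n) + 1)"
  proof -
    have "t ^ (2 * CARD('n) + 2) = (t\<^sup>2) ^ (CARD('n) + 1)"
      by (simp only: power_mult[symmetric]) (simp add: algebra_simps)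
    also have "\<dots> = rho a powr (real (CARD('n) + 1))"
      using t a by (subst powr_realpow) (auto simp: mem_tube_B_iff)
    finally show ?thesis by (simp add: add.commute)
  qed
  also have "rho a powr (real CARD('n) + 1) * rho a powr \<alpha> = rho a powr (real CARD('n) + \<alpha> + 1)"
    by (simp add: powr_add[symmetric] add_ac)
  finally show ?thesis .
qed

section \<open>The sub-mean value property\<close>

text \<open>The supporting line of the convex function t^p at m, from Young's inequality with
  weights 1/p and 1 - 1/p. Integrated over t it gives Jensen's inequality.\<close>

lemma powr_ge_tangent:
  fixes p t m :: real
  assumes "p \<ge> 1" "t \<ge> 0" "m \<ge> 0"
  shows "m powr p + p * m powr (p - 1) * (t - m) \<le> t powr p"
proof (cases "m = 0 \<or> t = 0")
  case True
  have "m powr (p - 1) * m = m powr p" using assms by (cases "m = 0") (auto simp: powr_mult_base mult.commute)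
  then have "m powr p + p * m powr (p - 1) * (0 - m) = (1 - p) * m powr p"
    by (simp add: algebra_simps)
  also have "\<dots> \<le> 0" using assms by (intro mult_nonpos_nonneg) auto
  finally show ?thesis using True by auto
next
  case False
  then have pos: "m > 0" "t > 0" using assms by auto
  have "(t powr p) powr (1 / p) * (m powr p) powr (1 - 1 / p) \<le> 1 / p * t powr p + (1 - 1 / p) * m powr p"
    using pos assms by (intro Youngs_inequality_0) auto
  also have "(t powr p) powr (1 / p) = t" using pos assms by (simp add: powr_powr)
  also have "(m powr p) powr (1 - 1 / p) = m powr (p - 1)"
    using assms by (simp add: powr_powr right_diff_distrib)
  finally have "p * (t * m powr (p - 1)) \<le> p * (1 / p * t powr p + (1 - 1 / p) * m powr p)"
    using assms by (intro mult_left_mono) auto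
  also have "\<dots> = t powr p + (p - 1) * m powr p"
    using assms by (simp add: algebra_simps)
  finally have "p * (t * m powr (p - 1)) \<le> t powr p + (p - 1) * m powr p" .
  moreover have "m powr (p - 1) * m = m powr p" using pos by (simp add: powr_mult_base mult.commute)
  ultimately show ?thesis by (simp add: algebra_simps)
qed

text \<open>Cauchy's formula on the unit circle is the mean value property, so m = |g(0)| is at most
  the mean of |g|. Integrating the supporting line of t^p at this m, whose linear term then has
  nonnegative mean, yields the claim.\<close>

lemma norm_powr_circle_mean:
  fixes g :: "complex \<Rightarrow> complex"
  assumes hol: "g holomorphic_on S" and S: "cball 0 1 \<subseteq> S" and p: "p \<ge> 1"
  shows "ennreal (norm (g 0) powr p) \<le>
    (\<integral>\<^sup>+t. ennreal (norm (g (exp (2 * of_real pi * \<i> * of_real t))) powr p) * indicator {0..1} t \<partial>lborel)"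
proof -
  define e where "e t = exp (2 * of_real pi * \<i> * complex_of_real t)" for t
  have e: "circlepath 0 1 t = e t" for t by (simp add: circlepath e_def)
  have ne: "norm (e t) = 1" for t by (simp add: e_def norm_exp_eq_Re)
  have hol': "g holomorphic_on cball 0 1" using hol S holomorphic_on_subset by blast
  have conte: "continuous_on A e" for A unfolding e_def by (intro continuous_intros)
  have cont: "continuous_on {0..1} (\<lambda>t. g (e t))"
    by (rule continuous_on_compose2[OF holomorphic_on_imp_continuous_on[OF hol'] conte]) (auto simp: ne)
  have "((\<lambda>u. g u / (u - 0)) has_contour_integral (2 * of_real pi * \<i> * g 0)) (circlepath 0 1)"
    by (rule Cauchy_integral_circlepath_simple[OF hol']) simp
  then have "((\<lambda>t. g (e t) / e t * vector_derivative (circlepath 0 1) (at t within {0..1})) has_integral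
     2 * of_real pi * \<i> * g 0) {0..1}"
    by (simp add: has_contour_integral_def e)
  then have "((\<lambda>t. 2 * of_real pi * \<i> * g (e t)) has_integral 2 * of_real pi * \<i> * g 0) {0..1}"
  proof (rule has_integral_eq[rotated])
    fix t :: real assume "t \<in> {0..1}"
    then have "vector_derivative (circlepath 0 1) (at t within {0..1}) = 2 * of_real pi * \<i> * e t"
      by (simp add: vector_derivative_circlepath01 e_def)
    moreover have "e t \<noteq> 0" by (simp add: e_def)
    ultimately show "g (e t) / e t * vector_derivative (circlepath 0 1) (at t within {0..1}) = 2 * of_real pi * \<i> * g (e t)"
      by simp
  qed
  from has_integral_mult_right[OF this, of "inverse (2 * of_real pi * \<i>)"]
  have "((\<lambda>t. g (e t)) has_integral g 0) {0..1}" by (simp add: field_simps)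
  then have g0: "integral {0..1} (\<lambda>t. g (e t)) = g 0" by (rule integral_unique)
  define m where "m = norm (g 0)"
  have int1: "(\<lambda>t. norm (g (e t))) integrable_on {0..1}"
    by (intro integrable_continuous_interval continuous_intros cont)
  have int2: "(\<lambda>t. norm (g (e t)) powr p) integrable_on {0..1}"
    using p by (intro integrable_continuous_interval continuous_on_powr' continuous_intros cont) auto
  have m: "m \<le> integral {0..1} (\<lambda>t. norm (g (e t)))"
    unfolding m_def g0[symmetric]
    by (rule integral_norm_bound_integral[OF integrable_continuous_interval[OF cont] int1]) simp
  have "m powr p \<le> m powr p + p * m powr (p - 1) * (integral {0..1} (\<lambda>t. norm (g (e t))) - m)"
    using m p by simp
  also have "\<dots> = integral {0..1} (\<lambda>t. m powr p + p * m powr (p - 1) * (norm (g (e t)) - m))"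
  proof -
    have "((\<lambda>t. m powr p + p * m powr (p - 1) * (norm (g (e t)) - m)) has_integral
        (m powr p + p * m powr (p - 1) * (integral {0..1} (\<lambda>t. norm (g (e t))) - m))) {0..1}"
      using has_integral_const_real[of "m powr p" 0 1] has_integral_const_real[of m 0 1] int1
      by (intro has_integral_add has_integral_mult_right has_integral_diff integrable_integral) auto
    then show ?thesis by (simp add: integral_unique)
  qed
  also have "\<dots> \<le> integral {0..1} (\<lambda>t. norm (g (e t)) powr p)"
  proof (rule integral_le)
    show "(\<lambda>t. m powr p + p * m powr (p - 1) * (norm (g (e t)) - m)) integrable_on {0..1}"
      by (intro integrable_continuous_interval continuous_intros cont)
    show "m powr p + p * m powr (p - 1) * (norm (g (e t)) - m) \<le> norm (g (e t)) powr p" for t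
      using p by (intro powr_ge_tangent) (auto simp: m_def)
  qed fact
  finally have "ennreal (m powr p) \<le> ennreal (integral {0..1} (\<lambda>t. norm (g (e t)) powr p))"
    by (rule ennreal_leI)
  also have "\<dots> = (\<integral>\<^sup>+t. ennreal (indicator {0..1} t * norm (g (e t)) powr p) \<partial>lborel)"
    by (rule nn_integral_has_integral_lebesgue[symmetric, OF _ integrable_integral[OF int2]]) auto
  also have "\<dots> = (\<integral>\<^sup>+t. ennreal (norm (g (e t)) powr p) * indicator {0..1} t \<partial>lborel)"
    by (intro nn_integral_cong) (auto simp: indicator_def)
  finally show ?thesis by (simp add: m_def e_def)
qed

section \<open>From one variable to several\<close>

lemma norm_vec_cmult: "norm (c *s v) = norm c * norm (v :: complex ^ 'n)"
  by (simp add: norm_vec_def norm_mult L2_set_right_distrib)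

lemma linear_vec_cmult: "linear (\<lambda>v :: complex ^ 'n. c *s v)"
  by (rule linearI) (simp_all add: vec_eq_iff algebra_simps)

text \<open>Multiplication by a unimodular scalar is an isometry, so its scaling factor is
  1.\<close>

lemma nn_integral_lborel_rotate:
  fixes f :: "complex ^ 'n \<Rightarrow> ennreal"
  assumes f: "f \<in> borel_measurable borel" and c: "norm c = 1"
  shows "(\<integral>\<^sup>+v. f (c *s v) \<partial>lborel) = (\<integral>\<^sup>+v. f v \<partial>lborel)"
proof -
  have "c \<noteq> 0" using c by auto
  then have "bij (\<lambda>v :: complex ^ 'n. c *s v)"
    by (intro o_bij[of "\<lambda>v. inverse c *s v"]) (auto simp: fun_eq_iff vec_eq_iff)
  then obtain k :: real where k:
      "\<And>f. f \<in> borel_measurable borel \<Longrightarrow>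
        (\<integral>\<^sup>+v. f (c *s v) \<partial>(lborel :: (complex ^ 'n) measure)) = ennreal k * (\<integral>\<^sup>+v. f v \<partial>lborel)"
      "(\<And>v :: complex ^ 'n. norm (c *s v) = norm v) \<Longrightarrow> k = 1"
    using nn_integral_lborel_linear[OF linear_vec_cmult] by metis
  then show ?thesis using f c by (simp add: norm_vec_cmult)
qed

lemma holomorphic_vec_on_continuous: "holomorphic_vec_on f S \<Longrightarrow> continuous_on S f"
  unfolding holomorphic_vec_on_def continuous_on_eq_continuous_within
  by (meson has_derivative_continuous)

text \<open>Complex linearity of the derivative turns h \<mapsto> f'(h v) into multiplication by the
  number f'(v), a complex derivative.\<close>

lemma holomorphic_vec_on_line:
  assumes f: "holomorphic_vec_on f S" and S: "open S"
  shows "(\<lambda>c. f (z + c *s v)) holomorphic_on {c. z + c *s v \<in> S}"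
  unfolding holomorphic_on_def
proof
  fix c assume "c \<in> {c. z + c *s v \<in> S}"
  then have c: "z + c *s v \<in> S" by simp
  then obtain f' where f': "(f has_derivative f') (at (z + c *s v))" "\<And>c v. f' (c *s v) = c * f' v"
    using f S by (metis holomorphic_vec_on_def at_within_open)
  have "linear (\<lambda>c :: complex. c *s v)"
    by (rule linearI) (simp_all add: vec_eq_iff algebra_simps)
  then have "bounded_linear (\<lambda>c :: complex. c *s v)"
    by (simp add: linear_conv_bounded_linear)
  then have "((\<lambda>c. z + c *s v) has_derivative (\<lambda>h. h *s v)) (at c)"
    by (auto intro!: derivative_eq_intros bounded_linear_imp_has_derivative)
  from diff_chain_at[OF this f'(1)]
  have "((\<lambda>c. f (z + c *s v)) has_derivative (\<lambda>h. f' v * h)) (at c)"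
    by (simp add: o_def f'(2) mult.commute)
  then have "((\<lambda>c. f (z + c *s v)) has_field_derivative f' v) (at c)"
    by (simp add: has_field_derivative_def)
  then show "(\<lambda>c. f (z + c *s v)) field_differentiable at c within {c. z + c *s v \<in> S}"
    using field_differentiable_at_within field_differentiable_def by blast
qed

text \<open>
  On each complex line through \<open>z\<close> the one-variable mean value inequality applies; since Lebesgue measure
  is invariant under \<open>v \<mapsto> e\<^bsup>it\<^esup> v\<close>, averaging over \<open>t\<close> leaves the integral over the ball unchanged.
\<close>

lemma holomorphic_vec_sub_mean_value:
  fixes f :: "complex ^ 'n \<Rightarrow> complex"
  assumes f: "holomorphic_vec_on f S" and S: "open S" and sub: "ball z d \<subseteq> S" and p: "p \<ge> 1"
  shows "ennreal (norm (f z) powr p) * emeasure lborel (ball (0 :: complex ^ 'n) d) \<le>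
    (\<integral>\<^sup>+w. ennreal (norm (f w) powr p) * indicator (ball z d) w \<partial>lborel)"
proof -
  \<comment> \<open>The cut-off belongs to \<open>F\<close> because f is controlled on S only, while
    the exchange of integrals needs a Borel function on the whole space.\<close>
  define F where "F w = ennreal (norm (f w) powr p) * indicator (ball z d) w" for w
  define e where "e t = exp (2 * of_real pi * \<i> * complex_of_real t)" for t
  have ne: "norm (e t) = 1" for t by (simp add: e_def norm_exp_eq_Re)
  have "continuous_on (ball z d) (\<lambda>w. norm (f w) powr p)"
    using p by (intro continuous_on_powr' continuous_intros
       continuous_on_subset[OF holomorphic_vec_on_continuous[OF f] sub]) auto
  then have "(\<lambda>w. ennreal (indicator (ball z d) w *\<^sub>R (norm (f w) powr p))) \<in> borel_measurable borel"
    by (intro measurable_compose[OF borel_measurable_continuous_on_indicator measurable_ennreal] borel_open open_ball)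
  moreover have "(\<lambda>w. ennreal (indicator (ball z d) w *\<^sub>R (norm (f w) powr p))) = F"
    by (auto simp: F_def indicator_def fun_eq_iff)
  ultimately have F [measurable]: "F \<in> borel_measurable borel" by (simp only:)
  have rot [measurable]: "(\<lambda>x. e (fst x) *s snd x :: complex ^ 'n) \<in> borel_measurable (borel \<Otimes>\<^sub>M borel)"
    unfolding borel_prod vector_scalar_mult_def e_def
    by (intro borel_measurable_continuous_onI continuous_intros)
  have [measurable]: "{0..1::real} \<in> sets borel" by simp
  have B [measurable]: "ball (0 :: complex ^ 'n) d \<in> sets borel" by (intro borel_open open_ball)
  have rot1 [measurable]: "(\<lambda>v. e t *s v :: complex ^ 'n) \<in> borel_measurable borel" for t
    unfolding vector_scalar_mult_def by (intro borel_measurable_continuous_onI continuous_intros)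
  have meas [measurable]: "(\<lambda>x. F (z + e (fst x) *s snd x) * indicator {0..1} (fst x)) \<in> borel_measurable (borel \<Otimes>\<^sub>M borel)"
    by measurable
  have "ennreal (norm (f z) powr p) * emeasure lborel (ball (0 :: complex ^ 'n) d) =
     (\<integral>\<^sup>+v. ennreal (norm (f z) powr p) * indicator (ball (0 :: complex ^ 'n) d) v \<partial>lborel)"
    by (simp add: nn_integral_cmult_indicator)
  also have "\<dots> \<le> (\<integral>\<^sup>+v. (\<integral>\<^sup>+t. F (z + e t *s v) * indicator {0..1} t \<partial>lborel) \<partial>lborel)"
  proof (rule nn_integral_mono)
    fix v :: "complex ^ 'n"
    show "ennreal (norm (f z) powr p) * indicator (ball 0 d) v \<le>
       (\<integral>\<^sup>+t. F (z + e t *s v) * indicator {0..1} t \<partial>lborel)"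
    proof (cases "v \<in> ball 0 d")
      case True
      have in_ball: "z + c *s v \<in> ball z d" if "norm c \<le> 1" for c
      proof -
        have "norm c * norm v \<le> 1 * norm v" using that by (intro mult_right_mono) auto
        then show ?thesis using True by (simp add: dist_norm norm_vec_cmult)
      qed
      have "ennreal (norm (f (z + 0 *s v)) powr p) \<le>
        (\<integral>\<^sup>+t. ennreal (norm (f (z + exp (2 * of_real pi * \<i> * of_real t) *s v)) powr p) * indicator {0..1} t \<partial>lborel)"
        by (rule norm_powr_circle_mean[OF holomorphic_vec_on_line[OF f S] _ p]) (use in_ball sub in auto)
      also have "\<dots> = (\<integral>\<^sup>+t. F (z + e t *s v) * indicator {0..1} t \<partial>lborel)"
        using in_ball by (intro nn_integral_cong) (simp add: F_def ne flip: e_def)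
      finally show ?thesis using True by simp
    qed simp
  qed
  also have "\<dots> = (\<integral>\<^sup>+t. (\<integral>\<^sup>+v. F (z + e t *s v) * indicator {0..1} t \<partial>lborel) \<partial>lborel)"
    by (rule lborel_pair.Fubini') (simp add: split_beta', measurable)
  also have "\<dots> = (\<integral>\<^sup>+t. (\<integral>\<^sup>+v. F (z + e t *s v) \<partial>lborel) * indicator {0..1} t \<partial>lborel)"
    by (intro nn_integral_cong nn_integral_multc) measurable
  also have "\<dots> = (\<integral>\<^sup>+t. (\<integral>\<^sup>+v. F v \<partial>lborel) * indicator {0..1::real} t \<partial>lborel)"
  proof -
    have "(\<integral>\<^sup>+v. F (z + e t *s v) \<partial>lborel) = (\<integral>\<^sup>+v. F v \<partial>lborel)" for t
    proof -
      have "(\<integral>\<^sup>+v. F (z + e t *s v) \<partial>lborel) = (\<integral>\<^sup>+v. F (z + v) \<partial>lborel)"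
        by (rule nn_integral_lborel_rotate[of "\<lambda>v. F (z + v)"]) (measurable, simp add: ne)
      also have "\<dots> = (\<integral>\<^sup>+v. F v \<partial>lborel)"
        by (rule nn_integral_lborel_translate) measurable
      finally show ?thesis .
    qed
    then show ?thesis by simp
  qed
  also have "\<dots> = (\<integral>\<^sup>+v. F v \<partial>lborel)"
    by (subst nn_integral_cmult_indicator) auto
  finally show ?thesis by (simp add: F_def)
qed

section \<open>Integrability of the kernel\<close>

lemma rho_le_norm: "rho z \<le> norm z"
proof -
  have "0 \<le> (\<Sum>j\<in>UNIV - {last_ix}. (Im (z $ j))\<^sup>2)" by (intro sum_nonneg) auto
  then have "rho z \<le> Im (z $ last_ix)" by (simp add: rho_def)
  also have "\<dots> \<le> norm (z $ last_ix)" using abs_Im_le_cmod abs_le_iff by blast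
  also have "\<dots> \<le> norm z" by (rule Finite_Cartesian_Product.norm_nth_le)
  finally show ?thesis .
qed

text \<open>
  Averaging over the translations \<open>z \<mapsto> z + i t e\<^sub>n\<close> with \<open>t \<in> [0, 1]\<close>, which raise \<open>\<rho>\<close> by \<open>t\<close>, reduces
  the claim to the integrability of \<open>u\<^sup>\<alpha>\<close> near \<open>0\<close>.
\<close>

lemma dV_cball_finite:
  fixes B :: real
  assumes \<alpha>: "\<alpha> > -1"
  shows "(\<integral>\<^sup>+z. indicator (cball 0 B) z \<partial>(dV \<alpha> :: (complex ^ 'n::{finite,linorder}) measure)) < \<infinity>"
proof -
  note borel_tube_B [measurable] borel_measurable_rho [measurable]
  let ?C = "cball (0 :: (complex, 'n) vec) B"
  have C [measurable]: "?C \<in> sets borel" by (intro borel_closed closed_cball)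
  have C1 [measurable]: "cball (0 :: (complex, 'n) vec) (B + 1) \<in> sets borel"
    by (intro borel_closed closed_cball)
  define F :: "(complex, 'n) vec \<Rightarrow> ennreal"
    where "F z = ennreal (rho z powr \<alpha>) * indicator ?C z * indicator tube_B z" for z
  define G :: "real \<Rightarrow> ennreal"
    where "G u = ennreal (indicator {0<..\<bar>B\<bar>} u * u powr \<alpha>)" for u
  define J where "J = (\<integral>\<^sup>+u. G u \<partial>lborel)"
  have [measurable]: "F \<in> borel_measurable borel" "G \<in> borel_measurable borel"
    unfolding F_def G_def by measurable
  have J: "J < \<infinity>"
  proof -
    \<comment> \<open>\<alpha> > -1 is exactly integrability of u^\<alpha> at 0.\<close>
    have "(\<lambda>u. u powr \<alpha>) integrable_on {0<..\<bar>B\<bar>}"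
      by (rule integrable_on_powr_from_0') (use \<alpha> in auto)
    then have "J = ennreal (integral {0<..\<bar>B\<bar>} (\<lambda>u. u powr \<alpha>))"
      unfolding J_def G_def by (intro nn_integral_has_integral_lebesgue integrable_integral) auto
    then show ?thesis by simp
  qed
  define e :: "(complex, 'n) vec" where "e = axis last_ix \<i>"
  have "e \<in> Basis" by (auto simp: e_def Basis_vec_def Basis_complex_def)
  then have ne: "norm e = 1" by (rule norm_Basis)
  have rho_e: "rho (t *\<^sub>R e + z) = t + rho z" for t z
  proof -
    have "(\<Sum>j\<in>UNIV - {last_ix}. (Im ((t *\<^sub>R e + z) $ j))\<^sup>2) = (\<Sum>j\<in>UNIV - {last_ix}. (Im (z $ j))\<^sup>2)"
      by (intro sum.cong) (auto simp: e_def axis_def)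
    then show ?thesis by (simp add: rho_def) (simp add: e_def)
  qed
  \<comment> \<open>The height u = rho(z) + t of the translated point lies in (0, |B|] by
    \<open>rho_le_norm\<close>, and z has moved by at most 1. The t-integral of
    \<open>G (rho z + t)\<close> equals \<open>J\<close> whatever z is.\<close>
  have bound: "F (t *\<^sub>R e + z) * indicator {0..1} t \<le> indicator (cball 0 (B + 1)) z * G (rho z + t)" for t z
  proof (cases "t \<in> {0..1} \<and> t *\<^sub>R e + z \<in> ?C \<and> t *\<^sub>R e + z \<in> tube_B")
    case True
    have "norm z \<le> norm (t *\<^sub>R e + z) + norm (t *\<^sub>R e)"
      by (metis add_diff_cancel_left' norm_triangle_ineq4)
    then have "z \<in> cball 0 (B + 1)" using True ne by simp
    moreover have "rho z + t \<le> \<bar>B\<bar>" "0 < rho z + t"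
      using True rho_le_norm[of "t *\<^sub>R e + z"] by (auto simp: rho_e mem_tube_B_iff)
    ultimately show ?thesis using True
      by (simp add: F_def G_def rho_e add.commute[of "rho z" t])
  next
    case False
    then show ?thesis by (auto simp: F_def indicator_def)
  qed
  have [measurable]: "(\<lambda>x. F (snd x *\<^sub>R e + fst x) * indicator {0..1} (snd x)) \<in> borel_measurable (borel \<Otimes>\<^sub>M borel)"
    by measurable
  have "(\<integral>\<^sup>+z. indicator ?C z \<partial>dV \<alpha>) = (\<integral>\<^sup>+z. F z \<partial>lborel)"
    unfolding F_def by (rule nn_integral_dV) (intro measurable_restrict_space1 borel_measurable_indicator C)
  also have "\<dots> = (\<integral>\<^sup>+t. (\<integral>\<^sup>+z. F z \<partial>lborel) * indicator {0..1::real} t \<partial>lborel)"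
    by (subst nn_integral_cmult_indicator) auto
  also have "\<dots> = (\<integral>\<^sup>+t. (\<integral>\<^sup>+z. F (t *\<^sub>R e + z) \<partial>lborel) * indicator {0..1} t \<partial>lborel)"
    by (simp add: nn_integral_lborel_translate)
  also have "\<dots> = (\<integral>\<^sup>+t. (\<integral>\<^sup>+z. F (t *\<^sub>R e + z) * indicator {0..1} t \<partial>lborel) \<partial>lborel)"
    by (intro nn_integral_cong nn_integral_multc[symmetric]) measurable
  also have "\<dots> = (\<integral>\<^sup>+z. (\<integral>\<^sup>+t. F (t *\<^sub>R e + z) * indicator {0..1} t \<partial>lborel) \<partial>lborel)"
    by (rule lborel_pair.Fubini') measurable
  also have "\<dots> \<le> (\<integral>\<^sup>+z. (\<integral>\<^sup>+t. indicator (cball 0 (B + 1)) z * G (rho z + t) \<partial>lborel)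
      \<partial>(lborel :: (complex, 'n) vec measure))"
    by (intro nn_integral_mono bound)
  also have "\<dots> = (\<integral>\<^sup>+z. indicator (cball 0 (B + 1)) z * J \<partial>(lborel :: (complex, 'n) vec measure))"
    by (simp add: nn_integral_cmult nn_integral_lborel_translate J_def)
  also have "\<dots> = emeasure lborel (cball (0 :: (complex, 'n) vec) (B + 1)) * J"
    by (simp add: nn_integral_multc)
  also have "\<dots> < \<infinity>"
    using J emeasure_lborel_cball_finite[of "0 :: (complex, 'n) vec" "B + 1"]
    by (simp add: ennreal_mult_less_top)
  finally show ?thesis .
qed

text \<open>The dilation taking the base point to height \<open>R\<close> pulls the sublevel set back into a fixed ball.\<close>

lemma dV_rho2_sublevel:
  assumes \<alpha>: "\<alpha> > -1"
  obtains M :: real where "M \<ge> 0"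
    "\<And>R. R \<ge> 1 \<Longrightarrow>
      (\<integral>\<^sup>+z. indicator {z. norm (rho2 z base_pt) \<le> R} z \<partial>(dV \<alpha> :: (complex ^ 'n::{finite,linorder}) measure))
       \<le> ennreal (R powr (real CARD('n) + \<alpha> + 1) * M)"
proof -
  define s where "s = real CARD('n) + \<alpha> + 1"
  obtain B where B: "\<And>z a :: (complex, 'n) vec.
      norm z \<le> real CARD('n) \<Longrightarrow> 0 \<le> rho z \<Longrightarrow> 0 \<le> rho a \<Longrightarrow> norm (rho2 z a) \<le> 1 \<Longrightarrow> norm a \<le> B"
    using norm_bound_of_rho2_bound[of "real CARD('n)" 1] by blast
  define I where "I = (\<integral>\<^sup>+z. indicator (cball 0 B) z \<partial>(dV \<alpha> :: (complex, 'n) vec measure))"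
  have I: "I = ennreal (enn2real I)"
    unfolding I_def by (intro ennreal_enn2real[symmetric] dV_cball_finite[OF \<alpha>, unfolded infinity_ennreal_def])
  have "(\<integral>\<^sup>+z. indicator {z. norm (rho2 z base_pt) \<le> R} z \<partial>(dV \<alpha> :: (complex, 'n) vec measure))
       \<le> ennreal (R powr s * enn2real I)" if R: "R \<ge> 1" for R
  proof -
    \<comment> \<open>The dilation \<open>tube_aut a\<close> takes b, at height 1/R, to the base
      point. Hence |rho(.,(0,i))| <= R pulls back to |rho(.,b)| <= 1, and R >= 1 keeps b inside a
      ball independent of R.\<close>
    define a :: "(complex, 'n) vec" where "a = (\<chi> j. if j = last_ix then of_real R * \<i> else 0)"
    define b :: "(complex, 'n) vec" where "b = (\<chi> j. if j = last_ix then of_real (1 / R) * \<i> else 0)"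
    have ra: "rho a = R" and rb: "rho b = 1 / R" by (simp_all add: rho_def a_def b_def)
    have a: "a \<in> tube_B" using ra R by (simp add: mem_tube_B_iff)
    have "tube_aut a b = base_pt"
    proof -
      have "tube_aut a b $ j = base_pt $ j" for j
      proof (cases "j = last_ix")
        case True
        have "(\<Sum>i\<in>UNIV - {last_ix}. complex_of_real (Im (a $ i)) * b $ i) = 0"
          by (intro sum.neutral) (auto simp: a_def)
        then show ?thesis using True ra R
          by (simp add: tube_aut_last) (simp add: a_def b_def base_pt_def algebra_simps)
      next
        case False
        then show ?thesis by (simp add: tube_aut_nth) (simp add: a_def b_def base_pt_def)
      qed
      then show ?thesis by (simp add: vec_eq_iff)
    qed
    then have scale: "rho2 (tube_aut a w) base_pt = of_real R * rho2 w b" for w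
      using rho2_tube_aut[of a w b] ra R by simp
    have nb: "norm b \<le> real CARD('n)"
    proof -
      have "norm b \<le> (\<Sum>j\<in>UNIV. norm (b $ j))" by (simp add: norm_vec_def L2_set_le_sum)
      also have "\<dots> \<le> (\<Sum>j\<in>(UNIV :: 'n set). 1)"
        using R by (intro sum_mono) (simp add: b_def norm_mult norm_divide)
      finally show ?thesis by simp
    qed
    have meas: "(\<lambda>z :: (complex, 'n) vec. indicator {z. norm (rho2 z base_pt) \<le> R} z :: ennreal)
        \<in> borel_measurable (restrict_space borel tube_B)"
      by (intro measurable_restrict_space1 borel_measurable_indicator borel_closed closed_Collect_le continuous_intros)
    have "(\<integral>\<^sup>+z. indicator {z. norm (rho2 z base_pt) \<le> R} z \<partial>(dV \<alpha> :: (complex, 'n) vec measure)) =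
      ennreal (R powr s) * (\<integral>\<^sup>+w. indicator {z. norm (rho2 z base_pt) \<le> R} (tube_aut a w) \<partial>dV \<alpha>)"
      using nn_integral_dV_tube_aut[OF a meas] by (simp add: ra s_def)
    also have "\<dots> \<le> ennreal (R powr s) * I"
      unfolding I_def
    proof (intro mult_left_mono nn_integral_mono)
      fix w :: "(complex, 'n) vec" assume "w \<in> space (dV \<alpha>)"
      then have w: "w \<in> tube_B" by (simp add: dV_def space_restrict_space)
      have "norm w \<le> B" if "norm (rho2 (tube_aut a w) base_pt) \<le> R"
        using B[OF nb, of w] w R that rb by (simp add: scale norm_mult norm_rho2_commute[of b] mem_tube_B_iff)
      then show "indicator {z. norm (rho2 z base_pt) \<le> R} (tube_aut a w) \<le> (indicator (cball 0 B) w :: ennreal)"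
        by (simp add: indicator_def)
    qed simp
    also have "\<dots> = ennreal (R powr s * enn2real I)"
      by (subst I) (simp add: ennreal_mult)
    finally show ?thesis .
  qed
  then show thesis using that[of "enn2real I"] by (simp add: s_def)
qed

text \<open>Dyadic shells: where 2^k / 2 <= |rho(z,(0,i))| <= 2^k the kernel is at most
  \<open>c k\<close> = (2^k / 2)^(-2s), and the mass is at most M 2^(ks). The products form a
  geometric series of ratio 2^(-s). Whole sublevel sets replace the shells, which only enlarges the
  sum.\<close>

lemma rho2_kernel_integral_finite:
  assumes \<alpha>: "\<alpha> > -1"
  shows "(\<integral>\<^sup>+z. ennreal (norm (rho2 z base_pt) powr (- (2 * (real CARD('n) + \<alpha> + 1))))
     \<partial>(dV \<alpha> :: (complex ^ 'n::{finite,linorder}) measure)) < \<infinity>"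
proof -
  define s where "s = real CARD('n) + \<alpha> + 1"
  have s: "s > 0" using \<alpha> by (simp add: s_def)
  obtain M :: real where M: "M \<ge> 0" "\<And>R. R \<ge> 1 \<Longrightarrow>
      (\<integral>\<^sup>+z. indicator {z. norm (rho2 z base_pt) \<le> R} z \<partial>(dV \<alpha> :: (complex, 'n) vec measure))
       \<le> ennreal (R powr s * M)"
    using dV_rho2_sublevel[OF \<alpha>] unfolding s_def by blast
  define c where "c k = (2 ^ k / 2 :: real) powr (- (2 * s))" for k :: nat
  let ?E = "\<lambda>k :: nat. {z :: (complex, 'n) vec. norm (rho2 z base_pt) \<le> 2 ^ k}"
  have bound: "ennreal (norm (rho2 z base_pt) powr (- (2 * s))) \<le> (\<Sum>k. ennreal (c k) * indicator (?E k) z)"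
    if z: "z \<in> tube_B" for z
  proof -
    define N where "N = norm (rho2 z base_pt)"
    \<comment> \<open>The base point has height 1, so the kernel is never larger than on the shell k
      = 0; no negative k is required.\<close>
    have N: "1 / 2 \<le> N" using rho_add_le_norm_rho2[of z base_pt] z by (simp add: N_def mem_tube_B_iff)
    obtain n where "N < 2 ^ n" using real_arch_pow[of 2 N] by auto
    then have ex: "N \<le> 2 ^ n" by simp
    define k where "k = (LEAST k. N \<le> 2 ^ k)"
    have k: "N \<le> 2 ^ k" unfolding k_def by (rule LeastI) (rule ex)
    have k': "2 ^ k / 2 \<le> N"
    proof (cases k)
      case 0
      then show ?thesis using N by simp
    next
      case (Suc l)
      then have "\<not> N \<le> 2 ^ l" using not_less_Least[of l "\<lambda>k. N \<le> 2 ^ k"] by (simp add: k_def)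
      then show ?thesis using Suc by simp
    qed
    have "N powr (- (2 * s)) \<le> c k"
      unfolding c_def using k' N s by (intro powr_mono2') auto
    then have "ennreal (N powr (- (2 * s))) \<le> ennreal (c k) * indicator (?E k) z"
      using k by (simp add: N_def ennreal_leI)
    also have "\<dots> = sum (\<lambda>k. ennreal (c k) * indicator (?E k) z) {k}"
      by (simp only: sum.insert finite.emptyI sum.empty add_0_right empty_iff not_False_eq_True)
    also have "\<dots> \<le> (\<Sum>k. ennreal (c k) * indicator (?E k) z)"
      by (rule sum_le_suminf) auto
    finally show ?thesis by (simp add: N_def)
  qed
  have meas: "(\<lambda>z. indicator (?E k) z :: ennreal) \<in> borel_measurable (dV \<alpha>)" for k
    unfolding measurable_dV
    by (intro measurable_restrict_space1 borel_measurable_indicator borel_closed closed_Collect_le continuous_intros)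
  have cM: "ennreal (c k) * ennreal ((2 ^ k) powr s * M) = ennreal (2 powr (2 * s) * M * (2 powr (- s)) ^ k)" for k
  proof -
    have "c k * (2 ^ k) powr s = 2 powr (2 * s) * (2 powr (- s)) ^ k"
    proof -
      have "c k * (2 ^ k) powr s = 2 powr (2 * s) * ((2 ^ k) powr (- (2 * s)) * (2 ^ k) powr s)"
        unfolding c_def by (subst powr_divide) (auto simp: powr_minus divide_inverse)
      also have "(2 ^ k) powr (- (2 * s)) * (2 ^ k) powr s = (2 ^ k :: real) powr (- s)"
        by (simp add: powr_add[symmetric])
      also have "(2 ^ k :: real) powr (- s) = (2 powr real k) powr (- s)" by (simp add: powr_realpow)
      also have "(2 powr real k) powr (- s) = (2 powr (- s)) powr real k"
        by (simp only: powr_powr mult.commute)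
      also have "\<dots> = (2 powr (- s)) ^ k" by (simp add: powr_realpow)
      finally show ?thesis .
    qed
    then have "c k * ((2 ^ k) powr s * M) = 2 powr (2 * s) * M * (2 powr (- s)) ^ k"
      by (metis mult.assoc mult.commute)
    moreover have "c k \<ge> 0" by (simp add: c_def)
    ultimately show ?thesis by (metis ennreal_mult')
  qed
  have "(\<integral>\<^sup>+z. ennreal (norm (rho2 z base_pt) powr (- (2 * s))) \<partial>(dV \<alpha> :: (complex, 'n) vec measure))
     \<le> (\<integral>\<^sup>+z. (\<Sum>k. ennreal (c k) * indicator (?E k) z) \<partial>dV \<alpha>)"
    by (intro nn_integral_mono bound) (simp add: dV_def space_restrict_space)
  also have "\<dots> = (\<Sum>k. \<integral>\<^sup>+z. ennreal (c k) * indicator (?E k) z \<partial>dV \<alpha>)"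
    by (intro nn_integral_suminf borel_measurable_times_ennreal meas measurable_const) auto
  also have "\<dots> = (\<Sum>k. ennreal (c k) * (\<integral>\<^sup>+z. indicator (?E k) z \<partial>dV \<alpha>))"
    by (intro suminf_cong nn_integral_cmult meas)
  also have "\<dots> \<le> (\<Sum>k. ennreal (c k) * ennreal ((2 ^ k) powr s * M))"
    by (intro suminf_le mult_left_mono M(2)) auto
  also have "\<dots> = (\<Sum>k. ennreal (2 powr (2 * s) * M * (2 powr (- s)) ^ k))"
    unfolding cM ..
  also have "\<dots> < \<infinity>"
  proof -
    have "2 powr (- s) < (1 :: real)" using s by (simp add: powr_less_one)
    then have "summable (\<lambda>k. 2 powr (2 * s) * M * (2 powr (- s)) ^ k)"
      by (intro summable_mult summable_geometric) auto
    then have "(\<Sum>k. ennreal (2 powr (2 * s) * M * (2 powr (- s)) ^ k)) = ennreal (\<Sum>k. 2 powr (2 * s) * M * (2 powr (- s)) ^ k)"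
      using M by (intro suminf_ennreal2) auto
    then show ?thesis by simp
  qed
  finally show ?thesis by (simp add: s_def)
qed

section \<open>Lattices and the boundary\<close>

lemma eventually_to_boundary:
  "eventually P to_boundary \<longleftrightarrow>
     (\<exists>\<epsilon>>0. \<exists>R. \<forall>a\<in>tube_B. rho a < \<epsilon> \<or> norm a > R \<longrightarrow> P a)" (is "?L \<longleftrightarrow> ?R")
proof
  assume ?L
  then have *: "eventually (\<lambda>a. a \<in> tube_B \<longrightarrow> P a) (filtercomap rho (nhds 0))"
    "eventually (\<lambda>a. a \<in> tube_B \<longrightarrow> P a) at_infinity"
    by (auto simp: to_boundary_def eventually_inf_principal eventually_sup)
  from *(1) obtain Q where Q: "eventually Q (nhds 0)" "\<And>a. Q (rho a) \<Longrightarrow> a \<in> tube_B \<Longrightarrow> P a"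
    by (auto simp: eventually_filtercomap)
  then obtain \<epsilon> where \<epsilon>: "\<epsilon> > 0" "\<And>x :: real. \<bar>x\<bar> < \<epsilon> \<Longrightarrow> Q x"
    by (auto simp: eventually_nhds_metric)
  from *(2) obtain R where R: "\<And>a. norm a \<ge> R \<Longrightarrow> a \<in> tube_B \<Longrightarrow> P a"
    by (auto simp: eventually_at_infinity)
  show ?R
    using \<epsilon> Q(2) R by (intro exI[of _ \<epsilon>] conjI exI[of _ R]) (auto simp: mem_tube_B_iff)
next
  assume ?R
  then obtain \<epsilon> R where \<epsilon>: "\<epsilon> > 0" "\<And>a. a \<in> tube_B \<Longrightarrow> rho a < \<epsilon> \<or> norm a > R \<Longrightarrow> P a" by blast
  have "eventually (\<lambda>a. a \<in> tube_B \<longrightarrow> P a) (filtercomap rho (nhds 0))"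
    unfolding eventually_filtercomap eventually_nhds_metric
    using \<epsilon> by (intro exI[of _ "\<lambda>x. x < \<epsilon>"] conjI exI[of _ \<epsilon>]) (auto simp: dist_real_def)
  moreover have "eventually (\<lambda>a. a \<in> tube_B \<longrightarrow> P a) at_infinity"
    unfolding eventually_at_infinity using \<epsilon> by (intro exI[of _ "R + 1"]) auto
  ultimately show ?L
    by (simp add: to_boundary_def eventually_inf_principal eventually_sup)
qed

lemma eventually_in_tube_B: "eventually (\<lambda>a. a \<in> tube_B) to_boundary"
  unfolding to_boundary_def eventually_inf_principal by simp

text \<open>Two regimes. If |rho(z,a)| > 2/\<epsilon>, then rho(a) <= 2 |rho(z,a)| <= \<epsilon>
  |rho(z,a)|^2. Otherwise a is confined to a ball, so being near the boundary means small height,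
  while |rho(z,a)| >= rho(z)/2 stays away from 0 on K.\<close>

lemma kernel_small_on_compact:
  fixes K :: "(complex ^ 'n::{finite,linorder}) set"
  assumes K: "compact K" "K \<subseteq> tube_B" and \<epsilon>: "\<epsilon> > 0"
  shows "eventually (\<lambda>a. \<forall>z\<in>K. rho a \<le> \<epsilon> * (norm (rho2 z a))\<^sup>2) to_boundary"
proof (cases "K = {}")
  case False
  obtain x where x: "x \<in> K" "\<And>z. z \<in> K \<Longrightarrow> rho x \<le> rho z"
    using continuous_attains_inf[OF K(1) False, of rho] continuous_on_rho[OF continuous_on_id] by blast
  have c: "rho x > 0" using x K by (auto simp: mem_tube_B_iff)
  obtain B where B: "\<And>z. z \<in> K \<Longrightarrow> norm z \<le> B"
    using compact_imp_bounded[OF K(1)] by (auto simp: bounded_iff)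
  obtain M where M: "\<And>z a :: (complex, 'n) vec.
      norm z \<le> B \<Longrightarrow> 0 \<le> rho z \<Longrightarrow> 0 \<le> rho a \<Longrightarrow> norm (rho2 z a) \<le> 2 / \<epsilon> \<Longrightarrow> norm a \<le> M"
    using norm_bound_of_rho2_bound[of B "2 / \<epsilon>"] by blast
  have "rho a \<le> \<epsilon> * (norm (rho2 z a))\<^sup>2"
    if a: "a \<in> tube_B" "rho a < \<epsilon> * (rho x / 2)\<^sup>2 \<or> norm a > M" and z: "z \<in> K" for a z
  proof (cases "norm (rho2 z a) \<le> 2 / \<epsilon>")
    case True
    have "z \<in> tube_B" using z K by auto
    then have "norm a \<le> M" using M[of z a] True B[OF z] a by (simp add: mem_tube_B_iff)
    then have "rho a < \<epsilon> * (rho x / 2)\<^sup>2" using a by simp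
    also have "rho x / 2 \<le> norm (rho2 z a)"
      using rho_add_le_norm_rho2[of z a] x(2)[OF z] a by (simp add: mem_tube_B_iff)
    then have "\<epsilon> * (rho x / 2)\<^sup>2 \<le> \<epsilon> * (norm (rho2 z a))\<^sup>2"
      using c \<epsilon> by (intro mult_left_mono power_mono) auto
    finally show ?thesis by simp
  next
    case False
    have "z \<in> tube_B" using z K by auto
    then have "rho a \<le> 2 * norm (rho2 z a)"
      using rho_add_le_norm_rho2[of z a] by (simp add: mem_tube_B_iff)
    also have "2 \<le> \<epsilon> * norm (rho2 z a)" using False \<epsilon> by (simp add: field_simps)
    then have "2 * norm (rho2 z a) \<le> \<epsilon> * norm (rho2 z a) * norm (rho2 z a)"
      by (intro mult_right_mono) auto
    finally show ?thesis by (simp add: power2_eq_square mult.assoc)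
  qed
  moreover have "\<epsilon> * (rho x / 2)\<^sup>2 > 0" using c \<epsilon> by simp
  ultimately show ?thesis unfolding eventually_to_boundary by blast
qed simp

text \<open>The points of the tube that are not yet near the boundary form a compact K, covered by
  finitely many balls D(x,r) with x in K. If a_k lies in D(x,r), then by symmetry x lies in
  D(a_k,2r), and finite overlap at x leaves finitely many such k.\<close>

lemma bergman_lattice_to_boundary:
  fixes a :: "nat \<Rightarrow> complex ^ 'n::{finite,linorder}"
  assumes a: "bergman_lattice r a" and r: "r > 0"
  shows "filterlim a to_boundary sequentially"
  unfolding filterlim_iff eventually_to_boundary
proof safe
  fix P :: "(complex, 'n) vec \<Rightarrow> bool" and \<epsilon> R :: real
  assume \<epsilon>: "\<epsilon> > 0" and P: "\<forall>a\<in>tube_B. rho a < \<epsilon> \<or> R < norm a \<longrightarrow> P a"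
  have at: "a k \<in> tube_B" for k using a by (auto simp: bergman_lattice_def)
  define K where "K = {z :: (complex, 'n) vec. \<epsilon> \<le> rho z} \<inter> cball 0 R"
  have K: "compact K"
    unfolding K_def by (intro closed_Int_compact compact_cball closed_Collect_le continuous_intros)
  have Kt: "K \<subseteq> tube_B" using \<epsilon> by (auto simp: K_def mem_tube_B_iff)
  obtain D where D: "D \<subseteq> K" "finite D" "K \<subseteq> (\<Union>x\<in>D. bergman_ball x r)"
    by (rule compactE_image[OF K, of K "\<lambda>x. bergman_ball x r"]) (use r Kt in \<open>blast intro: open_bergman_ball center_in_bergman_ball\<close>)+
  have "{k. a k \<in> K} \<subseteq> (\<Union>x\<in>D. {k. x \<in> bergman_ball (a k) (2 * r)})"
  proof
    fix k assume "k \<in> {k. a k \<in> K}"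
    then obtain x where x: "x \<in> D" "a k \<in> bergman_ball x r" using D by auto
    then have "x \<in> bergman_ball (a k) (2 * r)"
      using D Kt r bergman_dist_commute[of x "a k"] by (auto simp: bergman_ball_def)
    then show "k \<in> (\<Union>x\<in>D. {k. x \<in> bergman_ball (a k) (2 * r)})" using x by auto
  qed
  moreover have "finite (\<Union>x\<in>D. {k. x \<in> bergman_ball (a k) (2 * r)})"
    using D Kt a by (auto simp: bergman_lattice_def)
  ultimately have "finite {k. a k \<in> K}" by (rule finite_subset)
  moreover have "{k. \<not> P (a k)} \<subseteq> {k. a k \<in> K}"
    using P at by (force simp: K_def not_less)
  ultimately have "finite {k. \<not> P (a k)}" by (rule finite_subset[rotated])
  then show "eventually (\<lambda>k. P (a k)) sequentially"
    by (simp add: cofinite_eq_sequentially[symmetric] eventually_cofinite)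
qed

text \<open>
  Enumerate a maximal \<open>r/2\<close>-separated set. Moving \<open>z\<close> to the base point, the overlap number at \<open>z\<close> is at
  most the number of balls of radius \<open>r/4\<close> needed to cover the closed ball of radius \<open>2r\<close> there.
\<close>

lemma ex_bergman_lattice:
  assumes r: "r > 0"
  shows "\<exists>a :: nat \<Rightarrow> complex ^ 'n::{finite,linorder}. bergman_lattice r a"
proof -
  let ?S = "{A :: (complex, 'n) vec set. A \<subseteq> tube_B \<and>
     (\<forall>x\<in>A. \<forall>y\<in>A. x \<noteq> y \<longrightarrow> r / 2 \<le> bergman_dist x y)}"
  have "\<exists>A\<in>?S. \<forall>X\<in>?S. A \<subseteq> X \<longrightarrow> X = A"
  proof (rule subset_Zorn')
    fix C assume C: "subset.chain ?S C"
    then have sub: "C \<subseteq> ?S" and ch: "\<And>X Y. X \<in> C \<Longrightarrow> Y \<in> C \<Longrightarrow> X \<subseteq> Y \<or> Y \<subseteq> X"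
      by (auto simp: subset_chain_def)
    have "r / 2 \<le> bergman_dist x y" if xy: "x \<in> \<Union>C" "y \<in> \<Union>C" "x \<noteq> y" for x y
    proof -
      obtain X Y where XY: "X \<in> C" "Y \<in> C" "x \<in> X" "y \<in> Y" using xy by auto
      then obtain Z where "Z \<in> C" "x \<in> Z" "y \<in> Z" using ch[OF XY(1,2)] by auto
      then show ?thesis using sub xy(3) by auto
    qed
    moreover have "\<Union>C \<subseteq> tube_B" using sub by auto
    ultimately show "\<Union>C \<in> ?S" by simp
  qed
  then obtain A where A: "A \<in> ?S" and max: "\<forall>X\<in>?S. A \<subseteq> X \<longrightarrow> X = A"
    by (elim bexE)
  have At: "A \<subseteq> tube_B" and sep: "\<And>x y. x \<in> A \<Longrightarrow> y \<in> A \<Longrightarrow> x \<noteq> y \<Longrightarrow> r / 2 \<le> bergman_dist x y"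
    using A by auto
  \<comment> \<open>A point farther than r/2 from all of A could be added to A. The covering radius
    is thus even smaller than the r that a lattice demands.\<close>
  have near: "\<exists>x\<in>A. bergman_dist x z < r / 2" if z: "z \<in> tube_B" for z
  proof (rule ccontr)
    assume "\<not> ?thesis"
    then have far: "\<And>x. x \<in> A \<Longrightarrow> r / 2 \<le> bergman_dist x z" by force
    then have far': "\<And>x. x \<in> A \<Longrightarrow> r / 2 \<le> bergman_dist z x" by (subst bergman_dist_commute)
    have "insert z A \<in> ?S"
      using At sep far far' z by simp
    then have "insert z A = A" by (intro max[rule_format]) auto
    then have "z \<in> A" by auto
    then show False using far[of z] z r by simp
  qed
  \<comment> \<open>Otherwise x and y would be at distance less than r/2. This one fact gives
    disjointness, countability and the injectivity behind the overlap bound.\<close>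
  have same: "x = y" if "x \<in> A" "y \<in> A" "z \<in> tube_B" "bergman_dist x z < r / 4" "bergman_dist y z < r / 4" for x y z
  proof (rule ccontr)
    assume "x \<noteq> y"
    then show False
      using sep[of x y] bergman_triangle[of x z y] that At by (auto simp: bergman_dist_commute[of z y])
  qed
  \<comment> \<open>An injective enumeration by all of \<open>nat\<close> requires this. A finite A
    would make the tube a finite union of compact balls, hence closed as well as open, hence
    everything; but 0 is outside.\<close>
  have "infinite A"
  proof
    assume fin: "finite A"
    have "tube_B = (\<Union>x\<in>A. {w \<in> tube_B. bergman_dist x w \<le> r / 2})"
      using near by fastforce
    moreover have "compact (\<Union>x\<in>A. {w \<in> tube_B. bergman_dist x w \<le> r / 2})"
      using fin At r by (intro compact_UN compact_bergman_cball) auto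
    ultimately have "closed (tube_B :: (complex, 'n) vec set)"
      by (metis compact_imp_closed)
    then have "(tube_B :: (complex, 'n) vec set) = UNIV"
      using open_tube_B clopen base_pt_in_tube by (metis empty_iff)
    then have "(0 :: (complex, 'n) vec) \<in> tube_B" by simp
    then show False by (simp add: mem_tube_B_iff rho_def)
  qed
  have "countable A"
  proof -
    have "inj_on (\<lambda>x. bergman_ball x (r / 4)) A"
    proof (rule inj_onI)
      fix x y assume xy: "x \<in> A" "y \<in> A" "bergman_ball x (r / 4) = bergman_ball y (r / 4)"
      then have "x \<in> bergman_ball y (r / 4)" using At r by (metis center_in_bergman_ball divide_pos_pos subsetD zero_less_numeral)
      then show "x = y" using same[of x y x] xy At r by (auto simp: bergman_ball_def)
    qed
    moreover have "countable ((\<lambda>x. bergman_ball x (r / 4)) ` A)"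
    proof (rule countable_disjoint_open_subsets)
      show "open S" if "S \<in> (\<lambda>x. bergman_ball x (r / 4)) ` A" for S
        using that At r by (auto intro!: open_bergman_ball)
      show "disjoint ((\<lambda>x. bergman_ball x (r / 4)) ` A)"
      proof (rule disjointI)
        fix S T assume S: "S \<in> (\<lambda>x. bergman_ball x (r / 4)) ` A" "T \<in> (\<lambda>x. bergman_ball x (r / 4)) ` A" "S \<noteq> T"
        then obtain x y where xy: "x \<in> A" "y \<in> A" "S = bergman_ball x (r / 4)" "T = bergman_ball y (r / 4)" by auto
        show "S \<inter> T = {}"
        proof (rule ccontr)
          assume "S \<inter> T \<noteq> {}"
          then obtain z where "z \<in> S" "z \<in> T" by auto
          then have "x = y" using same[of x y z] xy by (auto simp: bergman_ball_def)
          then show False using S xy by simp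
        qed
      qed
    qed
    ultimately show ?thesis by (rule countable_image_inj_on[rotated])
  qed
  define a where "a = from_nat_into A"
  have bij: "bij_betw a UNIV A"
    unfolding a_def by (rule bij_betw_from_nat_into) fact+
  have aA: "a k \<in> A" for k using bij by (auto simp: bij_betw_def)
  have a_inj: "a j = a k \<Longrightarrow> j = k" for j k using bij by (auto simp: bij_betw_def inj_on_def)
  have at: "a k \<in> tube_B" for k using aA At by auto
  let ?K = "{w \<in> tube_B. bergman_dist (base_pt :: (complex, 'n) vec) w \<le> 2 * r}"
  have cK: "compact ?K" and r4: "r / 4 > 0" using r by (auto intro: compact_bergman_cball)
  obtain D where D: "D \<subseteq> ?K" "finite D" "?K \<subseteq> (\<Union>x\<in>D. bergman_ball x (r / 4))"
    by (rule compactE_image[OF cK, of ?K "\<lambda>x. bergman_ball x (r / 4)"])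
       (use r4 in \<open>blast intro: open_bergman_ball center_in_bergman_ball\<close>)+
  have overlap: "finite {k. z \<in> bergman_ball (a k) (2 * r)} \<and> card {k. z \<in> bergman_ball (a k) (2 * r)} \<le> card D"
    if z: "z \<in> tube_B" for z
  proof -
    let ?I = "{k. z \<in> bergman_ball (a k) (2 * r)}"
    have "\<forall>k\<in>?I. \<exists>x\<in>D. bergman_dist (a k) (tube_aut z x) < r / 4"
    proof
      fix k assume k: "k \<in> ?I"
      obtain w where w: "w \<in> tube_B" "a k = tube_aut z w" using ex_tube_aut[OF z at] .
      have "bergman_dist base_pt w = bergman_dist z (a k)"
        using bergman_dist_tube_aut[OF z, of base_pt w] w by simp
      then have "w \<in> ?K" using k w bergman_dist_commute[of z "a k"] by (auto simp: bergman_ball_def)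
      then obtain x where "x \<in> D" "w \<in> bergman_ball x (r / 4)" using D by blast
      then show "\<exists>x\<in>D. bergman_dist (a k) (tube_aut z x) < r / 4"
        using w bergman_dist_commute[of w x]
        by (intro bexI[of _ x]) (auto simp: bergman_ball_def bergman_dist_tube_aut[OF z])
    qed
    then obtain g where g: "\<And>k. k \<in> ?I \<Longrightarrow> g k \<in> D \<and> bergman_dist (a k) (tube_aut z (g k)) < r / 4"
      by metis
    have "inj_on g ?I"
    proof (rule inj_onI)
      fix j k assume jk: "j \<in> ?I" "k \<in> ?I" "g j = g k"
      have "tube_aut z (g j) \<in> tube_B" using g[OF jk(1)] D z by (auto simp: tube_aut_in_tube_iff)
      then have "a j = a k"
        using same[of "a j" "a k" "tube_aut z (g j)"] g[OF jk(1)] g[OF jk(2)] jk(3) aA by auto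
      then show "j = k" by (rule a_inj)
    qed
    moreover have "g ` ?I \<subseteq> D" using g by auto
    ultimately show ?thesis
      using inj_on_finite[of g ?I D] card_inj_on_le[of g ?I D] D(2) by simp
  qed
  have cover: "tube_B = (\<Union>k. bergman_ball (a k) r)"
  proof
    show "tube_B \<subseteq> (\<Union>k. bergman_ball (a k) r)"
    proof
      fix z :: "(complex, 'n) vec" assume z: "z \<in> tube_B"
      obtain x where x: "x \<in> A" "bergman_dist x z < r / 2" using near[OF z] by auto
      then obtain k where "x = a k" using bij by (auto simp: bij_betw_def)
      then have "z \<in> bergman_ball (a k) r" using x z r by (auto simp: bergman_ball_def)
      then show "z \<in> (\<Union>k. bergman_ball (a k) r)" by blast
    qed
  qed (auto simp: bergman_ball_def)
  have "disjoint_family (\<lambda>k. bergman_ball (a k) (r / 4))"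
    unfolding disjoint_family_on_def
  proof (intro ballI impI)
    fix j k :: nat assume "j \<noteq> k"
    then have "a j \<noteq> a k" using a_inj by auto
    then show "bergman_ball (a j) (r / 4) \<inter> bergman_ball (a k) (r / 4) = {}"
      using same[OF aA aA, of _ j k] by (auto simp: bergman_ball_def)
  qed
  then have "bergman_lattice r a"
    unfolding bergman_lattice_def using at cover overlap by blast
  then show ?thesis by (rule exI[where x = a])
qed

section \<open>Test functions and local estimates\<close>

lemma holomorphic_vec_on_compose_left:
  assumes f: "holomorphic_vec_on f S" and S: "open S"
    and g: "\<And>z. z \<in> S \<Longrightarrow> g field_differentiable (at (f z))"
  shows "holomorphic_vec_on (\<lambda>z. g (f z)) S"
  unfolding holomorphic_vec_on_def
proof
  fix z assume z: "z \<in> S"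
  then obtain f' where f': "(f has_derivative f') (at z)" "\<And>c v. f' (c *s v) = c * f' v"
    using f S by (metis holomorphic_vec_on_def at_within_open)
  obtain d where d: "(g has_field_derivative d) (at (f z))"
    using g[OF z] by (auto simp: field_differentiable_def)
  have "((\<lambda>z. g (f z)) has_derivative (\<lambda>v. d * f' v)) (at z)"
    using diff_chain_at[OF f'(1) d[unfolded has_field_derivative_def]] by (simp add: o_def)
  then show "\<exists>g'. ((\<lambda>z. g (f z)) has_derivative g') (at z within S) \<and> (\<forall>c v. g' (c *s v) = c * g' v)"
    using f'(2) by (intro exI[of _ "\<lambda>v. d * f' v"]) (auto intro: has_derivative_at_withinI)
qed

lemma holomorphic_vec_on_rho2: "holomorphic_vec_on (\<lambda>z. rho2 z a) S"
  unfolding holomorphic_vec_on_def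
proof
  fix z
  let ?D = "\<lambda>v. ((\<Sum>j\<in>UNIV - {last_ix}. 2 * (z $ j - cnj (a $ j)) * v $ j) - 2 * \<i> * v $ last_ix) / 4"
  have nth: "((\<lambda>z. z $ j) has_derivative (\<lambda>v. v $ j)) (at z within S)" for j
    by (rule bounded_linear_imp_has_derivative[OF bounded_linear_vec_nth])
  have "((\<lambda>z. (\<Sum>j\<in>UNIV - {last_ix}. (z $ j - cnj (a $ j))\<^sup>2) - 2 * \<i> * (z $ last_ix - cnj (a $ last_ix)))
     has_derivative (\<lambda>v. (\<Sum>j\<in>UNIV - {last_ix}. 2 * (z $ j - cnj (a $ j)) * v $ j) - 2 * \<i> * v $ last_ix)) (at z within S)"
    by (auto intro!: derivative_eq_intros nth simp: fun_eq_iff algebra_simps)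
  then have "((\<lambda>z. rho2 z a) has_derivative ?D) (at z within S)"
    unfolding rho2_def by (rule bounded_linear.has_derivative[OF bounded_linear_divide])
  moreover have "?D (c *s v) = c * ?D v" for c v
    by (simp add: algebra_simps sum_distrib_left diff_divide_distrib)
  ultimately show "\<exists>D. ((\<lambda>z. rho2 z a) has_derivative D) (at z within S) \<and> (\<forall>c v. D (c *s v) = c * D v)"
    by blast
qed

lemma holomorphic_vec_on_tube_aut:
  fixes a :: "complex ^ 'n::{finite,linorder}"
  assumes f: "holomorphic_vec_on f tube_B" and a: "a \<in> tube_B"
  shows "holomorphic_vec_on (\<lambda>w. f (tube_aut a w)) tube_B"
  unfolding holomorphic_vec_on_def
proof
  fix w :: "(complex, 'n) vec" assume w: "w \<in> tube_B"
  then have "tube_aut a w \<in> tube_B" using a by (simp add: tube_aut_in_tube_iff)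
  then obtain f' where f': "(f has_derivative f') (at (tube_aut a w))" "\<And>c v. f' (c *s v) = c * f' v"
    using f open_tube_B by (metis holomorphic_vec_on_def at_within_open)
  define T where "T = tube_lin (sqrt (rho a)) a"
  have T: "bounded_linear T" by (simp add: T_def linear_conv_bounded_linear[symmetric] linear_tube_lin)
  have "(tube_aut a has_derivative T) (at w)"
    unfolding tube_aut_def T_def[symmetric]
    by (auto intro!: derivative_eq_intros bounded_linear.has_derivative[OF T])
  from diff_chain_at[OF this f'(1)]
  have "((\<lambda>w. f (tube_aut a w)) has_derivative (\<lambda>v. f' (T v))) (at w)" by (simp add: o_def)
  moreover have "f' (T (c *s v)) = c * f' (T v)" for c v
    by (simp add: T_def tube_lin_cmult f'(2))
  ultimately show "\<exists>g'. ((\<lambda>w. f (tube_aut a w)) has_derivative g') (at w within tube_B) \<and>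
      (\<forall>c v. g' (c *s v) = c * g' v)"
    by (blast intro: has_derivative_at_withinI)
qed

section \<open>The Bergman norm and nonnegative integrals\<close>

lemma borel_measurable_holomorphic_powr:
  assumes f: "holomorphic_vec_on f tube_B"
  shows "(\<lambda>z. norm (f z) powr p) \<in> borel_measurable (restrict_space borel tube_B)"
proof -
  have [measurable]: "f \<in> borel_measurable (restrict_space borel tube_B)"
    by (rule borel_measurable_continuous_on_restrict[OF holomorphic_vec_on_continuous[OF f]])
  show ?thesis by measurable
qed

lemma nn_integral_le_of_bergman_norm:
  assumes f: "f \<in> bergman_space p \<alpha>" and M: "bergman_norm p \<alpha> f \<le> M" and p: "p > 0"
  shows "(\<integral>\<^sup>+z. ennreal (norm (f z) powr p) \<partial>dV \<alpha>) \<le> ennreal (M powr p)"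
proof -
  define I where "I = (\<integral>z. norm (f z) powr p \<partial>dV \<alpha>)"
  have "I \<ge> 0" by (simp add: I_def)
  have "I = (I powr (1 / p)) powr p" using \<open>I \<ge> 0\<close> p by (simp add: powr_powr)
  also have "\<dots> \<le> M powr p"
    using M p by (intro powr_mono2) (auto simp: bergman_norm_def I_def)
  finally have "ennreal I \<le> ennreal (M powr p)" by (rule ennreal_leI)
  moreover have "(\<integral>\<^sup>+z. ennreal (norm (f z) powr p) \<partial>dV \<alpha>) = ennreal I"
    unfolding I_def using f by (intro nn_integral_eq_integral) (auto simp: bergman_space_def)
  ultimately show ?thesis by simp
qed

text \<open>The Bochner integral in \<open>bergman_norm\<close> is 0 by default for a non-integrable
  function, so integrability is extracted from the nonnegative integral before the norm is
  estimated.\<close>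

lemma bergman_space_of_nn_integral:
  assumes f: "holomorphic_vec_on f tube_B" and p: "p > 0" and C: "C \<ge> 0"
    and le: "(\<integral>\<^sup>+z. ennreal (norm (f z) powr p) \<partial>dV \<alpha>) \<le> ennreal C"
  shows "f \<in> bergman_space p \<alpha>" and "bergman_norm p \<alpha> f \<le> C powr (1 / p)"
proof -
  have m: "(\<lambda>z. norm (f z) powr p) \<in> borel_measurable (dV \<alpha>)"
    unfolding measurable_dV by (rule borel_measurable_holomorphic_powr[OF f])
  have "(\<integral>\<^sup>+z. ennreal (norm (norm (f z) powr p)) \<partial>dV \<alpha>) < \<infinity>"
    using le ennreal_less_top[of C] le_less_trans by fastforce
  then have int: "integrable (dV \<alpha>) (\<lambda>z. norm (f z) powr p)"
    using m by (simp add: integrable_iff_bounded)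
  then show "f \<in> bergman_space p \<alpha>" using f by (simp add: bergman_space_def)
  have "ennreal (\<integral>z. norm (f z) powr p \<partial>dV \<alpha>) \<le> ennreal C"
    using le nn_integral_eq_integral[OF int] by simp
  then have "(\<integral>z. norm (f z) powr p \<partial>dV \<alpha>) \<le> C" using C by simp
  then show "bergman_norm p \<alpha> f \<le> C powr (1 / p)"
    unfolding bergman_norm_def using p by (intro powr_mono2) auto
qed

text \<open>The power -2s/p is taken with the principal logarithm, which is holomorphic here because
  rho(z,a) has positive real part on the tube. The exponents are chosen so that the p-th power of
  the modulus is the integrand of condition (2).\<close>

definition kernel_fun ::
    "real \<Rightarrow> real \<Rightarrow> complex ^ 'n::{finite,linorder} \<Rightarrow> complex ^ 'n::{finite,linorder} \<Rightarrow> complex" where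
  "kernel_fun p s a z = of_real (rho a powr (s / p)) * exp (- of_real (2 * s / p) * Ln (rho2 z a))"

lemma norm_kernel_fun_powr:
  assumes "a \<in> tube_B" "z \<in> tube_B" "p > 0"
  shows "norm (kernel_fun p s a z) powr p = rho a powr s / norm (rho2 z a) powr (2 * s)"
proof -
  have pos: "norm (rho2 z a) > 0" "rho2 z a \<noteq> 0" using norm_rho2_pos[OF assms(2,1)] by auto
  have "norm (kernel_fun p s a z) = rho a powr (s / p) * exp (- (2 * s / p) * ln (norm (rho2 z a)))"
    using pos by (simp add: kernel_fun_def norm_mult)
  also have "\<dots> = rho a powr (s / p) * norm (rho2 z a) powr (- (2 * s / p))"
    using pos by (simp add: powr_def)
  also have "\<dots> powr p = rho a powr s * norm (rho2 z a) powr (- (2 * s))"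
    using assms(3) by (simp add: powr_mult powr_powr)
  finally show ?thesis by (simp add: powr_minus divide_inverse)
qed

lemma holomorphic_kernel_fun:
  assumes a: "a \<in> tube_B"
  shows "holomorphic_vec_on (kernel_fun p s a) tube_B"
proof -
  have "(\<lambda>u. of_real (rho a powr (s / p)) * exp (- of_real (2 * s / p) * Ln u)) field_differentiable at (rho2 z a)"
    if z: "z \<in> tube_B" for z
  proof -
    have "rho2 z a \<notin> \<real>\<^sub>\<le>\<^sub>0" using Re_rho2_pos[OF z a] by (auto simp: complex_nonpos_Reals_iff)
    then have "(\<lambda>u. A * exp (B * Ln u)) field_differentiable at (rho2 z a)" for A B
      unfolding field_differentiable_def by (auto intro!: derivative_eq_intros exI)
    then show ?thesis .
  qed
  then show ?thesis
    unfolding kernel_fun_def[abs_def]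
    by (rule holomorphic_vec_on_compose_left[OF holomorphic_vec_on_rho2 open_tube_B])
qed

text \<open>Substituting z = tube_aut a w, the measure contributes rho(a)^s, the normalisation
  rho(a)^s and the kernel rho(a)^(-2s). These cancel, leaving the integral at the base
  point.\<close>

lemma kernel_fun_integral_bound:
  assumes \<alpha>: "\<alpha> > -1" and p: "p > 0"
  obtains C :: real where "C \<ge> 0"
    "\<And>a. a \<in> tube_B \<Longrightarrow>
      (\<integral>\<^sup>+z. ennreal (norm (kernel_fun p (real CARD('n) + \<alpha> + 1) a z) powr p)
        \<partial>(dV \<alpha> :: (complex ^ 'n::{finite,linorder}) measure)) \<le> ennreal C"
proof -
  define s where "s = real CARD('n) + \<alpha> + 1"
  define I where "I = (\<integral>\<^sup>+z. ennreal (norm (rho2 z base_pt) powr (- (2 * s)))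
     \<partial>(dV \<alpha> :: (complex, 'n) vec measure))"
  have "I < \<infinity>" unfolding I_def s_def by (rule rho2_kernel_integral_finite[OF \<alpha>])
  then have I: "I = ennreal (enn2real I)" by simp
  have "(\<integral>\<^sup>+z. ennreal (norm (kernel_fun p s a z) powr p) \<partial>(dV \<alpha> :: (complex, 'n) vec measure)) \<le> I"
    if a: "a \<in> tube_B" for a
  proof -
    have ra: "rho a > 0" using a by (simp add: mem_tube_B_iff)
    have "(\<lambda>z. ennreal (norm (kernel_fun p s a z) powr p)) \<in> borel_measurable (restrict_space borel tube_B)"
      by (intro measurable_compose[OF borel_measurable_holomorphic_powr measurable_ennreal] holomorphic_kernel_fun a)
    from nn_integral_dV_tube_aut[OF a this, of \<alpha>]
    have "(\<integral>\<^sup>+z. ennreal (norm (kernel_fun p s a z) powr p) \<partial>dV \<alpha>) =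
      ennreal (rho a powr s) * (\<integral>\<^sup>+w. ennreal (norm (kernel_fun p s a (tube_aut a w)) powr p) \<partial>dV \<alpha>)"
      by (simp add: s_def)
    also have "(\<integral>\<^sup>+w. ennreal (norm (kernel_fun p s a (tube_aut a w)) powr p) \<partial>dV \<alpha>) =
       (\<integral>\<^sup>+w. ennreal (rho a powr (- s)) * ennreal (norm (rho2 w base_pt) powr (- (2 * s)))
         \<partial>(dV \<alpha> :: (complex, 'n) vec measure))"
    proof (rule nn_integral_cong)
      fix w :: "(complex, 'n) vec" assume "w \<in> space (dV \<alpha>)"
      then have w: "tube_aut a w \<in> tube_B" using a by (simp add: space_dV tube_aut_in_tube_iff)
      have "rho2 (tube_aut a w) a = of_real (rho a) * rho2 w base_pt"
        using rho2_tube_aut[of a w base_pt] ra by simp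
      then have "norm (kernel_fun p s a (tube_aut a w)) powr p =
          rho a powr s * (rho a powr (- (2 * s)) * norm (rho2 w base_pt) powr (- (2 * s)))"
        using norm_kernel_fun_powr[OF a w p, of s] ra
        by (simp add: norm_mult powr_mult powr_minus divide_inverse)
      also have "\<dots> = rho a powr (- s) * norm (rho2 w base_pt) powr (- (2 * s))"
        by (simp add: mult.assoc[symmetric] powr_add[symmetric])
      finally show "ennreal (norm (kernel_fun p s a (tube_aut a w)) powr p) =
          ennreal (rho a powr (- s)) * ennreal (norm (rho2 w base_pt) powr (- (2 * s)))"
        by (simp add: ennreal_mult)
    qed
    also have "\<dots> = ennreal (rho a powr (- s)) * I"
      unfolding I_def
    proof (rule nn_integral_cmult)
      have "(\<lambda>z. norm (rho2 z (base_pt :: (complex, 'n) vec))) \<in> borel_measurable borel"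
        by (intro borel_measurable_continuous_onI continuous_intros)
      then have [measurable]: "(\<lambda>z. norm (rho2 z (base_pt :: (complex, 'n) vec)))
          \<in> borel_measurable (restrict_space borel tube_B)"
        by (rule measurable_restrict_space1)
      show "(\<lambda>z. ennreal (norm (rho2 z (base_pt :: (complex, 'n) vec)) powr (- (2 * s)))) \<in> borel_measurable (dV \<alpha>)"
        unfolding measurable_dV by measurable
    qed
    also have "ennreal (rho a powr s) * (ennreal (rho a powr (- s)) * I) = I"
      using ra by (simp add: mult.assoc[symmetric] ennreal_mult[symmetric] powr_add[symmetric])
    finally show ?thesis by simp
  qed
  then show thesis using that[of "enn2real I"] I by (simp add: s_def)
qed

text \<open>At the base point the closed ball of radius r is compact inside the open ball of radius
  2r, so one Euclidean radius d fits around all its points. On the closed ball of radius 2r the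
  weight has a positive minimum c, whatever the sign of \<alpha>. With V the volume of a Euclidean
  ball of radius d, the constant is 1/(V c); moving from the base point to a costs the factor
  rho(a)^s.\<close>

lemma bergman_local_estimate:
  assumes p: "p \<ge> 1" and r: "r > 0"
  obtains C :: real where "C \<ge> 0"
    "\<And>f a z. holomorphic_vec_on f (tube_B :: (complex ^ 'n::{finite,linorder}) set) \<Longrightarrow> a \<in> tube_B \<Longrightarrow> z \<in> bergman_ball a r \<Longrightarrow>
      ennreal (norm (f z) powr p * rho a powr (real CARD('n) + \<alpha> + 1)) \<le>
      ennreal C * (\<integral>\<^sup>+w. ennreal (norm (f w) powr p) * indicator (bergman_ball a (2 * r)) w \<partial>dV \<alpha>)"
proof -
  define s where "s = real CARD('n) + \<alpha> + 1"
  let ?e = "base_pt :: (complex, 'n) vec"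
  define K where "K = {w \<in> tube_B. bergman_dist ?e w \<le> r}"
  define U where "U = bergman_ball ?e (2 * r)"
  define K2 where "K2 = {w \<in> tube_B. bergman_dist ?e w \<le> 2 * r}"
  have K: "compact K" "compact K2" unfolding K_def K2_def using r by (auto intro: compact_bergman_cball)
  have U: "open U" unfolding U_def using r by (intro open_bergman_ball) auto
  have KU: "K \<subseteq> U" "U \<subseteq> K2" "K2 \<subseteq> tube_B" using r by (auto simp: K_def U_def K2_def bergman_ball_def)
  obtain d where d: "d > 0" "(\<Union>w\<in>K. ball w d) \<subseteq> U"
    using compact_subset_open_imp_ball_epsilon_subset[OF K(1) U KU(1)] .
  have "continuous_on K2 (\<lambda>w. rho w powr \<alpha>)"
    using KU(3) by (intro continuous_on_powr continuous_intros) (auto simp: mem_tube_B_iff)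
  moreover have "K2 \<noteq> {}" using r by (auto simp: K2_def intro!: exI[of _ ?e])
  ultimately obtain x where x: "x \<in> K2" "\<And>w. w \<in> K2 \<Longrightarrow> rho x powr \<alpha> \<le> rho w powr \<alpha>"
    using continuous_attains_inf[OF K(2)] by blast
  define c where "c = rho x powr \<alpha>"
  have c: "c > 0" using x KU(3) by (auto simp: c_def mem_tube_B_iff)
  define V where "V = measure lborel (ball (0 :: (complex, 'n) vec) d)"
  have V: "V > 0" "emeasure lborel (ball (0 :: (complex, 'n) vec) d) = ennreal V"
    using d content_ball_pos[of d "0 :: (complex, 'n) vec"]
      emeasure_lborel_ball_finite[of "0 :: (complex, 'n) vec" d]
    by (auto simp: V_def emeasure_eq_ennreal_measure less_top)
  have Um: "U \<in> sets borel" using U by (rule borel_open)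
  have base: "ennreal (norm (g w) powr p) * ennreal (V * c) \<le>
       (\<integral>\<^sup>+w. ennreal (norm (g w) powr p) * indicator U w \<partial>dV \<alpha>)"
    if g: "holomorphic_vec_on g tube_B" and w: "w \<in> K" for g w
  proof -
    have subU: "ball w d \<subseteq> U" using d(2) w by blast
    have sub: "ball w d \<subseteq> tube_B" using subU KU by (meson subset_trans)
    have gm: "(\<lambda>w. ennreal (norm (g w) powr p)) \<in> borel_measurable (restrict_space borel tube_B)"
      by (intro measurable_compose[OF borel_measurable_holomorphic_powr[OF g] measurable_ennreal])
    have "ennreal (norm (g w) powr p) * ennreal V \<le>
        (\<integral>\<^sup>+v. ennreal (norm (g v) powr p) * indicator (ball w d) v \<partial>lborel)"
      using holomorphic_vec_sub_mean_value[OF g open_tube_B sub p] unfolding V .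
    then have "ennreal c * (ennreal (norm (g w) powr p) * ennreal V) \<le>
        ennreal c * (\<integral>\<^sup>+v. ennreal (norm (g v) powr p) * indicator (ball w d) v \<partial>lborel)"
      by (intro mult_left_mono) auto
    also have "\<dots> = (\<integral>\<^sup>+v. ennreal c * (ennreal (norm (g v) powr p) * indicator (ball w d) v) \<partial>lborel)"
    proof (rule nn_integral_cmult[symmetric])
      have "(\<lambda>v. ennreal (norm (g v) powr p) * indicator (ball w d) v) =
         (\<lambda>v. ennreal (norm (g v) powr p) * indicator tube_B v * indicator (ball w d) v)"
        using sub by (auto simp: fun_eq_iff indicator_def)
      moreover have "(\<lambda>v. ennreal (norm (g v) powr p) * indicator tube_B v) \<in> borel_measurable borel"
        by (rule borel_measurable_restrict_space_iff_ennreal[THEN iffD1, OF _ gm]) (simp add: borel_tube_B)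
      ultimately show "(\<lambda>v. ennreal (norm (g v) powr p) * indicator (ball w d) v) \<in> borel_measurable lborel"
        by (auto intro!: borel_measurable_times_ennreal borel_measurable_indicator borel_open)
    qed
    also have "\<dots> \<le> (\<integral>\<^sup>+v. ennreal (rho v powr \<alpha>) * (ennreal (norm (g v) powr p) * indicator U v) * indicator tube_B v \<partial>lborel)"
    proof (rule nn_integral_mono)
      fix v
      show "ennreal c * (ennreal (norm (g v) powr p) * indicator (ball w d) v) \<le>
         ennreal (rho v powr \<alpha>) * (ennreal (norm (g v) powr p) * indicator U v) * indicator tube_B v"
      proof (cases "v \<in> ball w d")
        case True
        then have vU: "v \<in> U" by (rule subsetD[OF subU])
        then have vK: "v \<in> K2" by (rule subsetD[OF KU(2)])
        then have vt: "v \<in> tube_B" by (rule subsetD[OF KU(3)])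
        have "ennreal c \<le> ennreal (rho v powr \<alpha>)" unfolding c_def by (intro ennreal_leI x(2) vK)
        then have "ennreal c * ennreal (norm (g v) powr p) \<le> ennreal (rho v powr \<alpha>) * ennreal (norm (g v) powr p)"
          by (rule mult_right_mono) simp
        then show ?thesis using True vU vt by simp
      qed simp
    qed
    also have "\<dots> = (\<integral>\<^sup>+v. ennreal (norm (g v) powr p) * indicator U v \<partial>dV \<alpha>)"
      by (rule nn_integral_dV[symmetric])
         (intro borel_measurable_times_ennreal gm measurable_restrict_space1 borel_measurable_indicator Um)
    finally show ?thesis
      using V c by (simp add: ennreal_mult mult_ac)
  qed
  show thesis
  proof (rule that[of "1 / (V * c)"])
    show "0 \<le> 1 / (V * c)" using V c by simp
    fix f and a z :: "(complex, 'n) vec"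
    assume f: "holomorphic_vec_on f (tube_B :: (complex, 'n) vec set)" and a: "a \<in> tube_B" and z: "z \<in> bergman_ball a r"
    have ra: "rho a > 0" using a by (simp add: mem_tube_B_iff)
    obtain w where w: "w \<in> tube_B" "z = tube_aut a w"
      using ex_tube_aut[OF a, of z] z by (auto simp: bergman_ball_def)
    have wK: "w \<in> K"
      using z tube_aut_in_bergman_ball_iff[OF a, of w base_pt r] w by (auto simp: K_def bergman_ball_def)
    define I where "I = (\<integral>\<^sup>+v. ennreal (norm (f v) powr p) * indicator (bergman_ball a (2 * r)) v \<partial>dV \<alpha>)"
    have fm: "(\<lambda>w. ennreal (norm (f w) powr p)) \<in> borel_measurable (restrict_space borel tube_B)"
      by (intro measurable_compose[OF borel_measurable_holomorphic_powr[OF f] measurable_ennreal])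
    have bm: "bergman_ball a (2 * r) \<in> sets borel" using a r by (intro borel_open open_bergman_ball) auto
    have "I = ennreal (rho a powr s) *
      (\<integral>\<^sup>+v. ennreal (norm (f (tube_aut a v)) powr p) * indicator (bergman_ball a (2 * r)) (tube_aut a v) \<partial>dV \<alpha>)"
      unfolding I_def s_def
      by (rule nn_integral_dV_tube_aut[OF a])
         (intro borel_measurable_times_ennreal fm measurable_restrict_space1 borel_measurable_indicator bm)
    also have "(\<lambda>v. indicator (bergman_ball a (2 * r)) (tube_aut a v) :: ennreal) = indicator U"
      using tube_aut_in_bergman_ball_iff[OF a, of _ base_pt "2 * r"] by (auto simp: U_def indicator_def fun_eq_iff)
    finally have I: "I = ennreal (rho a powr s) *
      (\<integral>\<^sup>+v. ennreal (norm (f (tube_aut a v)) powr p) * indicator U v \<partial>dV \<alpha>)"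
      by (simp add: fun_eq_iff)
    have "ennreal (norm (f z) powr p) * ennreal (V * c) \<le>
        (\<integral>\<^sup>+v. ennreal (norm (f (tube_aut a v)) powr p) * indicator U v \<partial>dV \<alpha>)"
      using base[OF holomorphic_vec_on_tube_aut[OF f a] wK] w by simp
    then have "ennreal (rho a powr s) * (ennreal (norm (f z) powr p) * ennreal (V * c)) \<le> I"
      unfolding I by (intro mult_left_mono) auto
    then have "ennreal (1 / (V * c)) * (ennreal (rho a powr s) * (ennreal (norm (f z) powr p) * ennreal (V * c))) \<le>
       ennreal (1 / (V * c)) * I"
      by (intro mult_left_mono) auto
    also have "ennreal (1 / (V * c)) * (ennreal (rho a powr s) * (ennreal (norm (f z) powr p) * ennreal (V * c))) =
      ennreal (norm (f z) powr p * rho a powr s)"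
      using V c by (simp add: ennreal_mult[symmetric])
    finally show "ennreal (norm (f z) powr p * rho a powr (real CARD('n) + \<alpha> + 1)) \<le>
      ennreal (1 / (V * c)) * (\<integral>\<^sup>+w. ennreal (norm (f w) powr p) * indicator (bergman_ball a (2 * r)) w \<partial>dV \<alpha>)"
      by (simp add: I_def s_def)
  qed
qed

section \<open>The equivalences\<close>

lemma kernel_fun_uniform_limit:
  fixes a :: "nat \<Rightarrow> complex ^ 'n::{finite,linorder}"
  assumes a: "filterlim a to_boundary sequentially" "\<And>k. a k \<in> tube_B"
    and K: "compact K" "K \<subseteq> tube_B" and p: "p > 0" and s: "s > 0"
  shows "uniform_limit K (\<lambda>k. kernel_fun p s (a k)) (\<lambda>_. 0) sequentially"
  unfolding uniform_limit_iff
proof (intro allI impI)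
  fix e :: real assume e: "e > 0"
  \<comment> \<open>Since |kernel|^p = (rho(a) / |rho(z,a)|^2)^s, the choice is made so that
    \<epsilon>^s = (e/2)^p; the half makes the final inequality strict.\<close>
  define \<epsilon> where "\<epsilon> = (e / 2) powr (p / s)"
  have \<epsilon>: "\<epsilon> > 0" using e by (simp add: \<epsilon>_def)
  have "eventually (\<lambda>k. \<forall>z\<in>K. rho (a k) \<le> \<epsilon> * (norm (rho2 z (a k)))\<^sup>2) sequentially"
    by (rule eventually_compose_filterlim[OF kernel_small_on_compact[OF K \<epsilon>] a(1)])
  then show "eventually (\<lambda>k. \<forall>z\<in>K. dist (kernel_fun p s (a k) z) 0 < e) sequentially"
  proof eventually_elim
    case (elim k)
    show ?case
    proof
      fix z assume z: "z \<in> K"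
      then have zt: "z \<in> tube_B" using K by auto
      define N where "N = norm (rho2 z (a k))"
      have N: "N > 0" using norm_rho2_pos[OF zt a(2)] by (simp add: N_def)
      have ra: "rho (a k) > 0" using a(2) by (simp add: mem_tube_B_iff)
      have "rho (a k) powr s \<le> (\<epsilon> * N\<^sup>2) powr s"
        using elim z ra s by (intro powr_mono2) (auto simp: N_def)
      also have "\<dots> = \<epsilon> powr s * N powr (2 * s)"
      proof -
        have "N\<^sup>2 = N powr 2" using N by (simp add: powr_numeral)
        then have "N\<^sup>2 powr s = N powr (2 * s)" by (metis powr_powr)
        then show ?thesis using \<epsilon> N by (simp add: powr_mult)
      qed
      finally have "rho (a k) powr s / N powr (2 * s) \<le> \<epsilon> powr s"
        using N by (simp add: divide_le_eq)
      then have "norm (kernel_fun p s (a k) z) powr p \<le> (e / 2) powr p"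
        using norm_kernel_fun_powr[OF a(2)[of k] zt p, of s] e s by (simp add: N_def \<epsilon>_def powr_powr)
      then have "(norm (kernel_fun p s (a k) z) powr p) powr (1 / p) \<le> ((e / 2) powr p) powr (1 / p)"
        by (rule powr_mono2[rotated 2]) (use p in auto)
      moreover have "(x powr p) powr (1 / p) = x" if "x \<ge> 0" for x :: real
        using that p by (simp add: powr_powr)
      ultimately have "norm (kernel_fun p s (a k) z) \<le> e / 2"
        using e by (metis norm_ge_zero less_eq_real_def half_gt_zero)
      then show "dist (kernel_fun p s (a k) z) 0 < e" using e by simp
    qed
  qed
qed

text \<open>The hypothesis speaks of sequences and the conclusion of a filter. If the limit fails,
  some level y is missed by points a_k with height below 1/(k+1) or norm above k; these tend to the
  boundary, and the kernels at a_k contradict the hypothesis.\<close>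

lemma vanishing_carleson_imp_berezin:
  fixes \<mu> :: "(complex ^ 'n::{finite,linorder}) measure" and \<alpha> :: real
  assumes \<alpha>: "\<alpha> > -1" and p: "p > 0" and space: "space \<mu> = tube_B"
    and carleson: "vanishing_carleson p \<alpha> \<mu>"
  defines "s \<equiv> real CARD('n) + \<alpha> + 1"
  shows "((\<lambda>a. \<integral>\<^sup>+z. ennreal (rho a powr s / norm (rho2 z a) powr (2 * s)) \<partial>\<mu>) \<longlongrightarrow> 0) to_boundary"
proof (rule order_tendstoI)
  fix y :: ennreal assume y: "0 < y"
  define F where "F a = (\<integral>\<^sup>+z. ennreal (rho a powr s / norm (rho2 z a) powr (2 * s)) \<partial>\<mu>)" for a
  have s: "s > 0" using \<alpha> by (simp add: s_def)
  show "eventually (\<lambda>a. (\<integral>\<^sup>+z. ennreal (rho a powr s / norm (rho2 z a) powr (2 * s)) \<partial>\<mu>) < y) to_boundary"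
  proof (rule ccontr)
    assume "\<not> ?thesis"
    then have "\<exists>a\<in>tube_B. (rho a < \<epsilon> \<or> norm a > R) \<and> \<not> F a < y" if "\<epsilon> > 0" for \<epsilon> R :: real
      using that by (auto simp: eventually_to_boundary F_def)
    then have "\<forall>k. \<exists>a\<in>tube_B. (rho a < 1 / real (Suc k) \<or> norm a > real k) \<and> \<not> F a < y"
      by simp
    then obtain a where a: "\<And>k. a k \<in> tube_B" "\<And>k. rho (a k) < 1 / real (Suc k) \<or> norm (a k) > real k"
      "\<And>k. \<not> F (a k) < y" by metis
    have lim: "filterlim a to_boundary sequentially"
      unfolding filterlim_iff eventually_to_boundary
    proof safe
      fix P :: "(complex, 'n) vec \<Rightarrow> bool" and \<epsilon> R :: real
      assume \<epsilon>: "\<epsilon> > 0" and P: "\<forall>a\<in>tube_B. rho a < \<epsilon> \<or> R < norm a \<longrightarrow> P a"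
      obtain k0 where k0: "1 / real (Suc k0) < \<epsilon>" using nat_approx_posE[OF \<epsilon>] .
      show "eventually (\<lambda>k. P (a k)) sequentially"
      proof (rule eventually_sequentiallyI)
        fix k assume k: "max k0 (nat \<lceil>R\<rceil>) \<le> k"
        have "1 / real (Suc k) \<le> 1 / real (Suc k0)" using k by (intro divide_left_mono) auto
        moreover have "R \<le> real k" using k by linarith
        ultimately show "P (a k)" using a(1)[of k] a(2)[of k] k0 P by force
      qed
    qed
    obtain C :: real where C: "C \<ge> 0"
      "\<And>a. a \<in> tube_B \<Longrightarrow> (\<integral>\<^sup>+z. ennreal (norm (kernel_fun p s a z) powr p)
        \<partial>(dV \<alpha> :: (complex, 'n) vec measure)) \<le> ennreal C"
      using kernel_fun_integral_bound[OF \<alpha> p] unfolding s_def by blast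
    have mem: "kernel_fun p s (a k) \<in> bergman_space p \<alpha>" "bergman_norm p \<alpha> (kernel_fun p s (a k)) \<le> C powr (1 / p)" for k
      using bergman_space_of_nn_integral[OF holomorphic_kernel_fun[OF a(1)] p C(1) C(2)[OF a(1)]] by auto
    have "(\<lambda>k. \<integral>\<^sup>+z. ennreal (norm (kernel_fun p s (a k) z) powr p) \<partial>\<mu>) \<longlonglongrightarrow> 0"
    proof (rule carleson[unfolded vanishing_carleson_def, THEN spec, THEN mp], intro conjI allI impI)
      show "\<exists>M. \<forall>k. bergman_norm p \<alpha> (kernel_fun p s (a k)) \<le> M" using mem(2) by (intro exI allI)
    qed (use mem(1) kernel_fun_uniform_limit[OF lim a(1) _ _ p s] in auto)
    also have "(\<lambda>k. \<integral>\<^sup>+z. ennreal (norm (kernel_fun p s (a k) z) powr p) \<partial>\<mu>) = (\<lambda>k. F (a k))"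
      unfolding F_def
      by (intro ext nn_integral_cong) (simp add: space norm_kernel_fun_powr[OF a(1) _ p])
    finally have "eventually (\<lambda>k. F (a k) < y) sequentially"
      using y by (rule order_tendstoD)
    then show False using a(3) by (auto simp: eventually_sequentially)
  qed
qed simp

section \<open>(2) implies (3)\<close>

lemma bergman_ball_measurable:
  assumes "sets \<mu> = sets (restrict_space borel tube_B)" "a \<in> tube_B" "r > 0"
  shows "bergman_ball a r \<in> sets \<mu>"
proof -
  have "bergman_ball a r \<in> sets borel" using assms by (intro borel_open open_bergman_ball)
  moreover have "bergman_ball a r \<subseteq> tube_B" by (auto simp: bergman_ball_def)
  ultimately show ?thesis
    unfolding assms(1) by (subst sets_restrict_space_iff) (auto simp: borel_tube_B)
qed

lemma berezin_imp_averaging: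
  fixes \<mu> :: "(complex ^ 'n::{finite,linorder}) measure"
  assumes sets: "sets \<mu> = sets (restrict_space borel tube_B)" and r: "r > 0" and s: "s > 0"
    and lim: "((\<lambda>a. \<integral>\<^sup>+z. ennreal (rho a powr s / norm (rho2 z a) powr (2 * s)) \<partial>\<mu>) \<longlongrightarrow> 0) to_boundary"
  shows "((\<lambda>a. emeasure \<mu> (bergman_ball a r) / ennreal (rho a powr s)) \<longlongrightarrow> 0) to_boundary"
proof -
  define F where "F a = (\<integral>\<^sup>+z. ennreal (rho a powr s / norm (rho2 z a) powr (2 * s)) \<partial>\<mu>)" for a
  \<comment> \<open>The bound |rho(z,a)| <= 2 cosh^2 r rho(a) raised to the power 2s: on the ball it
    gives rho(a)^(-s) <= c rho(a)^s / |rho(z,a)|^(2s).\<close>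
  define c where "c = (2 * (cosh r)\<^sup>2) powr (2 * s)"
  have le: "emeasure \<mu> (bergman_ball a r) / ennreal (rho a powr s) \<le> ennreal c * F a" if a: "a \<in> tube_B" for a
  proof -
    have ra: "rho a > 0" using a by (simp add: mem_tube_B_iff)
    have [measurable]: "bergman_ball a r \<in> sets \<mu>" by (rule bergman_ball_measurable[OF sets a r])
    have m: "(\<lambda>z. ennreal (rho a powr s / norm (rho2 z a) powr (2 * s))) \<in> borel_measurable \<mu>"
    proof -
      have "(\<lambda>z. norm (rho2 z a)) \<in> borel_measurable borel"
        by (intro borel_measurable_continuous_onI continuous_intros)
      then have [measurable]: "(\<lambda>z. norm (rho2 z a)) \<in> borel_measurable (restrict_space borel tube_B)"
        by (rule measurable_restrict_space1)
      show ?thesis unfolding measurable_cong_sets[OF sets refl] by measurable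
    qed
    have "emeasure \<mu> (bergman_ball a r) / ennreal (rho a powr s) =
        (\<integral>\<^sup>+z. ennreal (1 / rho a powr s) * indicator (bergman_ball a r) z \<partial>\<mu>)"
      using ra by (subst nn_integral_cmult_indicator)
        (auto simp: divide_ennreal_def inverse_ennreal mult.commute divide_inverse bergman_ball_measurable[OF sets a r])
    also have "\<dots> \<le> (\<integral>\<^sup>+z. ennreal c * ennreal (rho a powr s / norm (rho2 z a) powr (2 * s)) \<partial>\<mu>)"
    proof (rule nn_integral_mono)
      fix z
      show "ennreal (1 / rho a powr s) * indicator (bergman_ball a r) z \<le>
          ennreal c * ennreal (rho a powr s / norm (rho2 z a) powr (2 * s))"
      proof (cases "z \<in> bergman_ball a r")
        case True
        then have zt: "z \<in> tube_B" by (simp add: bergman_ball_def)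
        have N: "norm (rho2 z a) > 0" by (rule norm_rho2_pos[OF zt a])
        have "norm (rho2 z a) powr (2 * s) \<le> (2 * (cosh r)\<^sup>2 * rho a) powr (2 * s)"
          using norm_rho2_le_of_bergman_ball[OF a r True] s by (intro powr_mono2) auto
        also have "\<dots> = c * (rho a powr s * rho a powr s)"
          using ra by (simp add: c_def powr_mult powr_add[symmetric])
        finally have "1 / rho a powr s \<le> c * (rho a powr s / norm (rho2 z a) powr (2 * s))"
          using ra N by (simp add: field_simps)
        then show ?thesis using True by (simp add: ennreal_mult'[symmetric] c_def ennreal_leI)
      qed simp
    qed
    also have "\<dots> = ennreal c * F a"
      unfolding F_def by (rule nn_integral_cmult[OF m])
    finally show ?thesis .
  qed
  have "((\<lambda>a. ennreal c * F a) \<longlongrightarrow> ennreal c * 0) to_boundary"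
    using lim by (intro ennreal_tendsto_cmult) (auto simp: F_def)
  then have "((\<lambda>a. ennreal c * F a) \<longlongrightarrow> 0) to_boundary" by simp
  moreover have "eventually (\<lambda>a. emeasure \<mu> (bergman_ball a r) / ennreal (rho a powr s) \<le> ennreal c * F a) to_boundary"
    using eventually_in_tube_B by eventually_elim (rule le)
  ultimately show ?thesis
    using tendsto_sandwich[of "\<lambda>_. 0" "\<lambda>a. emeasure \<mu> (bergman_ball a r) / ennreal (rho a powr s)"
        to_boundary "\<lambda>a. ennreal c * F a" 0] by simp
qed

section \<open>(4) implies (1)\<close>

lemma bergman_lattice_sum_estimate:
  fixes \<mu> :: "(complex ^ 'n::{finite,linorder}) measure" and \<alpha> :: real
  assumes sets: "sets \<mu> = sets (restrict_space borel tube_B)" and r: "r > 0" and p: "p \<ge> 1"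
    and a: "bergman_lattice r a"
  defines "s \<equiv> real CARD('n) + \<alpha> + 1"
  obtains C :: real where "C \<ge> 0"
    "\<And>f J (\<epsilon> :: real). holomorphic_vec_on f tube_B \<Longrightarrow> \<epsilon> \<ge> 0 \<Longrightarrow>
      (\<And>k. k \<ge> J \<Longrightarrow> emeasure \<mu> (bergman_ball (a k) r) / ennreal (rho (a k) powr s) \<le> ennreal \<epsilon>) \<Longrightarrow>
      (\<integral>\<^sup>+z. ennreal (norm (f z) powr p) \<partial>\<mu>) \<le>
      (\<integral>\<^sup>+z. ennreal (norm (f z) powr p) * indicator (\<Union>k<J. bergman_ball (a k) r) z \<partial>\<mu>) +
      ennreal (C * \<epsilon>) * (\<integral>\<^sup>+z. ennreal (norm (f z) powr p) \<partial>dV \<alpha>)"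
proof -
  have at: "a k \<in> tube_B" for k using a by (auto simp: bergman_lattice_def)
  obtain N where N: "\<And>z. z \<in> tube_B \<Longrightarrow> finite {k. z \<in> bergman_ball (a k) (2 * r)} \<and>
      card {k. z \<in> bergman_ball (a k) (2 * r)} \<le> N"
    using a by (auto simp: bergman_lattice_def)
  obtain C :: real where C: "C \<ge> 0"
    "\<And>f a z. holomorphic_vec_on f (tube_B :: (complex, 'n) vec set) \<Longrightarrow> a \<in> tube_B \<Longrightarrow> z \<in> bergman_ball a r \<Longrightarrow>
      ennreal (norm (f z) powr p * rho a powr s) \<le>
      ennreal C * (\<integral>\<^sup>+w. ennreal (norm (f w) powr p) * indicator (bergman_ball a (2 * r)) w \<partial>dV \<alpha>)"
    using bergman_local_estimate[OF p r] unfolding s_def by blast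
  have "(\<integral>\<^sup>+z. ennreal (norm (f z) powr p) \<partial>\<mu>) \<le>
      (\<integral>\<^sup>+z. ennreal (norm (f z) powr p) * indicator (\<Union>k<J. bergman_ball (a k) r) z \<partial>\<mu>) +
      ennreal (C * real N * \<epsilon>) * (\<integral>\<^sup>+z. ennreal (norm (f z) powr p) \<partial>dV \<alpha>)"
    if f: "holomorphic_vec_on f tube_B" and \<epsilon>: "\<epsilon> \<ge> 0"
      and small: "\<And>k. k \<ge> J \<Longrightarrow> emeasure \<mu> (bergman_ball (a k) r) / ennreal (rho (a k) powr s) \<le> ennreal \<epsilon>"
    for f J and \<epsilon> :: real
  proof -
    define h where "h z = ennreal (norm (f z) powr p)" for z
    have h0: "h \<in> borel_measurable (restrict_space borel tube_B)"
      unfolding h_def by (intro measurable_compose[OF borel_measurable_holomorphic_powr[OF f] measurable_ennreal])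
    have h [measurable]: "h \<in> borel_measurable \<mu>"
      using h0 unfolding measurable_cong_sets[OF sets refl] .
    have hV [measurable]: "h \<in> borel_measurable (dV \<alpha>)"
      using h0 unfolding measurable_dV .
    have space: "space \<mu> = tube_B" using sets_eq_imp_space_eq[OF sets] by (simp add: space_restrict_space)
    define D where "D k = bergman_ball (a k) r" for k
    define E where "E k = bergman_ball (a k) (2 * r)" for k
    have D [measurable]: "D k \<in> sets \<mu>" for k unfolding D_def by (rule bergman_ball_measurable[OF sets at r])
    have E [measurable]: "E k \<in> sets (dV \<alpha>)" for k
      unfolding E_def using r by (intro bergman_ball_measurable[OF sets_dV at]) auto
    define I where "I k = (\<integral>\<^sup>+w. h w * indicator (E k) w \<partial>dV \<alpha>)" for k
    define L where "L = (\<Union>k<J. D k)"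
    have L [measurable]: "L \<in> sets \<mu>" unfolding L_def by measurable
    \<comment> \<open>The factor rho(a_k)^(-s) of the local estimate meets \<mu>(D(a_k,r)) <=
      \<epsilon> rho(a_k)^s, so only \<epsilon> survives.\<close>
    have piece: "(\<integral>\<^sup>+z. h z * indicator (D k) z \<partial>\<mu>) \<le> ennreal (C * \<epsilon>) * I k" if k: "k \<ge> J" for k
    proof -
      have ra: "rho (a k) > 0" using at by (simp add: mem_tube_B_iff)
      define R where "R = rho (a k) powr s"
      have R: "R > 0" using ra by (simp add: R_def)
      have "(\<integral>\<^sup>+z. h z * indicator (D k) z \<partial>\<mu>) \<le> (\<integral>\<^sup>+z. (ennreal (1 / R) * (ennreal C * I k)) * indicator (D k) z \<partial>\<mu>)"
      proof (rule nn_integral_mono)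
        fix z
        show "h z * indicator (D k) z \<le> (ennreal (1 / R) * (ennreal C * I k)) * indicator (D k) z"
        proof (cases "z \<in> D k")
          case True
          have "h z = ennreal (1 / R) * ennreal (norm (f z) powr p * R)"
            using R by (simp add: h_def ennreal_mult[symmetric])
          also have "\<dots> \<le> ennreal (1 / R) * (ennreal C * I k)"
            using C(2)[OF f at, of z k] True
            by (intro mult_left_mono) (auto simp: I_def h_def D_def E_def R_def)
          finally show ?thesis using True by simp
        qed simp
      qed
      also have "\<dots> = (ennreal (1 / R) * (ennreal C * I k)) * emeasure \<mu> (D k)"
        by (rule nn_integral_cmult_indicator[OF D])
      also have "\<dots> = (ennreal C * I k) * (emeasure \<mu> (D k) / ennreal R)"
        using R by (simp add: divide_ennreal_def inverse_ennreal divide_inverse mult_ac)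
      also have "\<dots> \<le> (ennreal C * I k) * ennreal \<epsilon>"
        using small[OF k] by (intro mult_left_mono) (auto simp: D_def R_def)
      also have "\<dots> = ennreal (C * \<epsilon>) * I k" using C \<epsilon> by (simp add: ennreal_mult mult_ac)
      finally show ?thesis .
    qed
    have "(\<Sum>k. I (k + J)) = (\<integral>\<^sup>+z. (\<Sum>k. h z * indicator (E (k + J)) z) \<partial>dV \<alpha>)"
      unfolding I_def by (intro nn_integral_suminf[symmetric]) measurable
    also have "\<dots> \<le> (\<integral>\<^sup>+z. h z * ennreal (real N) \<partial>dV \<alpha>)"
    proof (rule nn_integral_mono)
      fix z :: "(complex, 'n) vec" assume "z \<in> space (dV \<alpha>)"
      then have z: "z \<in> tube_B" by (simp add: space_dV)
      define A where "A = {k. z \<in> E (k + J)}"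
      have A: "finite A" "card A \<le> N"
      proof -
        have inj: "inj_on (\<lambda>k. k + J) A" by (simp add: inj_on_def)
        have img: "(\<lambda>k. k + J) ` A \<subseteq> {k. z \<in> bergman_ball (a k) (2 * r)}" by (auto simp: A_def E_def)
        show "finite A" using N[OF z] inj_on_finite[OF inj img] by simp
        show "card A \<le> N" using N[OF z] card_inj_on_le[OF inj img] by simp
      qed
      have "(\<Sum>k. h z * indicator (E (k + J)) z) = (\<Sum>k\<in>A. h z * indicator (E (k + J)) z)"
        by (rule suminf_finite[OF A(1)]) (simp add: A_def)
      also have "\<dots> = (\<Sum>k\<in>A. h z)" by (intro sum.cong) (auto simp: A_def)
      also have "\<dots> = h z * ennreal (real (card A))" by (simp add: ennreal_of_nat_eq_real_of_nat mult.commute)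
      also have "\<dots> \<le> h z * ennreal (real N)" using A by (intro mult_left_mono ennreal_leI) auto
      finally show "(\<Sum>k. h z * indicator (E (k + J)) z) \<le> h z * ennreal (real N)" .
    qed
    also have "\<dots> = (\<integral>\<^sup>+z. h z \<partial>dV \<alpha>) * ennreal (real N)" by (rule nn_integral_multc[OF hV])
    finally have sum_I: "(\<Sum>k. I (k + J)) \<le> (\<integral>\<^sup>+z. h z \<partial>dV \<alpha>) * ennreal (real N)" .
    have "(\<Sum>k. \<integral>\<^sup>+z. h z * indicator (D (k + J)) z \<partial>\<mu>) \<le> (\<Sum>k. ennreal (C * \<epsilon>) * I (k + J))"
      by (intro suminf_le piece) auto
    also have "\<dots> = ennreal (C * \<epsilon>) * (\<Sum>k. I (k + J))"
      by (rule ennreal_suminf_cmult)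
    also have "\<dots> \<le> ennreal (C * \<epsilon>) * ((\<integral>\<^sup>+z. h z \<partial>dV \<alpha>) * ennreal (real N))"
      by (rule mult_left_mono[OF sum_I]) simp
    also have "\<dots> = ennreal (C * real N * \<epsilon>) * (\<integral>\<^sup>+z. h z \<partial>dV \<alpha>)"
      using C \<epsilon> by (simp add: ennreal_mult mult_ac)
    finally have tail: "(\<Sum>k. \<integral>\<^sup>+z. h z * indicator (D (k + J)) z \<partial>\<mu>) \<le>
        ennreal (C * real N * \<epsilon>) * (\<integral>\<^sup>+z. h z \<partial>dV \<alpha>)" .
    have "(\<integral>\<^sup>+z. h z \<partial>\<mu>) \<le> (\<integral>\<^sup>+z. h z * indicator L z + (\<Sum>k. h z * indicator (D (k + J)) z) \<partial>\<mu>)"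
    proof (rule nn_integral_mono)
      fix z assume "z \<in> space \<mu>"
      then have "z \<in> (\<Union>k. D k)" using a by (auto simp: space bergman_lattice_def D_def)
      then obtain k where k: "z \<in> D k" by auto
      show "h z \<le> h z * indicator L z + (\<Sum>k. h z * indicator (D (k + J)) z)"
      proof (cases "k < J")
        case True
        then have "z \<in> L" using k by (auto simp: L_def)
        then show ?thesis by simp
      next
        case False
        then have "h z = h z * indicator (D ((k - J) + J)) z" using k by simp
        also have "\<dots> = sum (\<lambda>k. h z * indicator (D (k + J)) z) {k - J}"
          by (simp only: sum.insert finite.emptyI sum.empty add_0_right empty_iff not_False_eq_True)
        also have "\<dots> \<le> (\<Sum>k. h z * indicator (D (k + J)) z)" by (rule sum_le_suminf) auto
        finally show ?thesis by (simp add: add_increasing)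
      qed
    qed
    also have "\<dots> = (\<integral>\<^sup>+z. h z * indicator L z \<partial>\<mu>) + (\<Sum>k. \<integral>\<^sup>+z. h z * indicator (D (k + J)) z \<partial>\<mu>)"
    proof -
      have "(\<integral>\<^sup>+z. (\<Sum>k. h z * indicator (D (k + J)) z) \<partial>\<mu>) = (\<Sum>k. \<integral>\<^sup>+z. h z * indicator (D (k + J)) z \<partial>\<mu>)"
        by (rule nn_integral_suminf) measurable
      moreover have "(\<integral>\<^sup>+z. h z * indicator L z + (\<Sum>k. h z * indicator (D (k + J)) z) \<partial>\<mu>) =
          (\<integral>\<^sup>+z. h z * indicator L z \<partial>\<mu>) + (\<integral>\<^sup>+z. (\<Sum>k. h z * indicator (D (k + J)) z) \<partial>\<mu>)"
        by (rule nn_integral_add) measurable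
      ultimately show ?thesis by (simp only:)
    qed
    also have "\<dots> \<le> (\<integral>\<^sup>+z. h z * indicator L z \<partial>\<mu>) + ennreal (C * real N * \<epsilon>) * (\<integral>\<^sup>+z. h z \<partial>dV \<alpha>)"
      by (rule add_left_mono[OF tail])
    finally show ?thesis unfolding h_def L_def D_def .
  qed
  \<comment> \<open>The constant combines the local estimate with the overlap number and is fixed
    before f, J and \<epsilon>; hence a small \<epsilon> beats it uniformly over a bounded
    sequence.\<close>
  then show thesis using that[of "C * real N"] C by simp
qed

lemma lattice_averaging_imp_vanishing_carleson:
  fixes \<mu> :: "(complex ^ 'n::{finite,linorder}) measure" and \<alpha> :: real
  assumes sets: "sets \<mu> = sets (restrict_space borel tube_B)" and r: "r > 0" and p: "p \<ge> 1"
    and fin: "\<And>K. compact K \<Longrightarrow> K \<subseteq> tube_B \<Longrightarrow> emeasure \<mu> K < \<infinity>"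
    and a: "bergman_lattice r a"
  defines "s \<equiv> real CARD('n) + \<alpha> + 1"
  assumes lim: "(\<lambda>k. emeasure \<mu> (bergman_ball (a k) r) / ennreal (rho (a k) powr s)) \<longlonglongrightarrow> 0"
  shows "vanishing_carleson p \<alpha> \<mu>"
  unfolding vanishing_carleson_def
proof (intro allI impI, elim conjE exE)
  fix f :: "nat \<Rightarrow> (complex, 'n) vec \<Rightarrow> complex" and M :: real
  assume f: "\<forall>k. f k \<in> bergman_space p \<alpha>" and M: "\<forall>k. bergman_norm p \<alpha> (f k) \<le> M"
    and unif: "\<forall>K. compact K \<and> K \<subseteq> tube_B \<longrightarrow> uniform_limit K f (\<lambda>_. 0) sequentially"
  have at: "a k \<in> tube_B" for k using a by (auto simp: bergman_lattice_def)
  have hol: "holomorphic_vec_on (f k) tube_B" for k using f by (auto simp: bergman_space_def)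
  define X where "X k = (\<integral>\<^sup>+z. ennreal (norm (f k z) powr p) \<partial>\<mu>)" for k
  define m where "m = M powr p"
  have m: "m \<ge> 0" "(\<integral>\<^sup>+z. ennreal (norm (f k z) powr p) \<partial>dV \<alpha>) \<le> ennreal m" for k
    using nn_integral_le_of_bergman_norm[of "f k" p \<alpha> M] f M p by (auto simp: m_def)
  obtain C :: real where C: "C \<ge> 0"
    "\<And>f J (\<epsilon> :: real). holomorphic_vec_on f tube_B \<Longrightarrow> \<epsilon> \<ge> 0 \<Longrightarrow>
      (\<And>k. k \<ge> J \<Longrightarrow> emeasure \<mu> (bergman_ball (a k) r) / ennreal (rho (a k) powr s) \<le> ennreal \<epsilon>) \<Longrightarrow>
      (\<integral>\<^sup>+z. ennreal (norm (f z) powr p) \<partial>\<mu>) \<le>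
      (\<integral>\<^sup>+z. ennreal (norm (f z) powr p) * indicator (\<Union>k<J. bergman_ball (a k) r) z \<partial>\<mu>) +
      ennreal (C * \<epsilon>) * (\<integral>\<^sup>+z. ennreal (norm (f z) powr p) \<partial>dV \<alpha>)"
    using bergman_lattice_sum_estimate[OF sets r p a, of \<alpha>] unfolding s_def by blast
  show "(\<lambda>k. \<integral>\<^sup>+z. ennreal (norm (f k z) powr p) \<partial>\<mu>) \<longlonglongrightarrow> 0"
    unfolding X_def[symmetric]
  proof (rule order_tendstoI)
    fix y :: ennreal assume "0 < y"
    \<comment> \<open>y may be infinite, so a smaller finite target is used.\<close>
    then obtain y' where y': "0 < y'" "y' < y" using dense by blast
    then obtain t where t: "y' = ennreal t" "t > 0"
      by (cases y') auto
    \<comment> \<open>Makes the tail at most t/2 for every f_k at once; the added 1 keeps the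
      denominator positive.\<close>
    define \<epsilon> where "\<epsilon> = t / (2 * (C * m + 1))"
    have Cm: "C * m \<ge> 0" using C m by simp
    have \<epsilon>: "\<epsilon> > 0" using t Cm by (simp add: \<epsilon>_def add_nonneg_pos)
    have \<epsilon>_le: "C * \<epsilon> * m \<le> t / 2"
      using t Cm by (simp add: \<epsilon>_def field_simps)
    obtain J where J: "\<And>k. k \<ge> J \<Longrightarrow> emeasure \<mu> (bergman_ball (a k) r) / ennreal (rho (a k) powr s) < ennreal \<epsilon>"
      using order_tendstoD(2)[OF lim, of "ennreal \<epsilon>"] \<epsilon> by (auto simp: eventually_sequentially)
    define L where "L = (\<Union>k<J. bergman_ball (a k) r)"
    \<comment> \<open>Closed balls instead of the open ones in \<open>L\<close>: compactness is
      needed both for finite measure and for uniform convergence.\<close>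
    define K where "K = (\<Union>k<J. {w \<in> tube_B. bergman_dist (a k) w \<le> r})"
    have K: "compact K" "K \<subseteq> tube_B"
      unfolding K_def using at r by (auto intro!: compact_UN compact_bergman_cball)
    have LK: "L \<subseteq> K" by (force simp: L_def K_def bergman_ball_def)
    have Lm: "L \<in> sets \<mu>"
      unfolding L_def by (intro sets.finite_UN) (auto intro: bergman_ball_measurable[OF sets at r])
    have Km: "K \<in> sets \<mu>"
      unfolding sets using K by (subst sets_restrict_space_iff) (auto simp: borel_tube_B borel_compact)
    have "emeasure \<mu> L \<le> emeasure \<mu> K" by (rule emeasure_mono[OF LK Km])
    then have "emeasure \<mu> L < \<infinity>" using fin[OF K] by simp
    then obtain l where l: "emeasure \<mu> L = ennreal l" "l \<ge> 0"
      by (cases "emeasure \<mu> L") auto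
    \<comment> \<open>Makes the head, at most \<eta>^p times the measure l of \<open>L\<close>,
      smaller than t/2; here too the added 1 guards the case l = 0.\<close>
    define \<eta> where "\<eta> = (t / 2 / (l + 1)) powr (1 / p)"
    have \<eta>: "\<eta> > 0" "\<eta> powr p * l < t / 2"
    proof -
      show "\<eta> > 0" using t l by (simp add: \<eta>_def)
      have "\<eta> powr p = t / 2 / (l + 1)" using t l p by (simp add: \<eta>_def powr_powr)
      then have "\<eta> powr p * (l + 1) = t / 2" using l by (simp del: divide_divide_eq_left)
      moreover have "0 < \<eta> powr p" using \<open>\<eta> > 0\<close> by simp
      ultimately show "\<eta> powr p * l < t / 2" unfolding distrib_left by linarith
    qed
    have "eventually (\<lambda>k. \<forall>z\<in>K. dist (f k z) 0 < \<eta>) sequentially"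
      using unif K \<eta>(1) unfolding uniform_limit_iff by blast
    then show "eventually (\<lambda>k. X k < y) sequentially"
    proof eventually_elim
      case (elim k)
      have "X k \<le> (\<integral>\<^sup>+z. ennreal (norm (f k z) powr p) * indicator L z \<partial>\<mu>) +
          ennreal (C * \<epsilon>) * (\<integral>\<^sup>+z. ennreal (norm (f k z) powr p) \<partial>dV \<alpha>)"
        unfolding X_def L_def using \<epsilon> by (intro C(2)[OF hol]) (auto intro: less_imp_le J)
      also have "\<dots> \<le> ennreal (\<eta> powr p) * emeasure \<mu> L + ennreal (C * \<epsilon>) * ennreal m"
      proof (intro add_mono mult_left_mono m(2))
        have "(\<integral>\<^sup>+z. ennreal (norm (f k z) powr p) * indicator L z \<partial>\<mu>) \<le>
          (\<integral>\<^sup>+z. ennreal (\<eta> powr p) * indicator L z \<partial>\<mu>)"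
        proof (rule nn_integral_mono)
          fix z
          show "ennreal (norm (f k z) powr p) * indicator L z \<le> ennreal (\<eta> powr p) * indicator L z"
          proof (cases "z \<in> L")
            case True
            then have "norm (f k z) < \<eta>" using elim LK by auto
            then have "norm (f k z) powr p \<le> \<eta> powr p" using p by (intro powr_mono2) auto
            then show ?thesis using True by (simp add: ennreal_leI)
          qed simp
        qed
        also have "\<dots> = ennreal (\<eta> powr p) * emeasure \<mu> L" by (rule nn_integral_cmult_indicator[OF Lm])
        finally show "(\<integral>\<^sup>+z. ennreal (norm (f k z) powr p) * indicator L z \<partial>\<mu>) \<le>
          ennreal (\<eta> powr p) * emeasure \<mu> L" .
      qed simp
      also have "\<dots> = ennreal (\<eta> powr p * l + C * \<epsilon> * m)"
        using l C \<epsilon> m(1) by (simp add: ennreal_mult ennreal_plus)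
      also have "\<dots> \<le> ennreal t" using \<eta>(2) \<epsilon>_le by (intro ennreal_leI) linarith
      also have "\<dots> < y" using y' t by simp
      finally show ?case .
    qed
  qed simp
qed

text \<open>Finiteness on compact sets is part of how a positive Borel measure is read. Conditions
  (3) and (4) do not see \<mu> away from the boundary: an infinite point mass inside the tube
  satisfies both, but neither (1) nor (2).\<close>

theorem theorem4p2:
  fixes \<mu> :: "(complex ^ 'n::{finite,linorder}) measure"
    and p r \<alpha> :: real
  assumes "1 < p" and "r > 0" and "\<alpha> > -1"
    and borel_measure: "sets \<mu> = sets (restrict_space borel tube_B)"
    and locally_finite: "\<And>K. compact K \<Longrightarrow> K \<subseteq> tube_B \<Longrightarrow> emeasure \<mu> K < \<infinity>"
  defines "s \<equiv> real CARD('n) + \<alpha> + 1"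
  defines "cond1 \<equiv> vanishing_carleson p \<alpha> \<mu>"
  defines "cond2 \<equiv>
      ((\<lambda>a. \<integral>\<^sup>+ z. ennreal (rho a powr s / norm (rho2 z a) powr (2 * s)) \<partial>\<mu>) \<longlongrightarrow> 0) to_boundary"
  defines "cond3 \<equiv>
      ((\<lambda>a. emeasure \<mu> (bergman_ball a r) / ennreal (rho a powr s)) \<longlongrightarrow> 0) to_boundary"
  defines "cond4 \<equiv> (\<lambda>a :: nat \<Rightarrow> complex ^ 'n::{finite,linorder}.
      (\<lambda>k. emeasure \<mu> (bergman_ball (a k) r) / ennreal (rho (a k) powr s)) \<longlonglongrightarrow> 0)"
  shows "(cond1 \<longleftrightarrow> cond2) \<and> (cond1 \<longleftrightarrow> cond3) \<and>
         (cond1 \<longleftrightarrow> (\<forall>a. bergman_lattice r a \<longrightarrow> cond4 a)) \<and>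
         (\<forall>a. bergman_lattice r a \<longrightarrow> (cond1 \<longleftrightarrow> cond4 a))"
proof -
  have s: "s > 0" using \<open>\<alpha> > -1\<close> by (simp add: s_def)
  have space: "space \<mu> = tube_B"
    using sets_eq_imp_space_eq[OF borel_measure] by (simp add: space_restrict_space)
  have 12: cond2 if cond1
    using vanishing_carleson_imp_berezin[OF \<open>\<alpha> > -1\<close> _ space, of p] that \<open>1 < p\<close>
    unfolding cond1_def cond2_def s_def by simp
  have 23: cond3 if cond2
    using berezin_imp_averaging[OF borel_measure \<open>r > 0\<close> s] that unfolding cond2_def cond3_def .
  have 34: "cond4 a" if cond3 "bergman_lattice r a" for a
    using filterlim_compose[OF that(1)[unfolded cond3_def] bergman_lattice_to_boundary[OF that(2) \<open>r > 0\<close>]]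
    unfolding cond4_def .
  have 41: cond1 if "bergman_lattice r a" "cond4 a" for a
    using lattice_averaging_imp_vanishing_carleson[OF borel_measure \<open>r > 0\<close> _ locally_finite that(1)]
      that(2) \<open>1 < p\<close> unfolding cond1_def cond4_def s_def by simp
  \<comment> \<open>Without a lattice, (4) quantified over all lattices would hold vacuously and
    could not give (1).\<close>
  obtain a0 :: "nat \<Rightarrow> (complex, 'n) vec" where "bergman_lattice r a0"
    using ex_bergman_lattice[OF \<open>r > 0\<close>] by blast
  with 12 23 34 41 show ?thesis by blast
qed

end
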